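(* Let $n\ge 1$, $\theta>1/2$, and $u_1\in L^2(\mathbf{R}^n)\cap L^{1,1}(\mathbf{R}^n)$. Let $u$ be the unique (mild) solution of $$u_{tt}-\Delta u+L_\theta u_t=0\ \text{ in }(0,\infty)\times\mathbf{R}^n,\qquad u(0,x)=0,\quad u_t(0,x)=u_1(x).$$ Put $P_1=\int_{\mathbf{R}^n}u_1(x)\,dx$ and $I_0=\|u_1\|_{1,1}+\|u_1\|_{L^2}$. Then there is a constant $C_{n,\theta}>0$ (depending only on $n$ and $\theta$) such that for all sufficiently large $t$ $$C_{n,\theta}|P_1|\,t^{-\frac{n}{4\theta}}\le\|u_t(t,\cdot)\|_{L^2}+\|\nabla u(t,\cdot)\|_{L^2}\le C_{n,\theta}^{-1}I_0\,t^{-\frac{n}{4\theta}} .$$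
   Context: The Fourier transform is $\hat f(\xi)=\int_{\mathbf{R}^n}e^{-ix\cdot\xi}f(x)\,dx$, with inverse $\mathcal{F}^{-1}_{\xi\to x}$. For $\theta>0$, $L_\theta$ is the nonnegative self-adjoint operator on $L^2(\mathbf{R}^n)$ given by $L_\theta f=\mathcal{F}^{-1}_{\xi\to x}\big(\log(1+|\xi|^{2\theta})\hat f(\xi)\big)$, with domain $\{f\in L^2:\int_{\mathbf{R}^n}(\log(1+|\xi|^{2\theta}))^2|\hat f(\xi)|^2d\xi<\infty\}$. For $u_1\in L^2(\mathbf{R}^n)$ the Cauchy problem has a unique mild solution $u\in C([0,\infty);H^1(\mathbf{R}^n))\cap C^1([0,\infty);L^2(\mathbf{R}^n))$; its Fourier transform in $x$ solves, for a.e. $\xi$, $\hat u_{tt}+|\xi|^2\hat u+\log(1+|\xi|^{2\theta})\hat u_t=0$, $\hat u(0,\xi)=0$, $\hat u_t(0,\xi)=\hat u_1(\xi)$. The space $L^{1,1}(\mathbf{R}^n)$ consists of $f\in L^1(\mathbf{R}^n)$ with $\|f\|_{1,1}:=\int_{\mathbf{R}^n}(1+|x|)|f(x)|\,dx<\infty$. "For all sufficiently large $t$" (the paper's "$t\gg1$") means for all $t\ge t_0$ for some $t_0$, which may depend on $n$, $\theta$ and $u_1$. *)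

theory Defs
  imports "HOL-Analysis.Analysis"
begin

text \<open>
  Elements of the function spaces are represented by functions, i.e. by representatives of their
  classes modulo equality almost everywhere. Everything below that mentions such elements is
  invariant under changing representatives on null sets.
\<close>

definition square_integrable :: "(real^'n \<Rightarrow> 'b::real_normed_vector) \<Rightarrow> bool" where
  "square_integrable f \<longleftrightarrow>
     f \<in> borel_measurable lebesgue \<and> integrable lebesgue (\<lambda>x. (norm (f x))\<^sup>2)"

definition L2_norm :: "(real^'n \<Rightarrow> 'b::real_normed_vector) \<Rightarrow> real" where
  "L2_norm f = sqrt (LINT x|lebesgue. (norm (f x))\<^sup>2)"

text \<open>The membership conditions exclude the junk value \<open>L2_norm h = 0\<close> for \<open>h\<close> outside of $L^2$.\<close>

definition L2_tendsto ::
  "('i \<Rightarrow> real^'n \<Rightarrow> 'b::real_normed_vector) \<Rightarrow> (real^'n \<Rightarrow> 'b) \<Rightarrow> 'i filter \<Rightarrow> bool" where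
  "L2_tendsto F f net \<longleftrightarrow>
     (\<forall>\<^sub>F i in net. square_integrable (F i)) \<and> square_integrable f \<and>
     ((\<lambda>i. L2_norm (\<lambda>x. F i x - f x)) \<longlongrightarrow> 0) net"

definition L11 :: "(real^'n \<Rightarrow> complex) \<Rightarrow> bool" where
  "L11 f \<longleftrightarrow> integrable lebesgue f \<and> integrable lebesgue (\<lambda>x. (1 + norm x) * norm (f x))"

definition L11_norm :: "(real^'n \<Rightarrow> complex) \<Rightarrow> real" where
  "L11_norm f = (LINT x|lebesgue. (1 + norm x) * norm (f x))"


section \<open>The Fourier transform and the operator $L_\theta$\<close>

definition fourier :: "(real^'n \<Rightarrow> complex) \<Rightarrow> real^'n \<Rightarrow> complex" where
  "fourier f \<xi> = (LINT x|lebesgue. exp (- \<i> * complex_of_real (x \<bullet> \<xi>)) * f x)"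

text \<open>
  The Fourier transform on $L^2$ is the continuous extension of the one on $L^1 \cap L^2$:
  \<open>is_fourier f g\<close> says that \<open>g\<close> represents the transform of \<open>f\<close>.
\<close>

definition is_fourier :: "(real^'n \<Rightarrow> complex) \<Rightarrow> (real^'n \<Rightarrow> complex) \<Rightarrow> bool" where
  "is_fourier f g \<longleftrightarrow>
     (\<exists>F :: nat \<Rightarrow> real^'n \<Rightarrow> complex.
        (\<forall>k. integrable lebesgue (F k)) \<and>
        L2_tendsto F f sequentially \<and>
        L2_tendsto (\<lambda>k. fourier (F k)) g sequentially)"

text \<open>
  \<open>L_op \<theta> f g\<close>: \<open>f\<close> lies in the domain of $L_\theta$ and $L_\theta f = g$. The domain
  condition is contained in the second conjunct, which requires the product to be in $L^2$.
\<close>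

definition L_op :: "real \<Rightarrow> (real^'n \<Rightarrow> complex) \<Rightarrow> (real^'n \<Rightarrow> complex) \<Rightarrow> bool" where
  "L_op \<theta> f g \<longleftrightarrow>
     (\<exists>fh. is_fourier f fh \<and>
           is_fourier g (\<lambda>\<xi>. complex_of_real (ln (1 + norm \<xi> powr (2 * \<theta>))) * fh \<xi>))"


section \<open>Sobolev spaces\<close>

text \<open>Weak derivatives are tested against compactly supported $C^1$ functions \<open>\<phi>\<close>.\<close>

definition has_weak_gradient :: "(real^'n \<Rightarrow> complex) \<Rightarrow> (real^'n \<Rightarrow> complex^'n) \<Rightarrow> bool" where
  "has_weak_gradient f G \<longleftrightarrow>
     square_integrable f \<and> square_integrable G \<and>
     (\<forall>\<phi> D. (\<forall>x. GDERIV \<phi> x :> D x) \<longrightarrow> continuous_on UNIV D \<longrightarrow> compact (closure {x. \<phi> x \<noteq> 0}) \<longrightarrow>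
        (\<forall>j. (LINT x|lebesgue. (D x $ j) *\<^sub>R f x) = - (LINT x|lebesgue. \<phi> x *\<^sub>R (G x $ j))))"

definition in_H1 :: "(real^'n \<Rightarrow> complex) \<Rightarrow> bool" where
  "in_H1 f \<longleftrightarrow> (\<exists>G. has_weak_gradient f G)"

definition weak_gradient :: "(real^'n \<Rightarrow> complex) \<Rightarrow> real^'n \<Rightarrow> complex^'n" where
  "weak_gradient f = (SOME G. has_weak_gradient f G)"

definition H1_tendsto ::
  "('i \<Rightarrow> real^'n \<Rightarrow> complex) \<Rightarrow> (real^'n \<Rightarrow> complex) \<Rightarrow> 'i filter \<Rightarrow> bool" where
  "H1_tendsto F f net \<longleftrightarrow>
     (\<forall>\<^sub>F i in net. in_H1 (F i)) \<and> in_H1 f \<and> L2_tendsto F f net \<and>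
     L2_tendsto (\<lambda>i. weak_gradient (F i)) (weak_gradient f) net"

text \<open>\<open>has_laplacian f h\<close>: \<open>f\<close> lies in $H^2$ and $\Delta f = h$.\<close>

definition has_laplacian :: "(real^'n \<Rightarrow> complex) \<Rightarrow> (real^'n \<Rightarrow> complex) \<Rightarrow> bool" where
  "has_laplacian f h \<longleftrightarrow>
     (\<exists>G H. has_weak_gradient f G \<and>
            (\<forall>j. has_weak_gradient (\<lambda>x. G x $ j) (H j)) \<and>
            (\<forall>x. h x = (\<Sum>j\<in>UNIV. H j x $ j)))"


section \<open>Mild solutions\<close>

text \<open>
  Derivatives with respect to time of $L^2$-valued functions on $[0,\infty)$, one-sided at \<open>0\<close>.
\<close>

definition has_time_deriv ::
  "(real \<Rightarrow> real^'n \<Rightarrow> complex) \<Rightarrow> (real^'n \<Rightarrow> complex) \<Rightarrow> real \<Rightarrow> bool" where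
  "has_time_deriv u v t \<longleftrightarrow>
     L2_tendsto (\<lambda>s x. (u s x - u t x) / complex_of_real (s - t)) v (at t within {0..})"

definition time_deriv :: "(real \<Rightarrow> real^'n \<Rightarrow> complex) \<Rightarrow> real \<Rightarrow> real^'n \<Rightarrow> complex" where
  "time_deriv u t = (SOME v. has_time_deriv u v t)"

text \<open>
  The Cauchy problem is the abstract equation $U' = AU$, $U(0) = (0, u_1)$, for $U = (u, u_t)$ in
  $H^1 \times L^2$, where $A(u, v) = (v, \Delta u - L_\theta v)$ with domain $H^2 \times H^1$.
  A mild solution is a continuous $U$ such that $\int_0^t U(s)\,ds$ lies in the domain of $A$ and
  $U(t) = U(0) + A \int_0^t U(s)\,ds$ for all $t \ge 0$. As $\int_0^t u_t(s)\,ds = u(t)$, the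
  second component of this identity reads
  \[ u_t(t) = u_1 + \Delta \int_0^t u(s)\,ds - L_\theta u(t). \]
  Below, $w(t) = \int_0^t u(s)\,ds$ is the antiderivative of \<open>u\<close> as an $L^2$-valued
  function that vanishes at \<open>0\<close>; it agrees with the integral because \<open>u\<close> is continuous.
\<close>

definition mild_solution ::
  "real \<Rightarrow> (real^'n \<Rightarrow> complex) \<Rightarrow> (real \<Rightarrow> real^'n \<Rightarrow> complex) \<Rightarrow> bool" where
  "mild_solution \<theta> u1 u \<longleftrightarrow>
     (\<forall>t\<ge>0. H1_tendsto u (u t) (at t within {0..})) \<and>
     (\<forall>t\<ge>0. \<exists>v. has_time_deriv u v t) \<and>
     (\<forall>t\<ge>0. L2_tendsto (time_deriv u) (time_deriv u t) (at t within {0..})) \<and>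
     (AE x in lebesgue. u 0 x = 0) \<and>
     (AE x in lebesgue. time_deriv u 0 x = u1 x) \<and>
     (\<exists>w. (AE x in lebesgue. w 0 x = 0) \<and>
          (\<forall>t\<ge>0. has_time_deriv w (u t) t) \<and>
          (\<forall>t\<ge>0. \<exists>h g. has_laplacian (w t) h \<and> L_op \<theta> (u t) g \<and>
             (AE x in lebesgue. time_deriv u t x = u1 x + h x - g x)))"

end

theory Submission
  imports Defs "HOL-Probability.Characteristic_Functions" "HOL-Real_Asymp.Real_Asymp"
begin

text \<open>
  On the Fourier side the energy density $P = |\hat u_t|^2 + |\xi|^2 |\hat u|^2$ can be compared
  pointwise with the initial datum, without solving the characteristic equation. Write
  $a = \log(1 + |\xi|^{2\theta})$; as $\theta > 1/2$, $a \le K |\xi|$ with $K = 1 + 2\theta$.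
  From $P' = -2a|\hat u_t|^2 \ge -2aP$ one gets $P(t) \ge e^{-2at} |\hat u_1|^2$. The perturbed
  energy $G = P + (a/K)\, \mathrm{Re}(\hat u\, \overline{\hat u_t}) + (a^2/2K) |\hat u|^2$ is
  comparable to $P$ and satisfies $G' \le -(a/2K^2) G$, so $P(t) \le 2 e^{-at/2K^2} |\hat u_1|^2$.
  Integrating over $\xi$, the region where $|\xi|^{2\theta}$ is of size $1/t$ has volume of order
  $t^{-n/2\theta}$ and gives both rates, as $\hat u_1$ is bounded by the $L^1$ norm and
  $\hat u_1(0) = P_1$; on $|\xi| \ge 1$ the decay is exponential.

  A mild solution is differentiable in time only as an $L^2$-valued function, so the differential
  inequalities are proved for integrals over arbitrary measurable sets of bounded frequencies on
  which $a$ is bounded by a constant on one side, and the pointwise bounds are deduced from these.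
\<close>

section \<open>Square-integrable functions\<close>

text \<open>The mild equation expresses \<open>v\<close> through \<open>w\<close>, the
  antiderivative of \<open>u\<close>, and says nothing about a time derivative of \<open>v\<close>.
  On the Fourier side, however, \<open>vh\<close> is a time-independent function minus
  \<open>|\<xi>|^2 wh\<close> minus \<open>a uh\<close>, and \<open>wh\<close>, \<open>uh\<close>
  have the derivatives \<open>uh\<close>, \<open>vh\<close>. On a ball of frequencies both factors
  are bounded multipliers of L^2, so there \<open>vh\<close> is differentiable and solves the
  second-order equation; the resulting bounds do not depend on the ball.

  The condition \<theta> > 1/2 acts through \<open>a \<le> K |\<xi>|\<close>: damping never exceeds
  the frequency by more than a fixed factor, so both parts of the energy decay at a rate comparable
  with \<open>a\<close>. Stronger damping would leave the potential part decaying only like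
  \<open>|\<xi>|^2 / a\<close>. The cross term of G passes the dissipation of the kinetic part on to
  the potential part.

  Since solutions are stated with weak derivatives and with the transform on L^2 as a limit,
  Plancherel's theorem, its extension to L^2 and the multiplier of the weak gradient are derived as
  well, from Gaussians and cutoffs.\<close>

lemma square_integrableD:
  assumes "square_integrable f"
  shows "f \<in> borel_measurable lebesgue" "integrable lebesgue (\<lambda>x. (norm (f x))\<^sup>2)"
  using assms by (auto simp: square_integrable_def)

lemma L2_norm_nonneg [simp]: "0 \<le> L2_norm f"
  by (simp add: L2_norm_def)

lemma L2_norm_power2: "(L2_norm f)\<^sup>2 = (LINT x|lebesgue. (norm (f x))\<^sup>2)"
  by (simp add: L2_norm_def)

lemma square_integrable_bound:
  fixes f :: "real^'n \<Rightarrow> 'b::euclidean_space" and g :: "real^'n \<Rightarrow> 'c::euclidean_space"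
  assumes f: "f \<in> borel_measurable lebesgue" and g: "square_integrable g"
    and le: "AE x in lebesgue. norm (f x) \<le> C * norm (g x)"
  shows "square_integrable f" "0 \<le> C \<Longrightarrow> L2_norm f \<le> C * L2_norm g"
proof -
  have le2: "AE x in lebesgue. (norm (f x))\<^sup>2 \<le> C\<^sup>2 * (norm (g x))\<^sup>2"
    using le by eventually_elim (metis norm_ge_zero power_mono power_mult_distrib)
  have i: "integrable lebesgue (\<lambda>x. C\<^sup>2 * (norm (g x))\<^sup>2)"
    using square_integrableD(2)[OF g] by simp
  have j: "integrable lebesgue (\<lambda>x. (norm (f x))\<^sup>2)"
    by (rule Bochner_Integration.integrable_bound[OF i]) (use f le2 in auto)
  then show "square_integrable f" using f by (simp add: square_integrable_def)
  assume C: "0 \<le> C"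
  have "(L2_norm f)\<^sup>2 \<le> (LINT x|lebesgue. C\<^sup>2 * (norm (g x))\<^sup>2)"
    unfolding L2_norm_power2 by (rule integral_mono_AE[OF j i le2])
  also have "\<dots> = (C * L2_norm g)\<^sup>2" by (simp add: L2_norm_power2 power_mult_distrib)
  finally show "L2_norm f \<le> C * L2_norm g"
    by (rule power2_le_imp_le) (use C in simp)
qed

lemma square_integrable_cong_AE:
  fixes f :: "real^'n \<Rightarrow> 'b::euclidean_space"
  assumes "AE x in lebesgue. f x = g x" "square_integrable f"
  shows "square_integrable g"
proof -
  have "g \<in> borel_measurable lebesgue"
    by (rule borel_measurable_AE[OF square_integrableD(1)[OF assms(2)] assms(1)])
  then show ?thesis
    by (rule square_integrable_bound(1)[where C = 1, OF _ assms(2)]) (use assms(1) in auto)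
qed

lemma L2_norm_cong_AE:
  fixes f :: "real^'n \<Rightarrow> 'b::euclidean_space"
  assumes "AE x in lebesgue. f x = g x" "square_integrable f"
  shows "L2_norm f = L2_norm g"
proof -
  have "square_integrable g" by (rule square_integrable_cong_AE[OF assms])
  then have "(LINT x|lebesgue. (norm (f x))\<^sup>2) = (LINT x|lebesgue. (norm (g x))\<^sup>2)"
    using assms by (intro integral_cong_AE) (auto simp: square_integrable_def)
  then show ?thesis by (simp add: L2_norm_def)
qed

lemma L2_norm_eq_0:
  fixes f :: "real^'n \<Rightarrow> 'b::euclidean_space"
  assumes "square_integrable f" "L2_norm f = 0"
  shows "AE x in lebesgue. f x = 0"
proof -
  have "(LINT x|lebesgue. (norm (f x))\<^sup>2) = 0" using assms(2) by (simp add: L2_norm_def)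
  then show ?thesis
    using integral_nonneg_eq_0_iff_AE[OF square_integrableD(2)[OF assms(1)]] by auto
qed

lemma L2_norm_zero [simp]: "L2_norm (\<lambda>x. 0) = 0"
  by (simp add: L2_norm_def)

lemma square_integrable_zero [simp]: "square_integrable (\<lambda>x. 0)"
  by (simp add: square_integrable_def)

lemma square_integrable_add:
  fixes f :: "real^'n \<Rightarrow> 'b::euclidean_space"
  assumes "square_integrable f" "square_integrable g"
  shows "square_integrable (\<lambda>x. f x + g x)"
proof -
  note [measurable] = square_integrableD(1)[OF assms(1)] square_integrableD(1)[OF assms(2)]
  have "(norm (f x + g x))\<^sup>2 \<le> 2 * (norm (f x))\<^sup>2 + 2 * (norm (g x))\<^sup>2" for x
  proof -
    have "(norm (f x + g x))\<^sup>2 \<le> (norm (f x) + norm (g x))\<^sup>2"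
      by (simp add: norm_triangle_ineq power_mono)
    also have "\<dots> \<le> 2 * (norm (f x))\<^sup>2 + 2 * (norm (g x))\<^sup>2"
      using sum_squares_bound[of "norm (f x)" "norm (g x)"] by (simp add: power2_sum)
    finally show ?thesis .
  qed
  moreover have i: "integrable lebesgue (\<lambda>x. 2 * (norm (f x))\<^sup>2 + 2 * (norm (g x))\<^sup>2)"
    using square_integrableD(2)[OF assms(1)] square_integrableD(2)[OF assms(2)] by simp
  ultimately have "integrable lebesgue (\<lambda>x. (norm (f x + g x))\<^sup>2)"
    by (intro Bochner_Integration.integrable_bound[OF i]) auto
  then show ?thesis by (simp add: square_integrable_def)
qed

lemma square_integrable_norm:
  fixes f :: "real^'n \<Rightarrow> 'b::euclidean_space"
  shows "square_integrable f \<Longrightarrow> square_integrable (\<lambda>x. norm (f x))"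
  by (auto simp: square_integrable_def)

lemma square_integrable_uminus:
  fixes f :: "real^'n \<Rightarrow> 'b::euclidean_space"
  shows "square_integrable f \<Longrightarrow> square_integrable (\<lambda>x. - f x)"
  by (auto simp: square_integrable_def)

lemma square_integrable_diff:
  fixes f :: "real^'n \<Rightarrow> 'b::euclidean_space"
  assumes "square_integrable f" "square_integrable g"
  shows "square_integrable (\<lambda>x. f x - g x)"
  using square_integrable_add[OF assms(1) square_integrable_uminus[OF assms(2)]] by simp

lemma square_integrable_mult_bounded:
  fixes f :: "real^'n \<Rightarrow> complex"
  assumes "m \<in> borel_measurable lebesgue" "\<And>x. norm (m x) \<le> C" "square_integrable f"
  shows "square_integrable (\<lambda>x. m x * f x)" "L2_norm (\<lambda>x. m x * f x) \<le> C * L2_norm f"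
proof -
  note [measurable] = assms(1) square_integrableD(1)[OF assms(3)]
  have *: "AE x in lebesgue. norm (m x * f x) \<le> C * norm (f x)"
    using assms(2) by (auto simp: norm_mult mult_right_mono)
  have "0 \<le> C" using assms(2) norm_ge_zero order_trans by blast
  then show "square_integrable (\<lambda>x. m x * f x)" "L2_norm (\<lambda>x. m x * f x) \<le> C * L2_norm f"
    using square_integrable_bound[OF _ assms(3) *] by auto
qed

lemma square_integrable_cmult:
  fixes f :: "real^'n \<Rightarrow> complex"
  assumes "square_integrable f"
  shows "square_integrable (\<lambda>x. c * f x)" "L2_norm (\<lambda>x. c * f x) = norm c * L2_norm f"
proof -
  show "square_integrable (\<lambda>x. c * f x)"
    by (rule square_integrable_mult_bounded[OF _ _ assms]) auto
  show "L2_norm (\<lambda>x. c * f x) = norm c * L2_norm f"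
    by (simp add: L2_norm_def norm_mult power_mult_distrib real_sqrt_mult)
qed

lemma L2_norm_minus_commute: "L2_norm (\<lambda>x. f x - g x) = L2_norm (\<lambda>x. g x - f x)"
  by (simp add: L2_norm_def norm_minus_commute)

lemma L2_Cauchy_Schwarz:
  fixes f :: "real^'n \<Rightarrow> 'b::euclidean_space" and g :: "real^'n \<Rightarrow> 'c::euclidean_space"
  assumes f: "square_integrable f" and g: "square_integrable g"
  shows "integrable lebesgue (\<lambda>x. norm (f x) * norm (g x))"
    "(LINT x|lebesgue. norm (f x) * norm (g x)) \<le> L2_norm f * L2_norm g"
proof -
  note [measurable] = square_integrableD(1)[OF f] square_integrableD(1)[OF g]
  have "norm (f x) * norm (g x) \<le> (norm (f x))\<^sup>2 + (norm (g x))\<^sup>2" for x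
    using sum_squares_bound[of "norm (f x)" "norm (g x)"]
      mult_nonneg_nonneg[OF norm_ge_zero[of "f x"] norm_ge_zero[of "g x"]] by linarith
  moreover have j: "integrable lebesgue (\<lambda>x. (norm (f x))\<^sup>2 + (norm (g x))\<^sup>2)"
    using square_integrableD(2)[OF f] square_integrableD(2)[OF g] by simp
  ultimately show i: "integrable lebesgue (\<lambda>x. norm (f x) * norm (g x))"
    by (intro Bochner_Integration.integrable_bound[OF j]) auto
  \<comment> \<open>The inequality is taken for extended nonnegative integrals; the integrability
    just shown and that of the two squares make all three finite, so it can be read in the
    reals.\<close>
  have "(\<integral>\<^sup>+x. ennreal (norm (f x)) * ennreal (norm (g x)) \<partial>lebesgue)\<^sup>2 \<le>
        (\<integral>\<^sup>+x. (ennreal (norm (f x)))\<^sup>2 \<partial>lebesgue) * (\<integral>\<^sup>+x. (ennreal (norm (g x)))\<^sup>2 \<partial>lebesgue)"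
    by (rule Cauchy_Schwarz_nn_integral) auto
  also have "(\<integral>\<^sup>+x. ennreal (norm (f x)) * ennreal (norm (g x)) \<partial>lebesgue) =
      ennreal (LINT x|lebesgue. norm (f x) * norm (g x))"
    using nn_integral_eq_integral[OF i] by (simp add: ennreal_mult)
  also have "(\<integral>\<^sup>+x. (ennreal (norm (f x)))\<^sup>2 \<partial>lebesgue) = ennreal ((L2_norm f)\<^sup>2)"
    using nn_integral_eq_integral[OF square_integrableD(2)[OF f]]
    by (simp add: ennreal_power L2_norm_power2)
  also have "(\<integral>\<^sup>+x. (ennreal (norm (g x)))\<^sup>2 \<partial>lebesgue) = ennreal ((L2_norm g)\<^sup>2)"
    using nn_integral_eq_integral[OF square_integrableD(2)[OF g]]
    by (simp add: ennreal_power L2_norm_power2)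
  finally have "(LINT x|lebesgue. norm (f x) * norm (g x))\<^sup>2 \<le> (L2_norm f)\<^sup>2 * (L2_norm g)\<^sup>2"
    by (simp add: ennreal_power ennreal_mult[symmetric] integral_nonneg_AE)
  then show "(LINT x|lebesgue. norm (f x) * norm (g x)) \<le> L2_norm f * L2_norm g"
    by (metis L2_norm_nonneg mult_nonneg_nonneg power2_le_imp_le power_mult_distrib)
qed

lemma L2_norm_triangle:
  fixes f g :: "real^'n \<Rightarrow> 'b::euclidean_space"
  assumes f: "square_integrable f" and g: "square_integrable g"
  shows "L2_norm (\<lambda>x. f x + g x) \<le> L2_norm f + L2_norm g"
proof -
  note CS = L2_Cauchy_Schwarz[OF f g]
  note sq = square_integrableD(2)[OF f] square_integrableD(2)[OF g]
  have "(L2_norm (\<lambda>x. f x + g x))\<^sup>2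
      \<le> (LINT x|lebesgue. (norm (f x))\<^sup>2 + (norm (g x))\<^sup>2 + 2 * (norm (f x) * norm (g x)))"
    unfolding L2_norm_power2
  proof (rule integral_mono)
    show "integrable lebesgue (\<lambda>x. (norm (f x + g x))\<^sup>2)"
      using square_integrable_add[OF f g] by (rule square_integrableD)
    show "integrable lebesgue (\<lambda>x. (norm (f x))\<^sup>2 + (norm (g x))\<^sup>2 + 2 * (norm (f x) * norm (g x)))"
      using CS sq by simp
    show "(norm (f x + g x))\<^sup>2 \<le> (norm (f x))\<^sup>2 + (norm (g x))\<^sup>2 + 2 * (norm (f x) * norm (g x))" for x
      by (metis mult.assoc norm_ge_zero norm_triangle_ineq power2_sum power_mono)
  qed
  also have "\<dots> = (L2_norm f)\<^sup>2 + (L2_norm g)\<^sup>2 + 2 * (LINT x|lebesgue. norm (f x) * norm (g x))"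
    using CS sq by (simp add: L2_norm_power2)
  also have "\<dots> \<le> (L2_norm f + L2_norm g)\<^sup>2"
    using CS(2) by (simp add: power2_sum)
  finally show ?thesis by (rule power2_le_imp_le) simp
qed

lemma L2_norm_triangle_diff:
  fixes f g h :: "real^'n \<Rightarrow> 'b::euclidean_space"
  assumes "square_integrable f" "square_integrable g" "square_integrable h"
  shows "L2_norm (\<lambda>x. f x - h x) \<le> L2_norm (\<lambda>x. f x - g x) + L2_norm (\<lambda>x. g x - h x)"
  using L2_norm_triangle[OF square_integrable_diff[OF assms(1,2)] square_integrable_diff[OF assms(2,3)]]
  by simp

lemma L2_norm_diff_bound:
  fixes f g :: "real^'n \<Rightarrow> 'b::euclidean_space"
  assumes "square_integrable f" "square_integrable g"
  shows "\<bar>L2_norm f - L2_norm g\<bar> \<le> L2_norm (\<lambda>x. f x - g x)"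
  using L2_norm_triangle[OF square_integrable_diff[OF assms] assms(2)]
    L2_norm_triangle[OF square_integrable_diff[OF assms(2,1)] assms(1)]
    L2_norm_minus_commute[of f g]
  by auto

section \<open>Convergence in L^2 and completeness\<close>

lemma L2_tendstoD:
  assumes "L2_tendsto F f net"
  shows "eventually (\<lambda>i. square_integrable (F i)) net" "square_integrable f"
    "((\<lambda>i. L2_norm (\<lambda>x. F i x - f x)) \<longlongrightarrow> 0) net"
  using assms by (auto simp: L2_tendsto_def)

text \<open>Maps that are Lipschitz for the L^2 norm preserve convergence. This serves bounded
  multipliers, the Fourier transform and changes on null sets; the two value types may
  differ.\<close>

lemma L2_tendsto_bound:
  fixes f :: "real^'n \<Rightarrow> 'b::euclidean_space" and g :: "real^'n \<Rightarrow> 'c::euclidean_space"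
  assumes "L2_tendsto F f net" "eventually (\<lambda>i. square_integrable (G i)) net" "square_integrable g"
    and le: "eventually (\<lambda>i. L2_norm (\<lambda>x. G i x - g x) \<le> C * L2_norm (\<lambda>x. F i x - f x)) net"
  shows "L2_tendsto G g net"
proof -
  have "((\<lambda>i. L2_norm (\<lambda>x. G i x - g x)) \<longlongrightarrow> 0) net"
  proof (rule tendsto_sandwich[OF _ le tendsto_const])
    show "((\<lambda>i. C * L2_norm (\<lambda>x. F i x - f x)) \<longlongrightarrow> 0) net"
      using tendsto_mult_right_zero[OF L2_tendstoD(3)[OF assms(1)]] .
  qed simp
  then show ?thesis using assms by (simp add: L2_tendsto_def)
qed

lemma L2_tendsto_norm:
  fixes f :: "real^'n \<Rightarrow> 'b::euclidean_space"
  assumes "L2_tendsto F f net"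
  shows "((\<lambda>i. L2_norm (F i)) \<longlongrightarrow> L2_norm f) net"
proof -
  have "eventually (\<lambda>i. norm (L2_norm (F i) - L2_norm f) \<le> L2_norm (\<lambda>x. F i x - f x)) net"
    using L2_tendstoD(1)[OF assms]
    by eventually_elim (simp add: L2_norm_diff_bound L2_tendstoD(2)[OF assms])
  then have "((\<lambda>i. L2_norm (F i) - L2_norm f) \<longlongrightarrow> 0) net"
    by (rule Lim_null_comparison) (rule L2_tendstoD(3)[OF assms])
  then show ?thesis by (rule LIM_zero_cancel)
qed

lemma L2_tendsto_add:
  fixes f g :: "real^'n \<Rightarrow> 'b::euclidean_space"
  assumes "L2_tendsto F f net" "L2_tendsto G g net"
  shows "L2_tendsto (\<lambda>i x. F i x + G i x) (\<lambda>x. f x + g x) net"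
proof -
  note D = L2_tendstoD[OF assms(1)] L2_tendstoD[OF assms(2)]
  have ev: "eventually (\<lambda>i. L2_norm (\<lambda>x. F i x + G i x - (f x + g x))
      \<le> L2_norm (\<lambda>x. F i x - f x) + L2_norm (\<lambda>x. G i x - g x)) net"
    using D(1) D(4)
  proof eventually_elim
    case (elim i)
    have "L2_norm (\<lambda>x. F i x + G i x - (f x + g x)) = L2_norm (\<lambda>x. (F i x - f x) + (G i x - g x))"
      by (simp add: algebra_simps)
    also have "\<dots> \<le> L2_norm (\<lambda>x. F i x - f x) + L2_norm (\<lambda>x. G i x - g x)"
      using elim D by (intro L2_norm_triangle square_integrable_diff)
    finally show ?case .
  qed
  have "((\<lambda>i. L2_norm (\<lambda>x. F i x + G i x - (f x + g x))) \<longlongrightarrow> 0) net"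
    by (rule tendsto_sandwich[OF _ ev tendsto_const])
      (use tendsto_add[OF D(3) D(6)] in auto)
  moreover have "eventually (\<lambda>i. square_integrable (\<lambda>x. F i x + G i x)) net"
    using D(1) D(4) by eventually_elim (rule square_integrable_add)
  ultimately show ?thesis
    using D by (simp add: L2_tendsto_def square_integrable_add)
qed

lemma L2_tendsto_mult_bounded:
  fixes f :: "real^'n \<Rightarrow> complex"
  assumes m: "m \<in> borel_measurable lebesgue" "\<And>x. norm (m x) \<le> C" and F: "L2_tendsto F f net"
  shows "L2_tendsto (\<lambda>i x. m x * F i x) (\<lambda>x. m x * f x) net"
proof (rule L2_tendsto_bound[OF F, where C = C])
  note D = L2_tendstoD[OF F]
  show "\<forall>\<^sub>F i in net. square_integrable (\<lambda>x. m x * F i x)"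
    using D(1) by eventually_elim (rule square_integrable_mult_bounded[OF m])
  show "square_integrable (\<lambda>x. m x * f x)"
    by (rule square_integrable_mult_bounded[OF m D(2)])
  show "\<forall>\<^sub>F i in net. L2_norm (\<lambda>x. m x * F i x - m x * f x) \<le> C * L2_norm (\<lambda>x. F i x - f x)"
    using D(1)
  proof eventually_elim
    case (elim i)
    show ?case
      using square_integrable_mult_bounded(2)[OF m square_integrable_diff[OF elim D(2)]]
      by (simp add: algebra_simps)
  qed
qed

lemma L2_tendsto_cmult:
  fixes f :: "real^'n \<Rightarrow> complex"
  assumes "L2_tendsto F f net"
  shows "L2_tendsto (\<lambda>i x. c * F i x) (\<lambda>x. c * f x) net"
  by (rule L2_tendsto_mult_bounded[where C = "norm c", OF _ _ assms]) auto

lemma L2_tendsto_const: "square_integrable f \<Longrightarrow> L2_tendsto (\<lambda>i. f) f net"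
  by (simp add: L2_tendsto_def)

lemma L2_tendsto_cong_AE:
  fixes f g :: "real^'n \<Rightarrow> 'b::euclidean_space"
  assumes F: "L2_tendsto F f net" and "eventually (\<lambda>i. AE x in lebesgue. F i x = G i x) net"
    "AE x in lebesgue. f x = g x"
  shows "L2_tendsto G g net"
proof (rule L2_tendsto_bound[OF F, where C = 1])
  note D = L2_tendstoD[OF F]
  show "\<forall>\<^sub>F i in net. square_integrable (G i)"
    using D(1) assms(2) by eventually_elim (rule square_integrable_cong_AE)
  show "square_integrable g" by (rule square_integrable_cong_AE[OF assms(3) D(2)])
  show "\<forall>\<^sub>F i in net. L2_norm (\<lambda>x. G i x - g x) \<le> 1 * L2_norm (\<lambda>x. F i x - f x)"
    using D(1) assms(2)
  proof eventually_elim
    case (elim i)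
    have "AE x in lebesgue. F i x - f x = G i x - g x" using elim(2) assms(3) by eventually_elim simp
    from L2_norm_cong_AE[OF this square_integrable_diff[OF elim(1) D(2)]] show ?case by simp
  qed
qed

lemma L2_tendsto_unique:
  fixes f g :: "real^'n \<Rightarrow> 'b::euclidean_space"
  assumes "L2_tendsto F f net" "L2_tendsto F g net" "net \<noteq> bot"
  shows "AE x in lebesgue. f x = g x"
proof -
  note D = L2_tendstoD[OF assms(1)] L2_tendstoD[OF assms(2)]
  have "((\<lambda>i. L2_norm (\<lambda>x. F i x - f x) + L2_norm (\<lambda>x. F i x - g x)) \<longlongrightarrow> 0 + 0) net"
    by (intro tendsto_add D)
  moreover have "eventually (\<lambda>i. L2_norm (\<lambda>x. f x - g x) \<le>
      L2_norm (\<lambda>x. F i x - f x) + L2_norm (\<lambda>x. F i x - g x)) net"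
    using D(1)
    by eventually_elim
      (use L2_norm_triangle_diff[OF D(2) _ D(5)] L2_norm_minus_commute[of f] in metis)
  ultimately have "L2_norm (\<lambda>x. f x - g x) \<le> 0 + 0"
    using tendsto_lowerbound assms(3) by blast
  then have "L2_norm (\<lambda>x. f x - g x) = 0" by (simp add: order_antisym)
  then have "AE x in lebesgue. f x - g x = 0"
    by (rule L2_norm_eq_0[rotated]) (intro square_integrable_diff D)
  then show ?thesis by simp
qed

text \<open>Riesz-Fischer: a rapidly converging subsequence has an almost everywhere limit, and
  Fatou's lemma shows that the whole sequence tends to that limit in L^2.\<close>

lemma L2_complete:
  fixes F :: "nat \<Rightarrow> real^'n \<Rightarrow> 'b::euclidean_space"
  assumes F: "\<And>k. square_integrable (F k)"
    and Cauchy: "\<And>e. e > 0 \<Longrightarrow> \<exists>N. \<forall>m\<ge>N. \<forall>n\<ge>N. L2_norm (\<lambda>x. F m x - F n x) < e"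
  shows "\<exists>f. L2_tendsto F f sequentially"
proof -
  note [measurable] = square_integrableD(1)[OF F]
  note Fd = square_integrable_diff[OF F F]
  have nn: "(\<integral>\<^sup>+x. ennreal ((norm (F m x - F n x))\<^sup>2) \<partial>lebesgue) = ennreal ((L2_norm (\<lambda>x. F m x - F n x))\<^sup>2)"
    for m n
    unfolding L2_norm_power2
    by (rule nn_integral_eq_integral) (use square_integrableD(2)[OF Fd] in auto)
  have "\<exists>r. \<forall>k::nat. (\<forall>m\<ge>r k. \<forall>n\<ge>r k. L2_norm (\<lambda>x. F m x - F n x) < (1/4)^k) \<and> r k < r (Suc k)"
  proof (rule dependent_nat_choice)
    show "\<exists>N. \<forall>m\<ge>N. \<forall>n\<ge>N. L2_norm (\<lambda>x. F m x - F n x) < (1/4)^0"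
      by (rule Cauchy) simp
    fix N k
    obtain M where "\<forall>m\<ge>M. \<forall>n\<ge>M. L2_norm (\<lambda>x. F m x - F n x) < (1/4)^(Suc k)"
      using Cauchy[of "(1/4)^(Suc k)"] by auto
    then show "\<exists>y. (\<forall>m\<ge>y. \<forall>n\<ge>y. L2_norm (\<lambda>x. F m x - F n x) < (1/4)^(Suc k)) \<and> N < y"
      by (intro exI[of _ "max M (Suc N)"]) auto
  qed
  then obtain r :: "nat \<Rightarrow> nat" where
    r: "\<And>k m n. m \<ge> r k \<Longrightarrow> n \<ge> r k \<Longrightarrow> L2_norm (\<lambda>x. F m x - F n x) < (1/4)^k" "\<And>k. r k < r (Suc k)"
    by blast
  have r_mono: "strict_mono r" using r(2) by (simp add: strict_mono_Suc_iff)
  define d where "d k x = norm (F (r (Suc k)) x - F (r k) x)" for k x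
  have [measurable]: "d k \<in> borel_measurable lebesgue" for k
    unfolding d_def by measurable
  \<comment> \<open>On a space of infinite measure the L^2 norms of the \<open>d k\<close> do not
    control their L^1 norms, so the squares are summed with weights. The k-th integral is at most
    \<open>4^k * (1/16)^k\<close>; where the sum is finite, \<open>d k x\<close> is at most a
    constant times \<open>(1/2)^k\<close>, hence summable.\<close>
  have "(\<integral>\<^sup>+x. (\<Sum>k. ennreal (4^k * (d k x)\<^sup>2)) \<partial>lebesgue) = (\<Sum>k. \<integral>\<^sup>+x. ennreal (4^k * (d k x)\<^sup>2) \<partial>lebesgue)"
    by (rule nn_integral_suminf) auto
  also have "\<dots> \<le> (\<Sum>k. ennreal ((1/4)^k))"
  proof (rule suminf_le)
    fix k
    have "(\<integral>\<^sup>+x. ennreal (4^k * (d k x)\<^sup>2) \<partial>lebesgue) = ennreal (4^k) * (\<integral>\<^sup>+x. ennreal ((d k x)\<^sup>2) \<partial>lebesgue)"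
      by (simp add: ennreal_mult nn_integral_cmult)
    also have "\<dots> = ennreal (4^k * (L2_norm (\<lambda>x. F (r (Suc k)) x - F (r k) x))\<^sup>2)"
      unfolding d_def nn by (simp add: ennreal_mult)
    also have "\<dots> \<le> ennreal ((1/4)^k)"
    proof (rule ennreal_leI)
      have "(L2_norm (\<lambda>x. F (r (Suc k)) x - F (r k) x))\<^sup>2 \<le> ((1/4)^k)\<^sup>2"
        by (rule power_mono) (use r(1)[of k "r (Suc k)" "r k"] r(2)[of k] in auto)
      then have "4^k * (L2_norm (\<lambda>x. F (r (Suc k)) x - F (r k) x))\<^sup>2 \<le> 4^k * ((1/4)^k)\<^sup>2"
        by simp
      also have "\<dots> = (1/4::real)^k"
        by (simp add: power2_eq_square power_one_over field_simps)
      finally show "4^k * (L2_norm (\<lambda>x. F (r (Suc k)) x - F (r k) x))\<^sup>2 \<le> (1/4)^k" .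
    qed
    finally show "(\<integral>\<^sup>+x. ennreal (4^k * (d k x)\<^sup>2) \<partial>lebesgue) \<le> ennreal ((1/4)^k)" .
  qed auto
  also have "\<dots> = ennreal (\<Sum>k. (1/4)^k)"
    by (rule suminf_ennreal2) (auto intro: summable_geometric)
  also have "\<dots> < \<infinity>" by simp
  finally have "AE x in lebesgue. (\<Sum>k. ennreal (4^k * (d k x)\<^sup>2)) \<noteq> \<infinity>"
    by (intro nn_integral_PInf_AE) auto
  then have AEsum: "AE x in lebesgue. convergent (\<lambda>k. F (r k) x)"
  proof eventually_elim
    case (elim x)
    define e where "e k = ennreal (4^k * (d k x)\<^sup>2)" for k
    define S where "S = (\<Sum>k. e k)"
    have eS: "e k \<le> S" for k
    proof -
      have "sum e {k} \<le> S" unfolding S_def by (rule sum_le_suminf) auto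
      then show ?thesis by simp
    qed
    have "S \<noteq> top" using elim by (simp add: S_def e_def)
    then have "S < top" by (rule top.not_eq_extremum[THEN iffD1])
    then have le: "4^k * (d k x)\<^sup>2 \<le> enn2real S" for k
      using enn2real_mono[OF eS[of k]] by (simp add: e_def)
    have four: "((2::real)^k)\<^sup>2 = (2\<^sup>2)^k" for k
      by (simp only: power_mult[symmetric] mult.commute)
    have "(2^k * d k x)\<^sup>2 \<le> (sqrt (enn2real S))\<^sup>2" for k
      unfolding power_mult_distrib four using le[of k] by simp
    then have b: "2^k * d k x \<le> sqrt (enn2real S)" for k
      by (rule power2_le_imp_le) simp
    have "summable (\<lambda>k. F (r (Suc k)) x - F (r k) x)"
    proof (rule summable_comparison_test)
      show "\<exists>N. \<forall>k\<ge>N. norm (F (r (Suc k)) x - F (r k) x) \<le> sqrt (enn2real S) * (1/2)^k"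
        using b by (simp add: d_def field_simps power_one_over)
      show "summable (\<lambda>k. sqrt (enn2real S) * (1/2)^k)"
        by (intro summable_mult summable_geometric) simp
    qed
    then have "(\<lambda>n. \<Sum>k<n. F (r (Suc k)) x - F (r k) x) \<longlonglongrightarrow> (\<Sum>k. F (r (Suc k)) x - F (r k) x)"
      by (rule summable_LIMSEQ)
    then have "(\<lambda>n. F (r n) x - F (r 0) x) \<longlonglongrightarrow> (\<Sum>k. F (r (Suc k)) x - F (r k) x)"
      by (simp only: sum_lessThan_telescope[of "\<lambda>k. F (r k) x"])
    from tendsto_add[OF this tendsto_const[of "F (r 0) x"]] show ?case
      by (auto simp: convergent_def)
  qed
  define f where "f x = lim (\<lambda>k. F (r k) x)" for x
  have [measurable]: "f \<in> borel_measurable lebesgue"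
    unfolding f_def by (rule borel_measurable_lim_metric) measurable
  have lim: "AE x in lebesgue. (\<lambda>k. F (r k) x) \<longlonglongrightarrow> f x"
    using AEsum by eventually_elim (simp add: f_def convergent_LIMSEQ_iff)
  \<comment> \<open>Fatou is applied along the subsequence only, while \<open>m\<close> is any index
    beyond \<open>r k\<close>; this is what yields convergence of the full sequence.\<close>
  have key: "(\<integral>\<^sup>+x. ennreal ((norm (F m x - f x))\<^sup>2) \<partial>lebesgue) \<le> ennreal (((1/4)^k)\<^sup>2)"
    if m: "m \<ge> r k" for m k
  proof -
    have "(\<integral>\<^sup>+x. ennreal ((norm (F m x - f x))\<^sup>2) \<partial>lebesgue)
        \<le> (\<integral>\<^sup>+x. liminf (\<lambda>j. ennreal ((norm (F m x - F (r j) x))\<^sup>2)) \<partial>lebesgue)"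
    proof (rule nn_integral_mono_AE)
      show "AE x in lebesgue. ennreal ((norm (F m x - f x))\<^sup>2)
          \<le> liminf (\<lambda>j. ennreal ((norm (F m x - F (r j) x))\<^sup>2))"
        using lim
      proof eventually_elim
        case (elim x)
        have "(\<lambda>j. ennreal ((norm (F m x - F (r j) x))\<^sup>2)) \<longlonglongrightarrow> ennreal ((norm (F m x - f x))\<^sup>2)"
          by (intro tendsto_ennrealI tendsto_power tendsto_norm tendsto_diff elim tendsto_const)
        from lim_imp_Liminf[OF _ this] show ?case by simp
      qed
    qed
    also have "\<dots> \<le> liminf (\<lambda>j. \<integral>\<^sup>+x. ennreal ((norm (F m x - F (r j) x))\<^sup>2) \<partial>lebesgue)"
      by (rule nn_integral_liminf) measurable
    also have "\<dots> \<le> liminf (\<lambda>j::nat. ennreal (((1/4)^k)\<^sup>2))"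
    proof (rule Liminf_mono)
      show "\<forall>\<^sub>F j in sequentially. (\<integral>\<^sup>+x. ennreal ((norm (F m x - F (r j) x))\<^sup>2) \<partial>lebesgue) \<le> ennreal (((1/4)^k)\<^sup>2)"
        using eventually_ge_at_top[of k]
      proof eventually_elim
        case (elim j)
        then have "r k \<le> r j" using r_mono by (simp add: strict_mono_less_eq)
        then have "L2_norm (\<lambda>x. F m x - F (r j) x) \<le> (1/4)^k" using r(1)[OF m] by (simp add: less_imp_le)
        then show ?case unfolding nn by (intro ennreal_leI power_mono) auto
      qed
    qed
    also have "\<dots> = ennreal (((1/4)^k)\<^sup>2)" by (simp add: Liminf_const)
    finally show ?thesis .
  qed
  have sq: "square_integrable (\<lambda>x. F m x - f x)" if "m \<ge> r 0" for m
  proof -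
    have "integrable lebesgue (\<lambda>x. (norm (F m x - f x))\<^sup>2)"
    proof (rule integrableI_bounded)
      show "(\<integral>\<^sup>+x. ennreal (norm ((norm (F m x - f x))\<^sup>2)) \<partial>lebesgue) < \<infinity>"
        using le_less_trans[OF key[OF that] ennreal_less_top] by simp
    qed measurable
    then show ?thesis by (simp add: square_integrable_def)
  qed
  have f: "square_integrable f"
    using square_integrable_diff[OF F[of "r 0"] sq[of "r 0"]] by simp
  have le: "L2_norm (\<lambda>x. F m x - f x) \<le> (1/4)^k" if m: "m \<ge> r k" for m k
  proof -
    have "ennreal ((L2_norm (\<lambda>x. F m x - f x))\<^sup>2) = (\<integral>\<^sup>+x. ennreal ((norm (F m x - f x))\<^sup>2) \<partial>lebesgue)"
      unfolding L2_norm_power2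
      by (rule nn_integral_eq_integral[symmetric])
        (use square_integrableD(2)[OF square_integrable_diff[OF F f]] in auto)
    then have "ennreal ((L2_norm (\<lambda>x. F m x - f x))\<^sup>2) \<le> ennreal (((1/4)^k)\<^sup>2)"
      using key[OF m] by (rule ord_eq_le_trans)
    then have "(L2_norm (\<lambda>x. F m x - f x))\<^sup>2 \<le> ((1/4)^k)\<^sup>2"
      by (subst (asm) ennreal_le_iff) simp
    then show ?thesis by (rule power2_le_imp_le) simp
  qed
  have "(\<lambda>m. L2_norm (\<lambda>x. F m x - f x)) \<longlonglongrightarrow> 0"
  proof (rule LIMSEQ_I)
    fix e :: real assume "0 < e"
    then obtain k where "(1/4::real)^k < e" using real_arch_pow_inv[of e "1/4"] by auto
    then show "\<exists>no. \<forall>n\<ge>no. norm (L2_norm (\<lambda>x. F n x - f x) - 0) < e"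
      using le by (intro exI[of _ "r k"]) (auto intro: le_less_trans)
  qed
  then show ?thesis using F f by (auto simp: L2_tendsto_def)
qed

section \<open>Gaussians, translations and dense subspaces\<close>

lemma borel_lebesgue: "f \<in> borel_measurable borel \<Longrightarrow> f \<in> borel_measurable lebesgue"
  by (rule measurable_completion) simp

lemma borel_measurable_ident_lebesgue: "(\<lambda>x. x) \<in> borel_measurable lebesgue"
  by (rule borel_lebesgue) simp

text \<open>The factor 1/2 in the exponent makes this function its own Fourier transform up to a
  constant.\<close>

definition gauss :: "'a::euclidean_space \<Rightarrow> real" where
  "gauss x = exp (- (norm x)\<^sup>2 / 2)"

lemma gauss_measurable [measurable]: "gauss \<in> borel_measurable borel"
  unfolding gauss_def by measurable

text \<open>Up to \<open>sqrt (2 * pi)\<close>, which undoes the normalisation of the density, the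
  integral is the characteristic function of the standard normal distribution at
  \<open>- s\<close>.\<close>

lemma gauss_1d:
  "integrable lborel (\<lambda>x. exp (- \<i> * complex_of_real (x * s)) * complex_of_real (exp (- x\<^sup>2 / 2)))"
  "(LINT x|lborel. exp (- \<i> * complex_of_real (x * s)) * complex_of_real (exp (- x\<^sup>2 / 2)))
    = complex_of_real (sqrt (2 * pi) * exp (- s\<^sup>2 / 2))"
proof -
  have eq: "exp (- \<i> * complex_of_real (x * s)) * complex_of_real (exp (- x\<^sup>2 / 2))
      = complex_of_real (sqrt (2 * pi)) * (std_normal_density x *\<^sub>R iexp (- s * x))" for x
    by (simp add: std_normal_density_def scaleR_conv_of_real mult.commute)
  have int: "integrable lborel (\<lambda>x. std_normal_density x *\<^sub>R iexp (- s * x))"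
  proof (rule Bochner_Integration.integrable_bound)
    show "integrable lborel std_normal_density" by (rule integrable_normal_density) simp
  qed auto
  show "integrable lborel (\<lambda>x. exp (- \<i> * complex_of_real (x * s)) * complex_of_real (exp (- x\<^sup>2 / 2)))"
    unfolding eq by (intro integrable_mult_right int)
  have "(LINT x|lborel. std_normal_density x *\<^sub>R iexp (- s * x)) = char std_normal_distribution (- s)"
    unfolding char_def by (subst integral_density) (auto simp: normal_density_nonneg)
  also have "\<dots> = complex_of_real (exp (- s\<^sup>2 / 2))"
    by (simp add: char_std_normal_distribution)
  finally show "(LINT x|lborel. exp (- \<i> * complex_of_real (x * s)) * complex_of_real (exp (- x\<^sup>2 / 2)))
    = complex_of_real (sqrt (2 * pi) * exp (- s\<^sup>2 / 2))"
    unfolding eq integral_mult_right_zero by simp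
qed

text \<open>The Gaussian and the exponential kernel both factor over the coordinates, and Lebesgue
  measure is the image of a product measure, so the integral is a product of one-dimensional
  ones.\<close>

lemma gauss_fourier:
  fixes z :: "'a::euclidean_space"
  shows "integrable lborel (\<lambda>x. exp (- \<i> * complex_of_real (x \<bullet> z)) * complex_of_real (gauss x))"
    "(LINT x|lborel. exp (- \<i> * complex_of_real (x \<bullet> z)) * complex_of_real (gauss x))
      = complex_of_real (sqrt (2 * pi) ^ DIM('a) * gauss z)"
proof -
  interpret P: product_sigma_finite "\<lambda>_::'a. lborel :: real measure" by standard
  define h where "h b u = exp (- \<i> * complex_of_real (u * (z \<bullet> b))) * complex_of_real (exp (- u\<^sup>2 / 2))"
    for b :: 'a and u :: real
  have sq: "(norm x)\<^sup>2 = (\<Sum>b\<in>Basis. (x \<bullet> b)\<^sup>2)" for x :: 'a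
    unfolding power2_norm_eq_inner by (subst euclidean_inner) (simp add: power2_eq_square)
  have g: "gauss x = (\<Prod>b\<in>Basis. exp (- (x \<bullet> b)\<^sup>2 / 2))" for x :: 'a
    by (simp add: gauss_def sq sum_divide_distrib sum_negf exp_sum flip: sum_negf)
  have eq: "exp (- \<i> * complex_of_real (x \<bullet> z)) * complex_of_real (gauss x) = (\<Prod>b\<in>Basis. h b (x \<bullet> b))" for x :: 'a
  proof -
    have "exp (- \<i> * complex_of_real (x \<bullet> z)) = (\<Prod>b\<in>Basis. exp (- \<i> * complex_of_real ((x \<bullet> b) * (z \<bullet> b))))"
      by (subst euclidean_inner) (simp add: sum_distrib_left exp_sum flip: sum_negf)
    then show ?thesis by (simp add: g h_def prod.distrib)
  qed
  have [measurable]: "h b \<in> borel_measurable borel" for b unfolding h_def by measurable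
  have m[measurable]: "(\<lambda>f. \<Sum>b\<in>Basis. f b *\<^sub>R b) \<in> (\<Pi>\<^sub>M b\<in>Basis. lborel) \<rightarrow>\<^sub>M (borel :: 'a measure)"
    by measurable
  have comp: "(\<Prod>b\<in>Basis. h b ((\<Sum>b\<in>Basis. f b *\<^sub>R b) \<bullet> b)) = (\<Prod>b\<in>Basis. h b (f b))" for f :: "'a \<Rightarrow> real"
    by (intro prod.cong) auto
  have i: "integrable lborel (h b)" for b unfolding h_def by (rule gauss_1d)
  have hm: "(\<lambda>x. \<Prod>b\<in>Basis. h b (x \<bullet> b)) \<in> borel_measurable borel" by measurable
  show "integrable lborel (\<lambda>x. exp (- \<i> * complex_of_real (x \<bullet> z)) * complex_of_real (gauss x))"
    unfolding eq
    by (subst lborel_eq, subst integrable_distr_eq[OF m hm], unfold comp)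
      (intro P.product_integrable_prod i finite_Basis)
  have "(LINT x|lborel. (\<Prod>b\<in>Basis. h b (x \<bullet> b))) = (\<Prod>b\<in>Basis. integral\<^sup>L lborel (h b))"
    by (subst lborel_eq, subst integral_distr[OF m hm], unfold comp)
      (intro P.product_integral_prod i finite_Basis)
  also have "\<dots> = complex_of_real (sqrt (2 * pi) ^ DIM('a) * gauss z)"
    unfolding h_def gauss_1d g by (simp add: prod.distrib)
  finally show "(LINT x|lborel. exp (- \<i> * complex_of_real (x \<bullet> z)) * complex_of_real (gauss x))
      = complex_of_real (sqrt (2 * pi) ^ DIM('a) * gauss z)"
    unfolding eq .
qed

lemma gauss_integral:
  "integrable lborel (gauss :: 'a::euclidean_space \<Rightarrow> real)"
  "(LINT x|lborel. gauss (x::'a::euclidean_space)) = sqrt (2 * pi) ^ DIM('a)"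
proof -
  have i: "integrable lborel (\<lambda>x. complex_of_real (gauss (x::'a)))"
    using gauss_fourier(1)[of "0::'a"] by simp
  then show "integrable lborel (gauss :: 'a \<Rightarrow> real)"
    using integrable_Re by fastforce
  have "complex_of_real (LINT x|lborel. gauss (x::'a)) = complex_of_real (sqrt (2 * pi) ^ DIM('a))"
    using gauss_fourier(2)[of "0::'a"] by (simp add: gauss_def)
  then show "(LINT x|lborel. gauss (x::'a)) = sqrt (2 * pi) ^ DIM('a)"
    by (simp only: of_real_eq_iff)
qed

section \<open>Scaling, translation and reflection of integrals\<close>

lemma lborel_integral_scaleR:
  fixes g :: "'a::euclidean_space \<Rightarrow> 'b::{banach,second_countable_topology}"
  assumes [measurable]: "g \<in> borel_measurable borel" and c: "c > 0"
  shows "(LINT x|lborel. g x) = c ^ DIM('a) *\<^sub>R (LINT x|lborel. g (c *\<^sub>R x))"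
  using c by (subst lborel_affine[of c 0], simp, subst integral_density) (auto simp: integral_distr)

lemma lborel_integrable_scaleR:
  fixes g :: "'a::euclidean_space \<Rightarrow> 'b::{banach,second_countable_topology}"
  assumes [measurable]: "g \<in> borel_measurable borel" and c: "c > 0" and i: "integrable lborel g"
  shows "integrable lborel (\<lambda>x. g (c *\<^sub>R x))"
proof -
  have "integrable (density (distr lborel borel (\<lambda>x. c *\<^sub>R x)) (\<lambda>_. ennreal (c ^ DIM('a)))) g"
    using i lborel_affine[of c "0::'a"] c by simp
  then have "integrable lborel (\<lambda>x. c ^ DIM('a) *\<^sub>R g (c *\<^sub>R x))"
    using c by (subst (asm) integrable_density) (auto simp: integrable_distr_eq)
  then have "integrable lborel (\<lambda>x. (1 / c ^ DIM('a)) *\<^sub>R (c ^ DIM('a) *\<^sub>R g (c *\<^sub>R x)))"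
    by (rule integrable_scaleR_right)
  then show ?thesis using c by simp
qed

lemma lborel_integral_translate:
  fixes g :: "'a::euclidean_space \<Rightarrow> 'b::{banach,second_countable_topology}"
  assumes [measurable]: "g \<in> borel_measurable borel"
  shows "(LINT x|lborel. g (x - z)) = (LINT x|lborel. g x)"
    "integrable lborel (\<lambda>x. g (x - z)) \<longleftrightarrow> integrable lborel g"
proof -
  have "(LINT x|lborel. g x) = (LINT x|distr lborel borel ((+) (- z)). g x)"
    by (simp add: lborel_distr_plus)
  also have "\<dots> = (LINT x|lborel. g (x - z))" by (subst integral_distr) auto
  finally show "(LINT x|lborel. g (x - z)) = (LINT x|lborel. g x)" by simp
  have "integrable lborel g \<longleftrightarrow> integrable (distr lborel borel ((+) (- z))) g"
    by (simp add: lborel_distr_plus)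
  also have "\<dots> \<longleftrightarrow> integrable lborel (\<lambda>x. g (x - z))" by (subst integrable_distr_eq) auto
  finally show "integrable lborel (\<lambda>x. g (x - z)) \<longleftrightarrow> integrable lborel g" by simp
qed

lemma lborel_integral_reflect:
  fixes g :: "'a::euclidean_space \<Rightarrow> 'b::{banach,second_countable_topology}"
  assumes [measurable]: "g \<in> borel_measurable borel"
  shows "(LINT x|lborel. g (- x)) = (LINT x|lborel. g x)"
    "integrable lborel (\<lambda>x. g (- x)) \<longleftrightarrow> integrable lborel g"
proof -
  have d: "distr lborel borel uminus = (lborel :: 'a measure)"
    using lborel_affine[of "-1" "0::'a"] by (simp add: density_1)
  have "(LINT x|lborel. g x) = (LINT x|distr lborel borel uminus. g x)" by (simp add: d)
  also have "\<dots> = (LINT x|lborel. g (- x))" by (subst integral_distr) auto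
  finally show "(LINT x|lborel. g (- x)) = (LINT x|lborel. g x)" by simp
  have "integrable lborel g \<longleftrightarrow> integrable (distr lborel borel uminus) g" by (simp add: d)
  also have "\<dots> \<longleftrightarrow> integrable lborel (\<lambda>x. g (- x))" by (subst integrable_distr_eq) auto
  finally show "integrable lborel (\<lambda>x. g (- x)) \<longleftrightarrow> integrable lborel g" by simp
qed

section \<open>Dense subspaces and continuity of translations\<close>

lemma L2_dominated_convergence:
  fixes F :: "nat \<Rightarrow> real^'n \<Rightarrow> 'b::euclidean_space" and g :: "real^'n \<Rightarrow> real"
  assumes F: "\<And>k. F k \<in> borel_measurable lebesgue" and g: "square_integrable g"
    and le: "\<And>k x. norm (F k x) \<le> g x" and lim: "AE x in lebesgue. (\<lambda>k. F k x) \<longlonglongrightarrow> f x"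
    and f: "f \<in> borel_measurable lebesgue"
  shows "L2_tendsto F f sequentially"
proof -
  note [measurable] = F f
  have g0: "0 \<le> g x" for x using le[of 0 x] norm_ge_zero order_trans by blast
  have sF: "square_integrable (F k)" for k
    by (rule square_integrable_bound(1)[where C = 1, OF F g]) (use le g0 in auto)
  have fg: "AE x in lebesgue. norm (f x) \<le> g x"
    using lim
  proof eventually_elim
    case (elim x)
    from tendsto_norm[OF elim] show ?case by (rule Lim_bounded) (use le in auto)
  qed
  have sf: "square_integrable f"
    by (rule square_integrable_bound(1)[where C = 1, OF f g]) (use fg g0 in auto)
  have "(\<lambda>k. LINT x|lebesgue. (norm (F k x - f x))\<^sup>2) \<longlonglongrightarrow> (LINT x::real^'n|lebesgue. 0)"
  proof (rule integral_dominated_convergence)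
    show "integrable lebesgue (\<lambda>x. 4 * (g x)\<^sup>2)"
      using square_integrableD(2)[OF g] by simp
    show "AE x in lebesgue. (\<lambda>k. (norm (F k x - f x))\<^sup>2) \<longlonglongrightarrow> 0"
      using lim
    proof eventually_elim
      case (elim x)
      have "(\<lambda>k. (norm (F k x - f x))\<^sup>2) \<longlonglongrightarrow> (norm (f x - f x))\<^sup>2"
        by (intro tendsto_intros elim)
      then show ?case by simp
    qed
    show "AE x in lebesgue. norm ((norm (F k x - f x))\<^sup>2) \<le> 4 * (g x)\<^sup>2" for k
      using fg
    proof eventually_elim
      case (elim x)
      have "norm (F k x - f x) \<le> 2 * g x"
        using norm_triangle_ineq4[of "F k x" "f x"] le[of k x] elim by linarith
      then have "(norm (F k x - f x))\<^sup>2 \<le> (2 * g x)\<^sup>2" by (rule power_mono) simp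
      then show ?case by (simp add: power_mult_distrib)
    qed
  qed measurable
  then have "(\<lambda>k. L2_norm (\<lambda>x. F k x - f x)) \<longlonglongrightarrow> 0"
    unfolding L2_norm_def using tendsto_real_sqrt by fastforce
  then show ?thesis using sF sf by (simp add: L2_tendsto_def)
qed

lemma square_integrable_indicator_cball:
  "square_integrable (\<lambda>x::real^'n. c * indicator (cball 0 R) x :: real)"
proof -
  have "(norm (c * indicator (cball 0 R) x :: real))\<^sup>2 = c\<^sup>2 * indicator (cball 0 R) x" for x :: "real^'n"
    by (simp split: split_indicator)
  moreover have "integrable lebesgue (\<lambda>x::real^'n. c\<^sup>2 * indicator (cball 0 R) x :: real)"
    by (intro integrable_mult_right integrable_real_indicator)
      (use emeasure_lborel_cball_finite[of "0::real^'n" R] in auto)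
  moreover have "(\<lambda>x::real^'n. c * indicator (cball 0 R) x :: real) \<in> borel_measurable lebesgue"
    by (rule borel_lebesgue) (intro borel_measurable_times borel_measurable_indicator borel_closed, auto)
  ultimately show ?thesis by (simp add: square_integrable_def)
qed

text \<open>Continuous functions converging to \<open>f\<close> almost everywhere are made to converge in $L^2$ by projecting their values to a ball and cutting them off in space.\<close>

lemma L2_approx_bounded:
  fixes f :: "real^'n \<Rightarrow> 'b::euclidean_space"
  assumes f: "f \<in> borel_measurable lebesgue" and B: "\<And>x. norm (f x) \<le> B" "\<And>x. norm x > R \<Longrightarrow> f x = 0"
  shows "\<exists>H. (\<forall>k. continuous_on UNIV (H k)) \<and> (\<forall>k x. norm x > R + 1 \<longrightarrow> H k x = 0) \<and>
    L2_tendsto H f sequentially"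
proof -
  have B0: "0 \<le> B" using B(1)[of 0] norm_ge_zero order_trans by blast
  have "f measurable_on UNIV"
    using f by (simp add: measurable_on_iff_borel_measurable)
  then obtain N g where N: "negligible N" "\<And>n. continuous_on UNIV (g n)"
      "\<And>x. x \<notin> N \<Longrightarrow> (\<lambda>n. g n x) \<longlonglongrightarrow> f x"
    unfolding measurable_on_def by auto
  define P where "P = closest_point (cball (0::'b) B)"
  have P: "continuous_on UNIV P" "\<And>y. norm (P y) \<le> B" "\<And>y. norm y \<le> B \<Longrightarrow> P y = y"
  proof -
    show "continuous_on UNIV P"
      unfolding P_def using B0 by (intro continuous_on_closest_point) auto
    show "norm (P y) \<le> B" for y
      using closest_point_in_set[of "cball (0::'b) B" y] B0 by (simp add: P_def)
    show "norm y \<le> B \<Longrightarrow> P y = y" for y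
      by (simp add: P_def closest_point_self)
  qed
  define cut where "cut x = max 0 (min 1 (R + 1 - norm x))" for x :: "real^'n"
  have cut: "continuous_on UNIV cut" "\<And>x. 0 \<le> cut x" "\<And>x. cut x \<le> 1"
    "\<And>x. norm x \<le> R \<Longrightarrow> cut x = 1" "\<And>x. norm x > R + 1 \<Longrightarrow> cut x = 0"
    unfolding cut_def by (auto intro!: continuous_intros)
  define H where "H k x = cut x *\<^sub>R P (g k x)" for k x
  have cH: "continuous_on UNIV (H k)" for k
    unfolding H_def
    by (intro continuous_on_scaleR cut continuous_on_compose2[OF P(1) N(2)]) auto
  have "L2_tendsto H f sequentially"
  proof (rule L2_dominated_convergence)
    show "H k \<in> borel_measurable lebesgue" for k
      using borel_measurable_continuous_onI[OF cH[of k]] by (rule borel_lebesgue)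
    show "square_integrable (\<lambda>x::real^'n. B * indicator (cball 0 (R + 1)) x)"
      by (rule square_integrable_indicator_cball)
    show "norm (H k x) \<le> B * indicator (cball 0 (R + 1)) x" for k x
    proof (cases "norm x > R + 1")
      case False
      have "norm (H k x) \<le> 1 * B" unfolding H_def norm_scaleR
        using cut(2,3)[of x] P(2)[of "g k x"] by (intro mult_mono) auto
      then show ?thesis using False by simp
    qed (simp add: H_def cut)
    have "AE x in lebesgue. x \<notin> N" using N(1) by (simp add: negligible_iff_null_sets AE_not_in)
    then show "AE x in lebesgue. (\<lambda>k. H k x) \<longlonglongrightarrow> f x"
    proof eventually_elim
      case (elim x)
      have "(\<lambda>k. P (g k x)) \<longlonglongrightarrow> P (f x)"
        using continuous_on_tendsto_compose[OF P(1) N(3)[OF elim]] by simp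
      then have "(\<lambda>k. H k x) \<longlonglongrightarrow> cut x *\<^sub>R P (f x)"
        unfolding H_def by (intro tendsto_intros)
      also have "cut x *\<^sub>R P (f x) = f x"
        using cut(4)[of x] B(2)[of x] P(3)[OF B(1)[of x]] by (cases "norm x \<le> R") auto
      finally show ?case .
    qed
  qed fact
  moreover have "\<forall>k x. norm x > R + 1 \<longrightarrow> H k x = 0" by (simp add: H_def cut)
  ultimately show ?thesis using cH by blast
qed

lemma L2_truncation:
  fixes f :: "real^'n \<Rightarrow> 'b::euclidean_space"
  assumes f: "square_integrable f"
  shows "L2_tendsto (\<lambda>k x. if norm x \<le> real k \<and> norm (f x) \<le> real k then f x else 0) f sequentially"
proof (rule L2_dominated_convergence[OF _ square_integrable_norm[OF f]])
  note [measurable] = square_integrableD(1)[OF f] borel_measurable_ident_lebesgue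
  show "(\<lambda>x. if norm x \<le> real k \<and> norm (f x) \<le> real k then f x else 0) \<in> borel_measurable lebesgue" for k
    by measurable
  show "AE x in lebesgue. (\<lambda>k. if norm x \<le> real k \<and> norm (f x) \<le> real k then f x else 0) \<longlonglongrightarrow> f x"
  proof (rule AE_I2, rule tendsto_eventually)
    fix x
    show "\<forall>\<^sub>F k in sequentially. (if norm x \<le> real k \<and> norm (f x) \<le> real k then f x else 0) = f x"
      using eventually_ge_at_top[of "nat \<lceil>norm x\<rceil>"] eventually_ge_at_top[of "nat \<lceil>norm (f x)\<rceil>"]
    proof eventually_elim
      case (elim k)
      then have "norm x \<le> real k" "norm (f x) \<le> real k" by linarith+
      then show ?case by simp
    qed
  qed
qed (use square_integrableD(1)[OF f] in auto)

text \<open>Truncating both the domain and the values reduces to a bounded function on a ball; the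
  truncation and its continuous approximation each cost less than \<open>e / 2\<close>.\<close>

lemma L2_dense_continuous:
  fixes f :: "real^'n \<Rightarrow> 'b::euclidean_space"
  assumes f: "square_integrable f" and e: "e > 0"
  shows "\<exists>h R. continuous_on UNIV h \<and> (\<forall>x. norm x > R \<longrightarrow> h x = 0) \<and> square_integrable h \<and>
    L2_norm (\<lambda>x. f x - h x) < e"
proof -
  let ?f = "\<lambda>k x. if norm x \<le> real k \<and> norm (f x) \<le> real k then f x else 0"
  note [measurable] = square_integrableD(1)[OF f]
  note T = L2_truncation[OF f]
  have "eventually (\<lambda>k. L2_norm (\<lambda>x. ?f k x - f x) < e / 2 \<and> square_integrable (?f k)) sequentially"
    using order_tendstoD(2)[OF L2_tendstoD(3)[OF T], of "e/2"] L2_tendstoD(1)[OF T] e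
    by (simp add: eventually_conj)
  then obtain k where k: "L2_norm (\<lambda>x. ?f k x - f x) < e / 2" "square_integrable (?f k)"
    using eventually_happens'[OF sequentially_bot] by blast
  have fk: "norm (?f k x) \<le> real k" for x by (cases "norm (f x) \<le> real k") auto
  obtain H where H: "\<And>j. continuous_on UNIV (H j)" "\<And>j x. norm x > real k + 1 \<Longrightarrow> H j x = 0"
    "L2_tendsto H (?f k) sequentially"
    using L2_approx_bounded[OF square_integrableD(1)[OF k(2)], of "real k" "real k", OF fk]
    by auto
  have "eventually (\<lambda>j. L2_norm (\<lambda>x. H j x - ?f k x) < e / 2 \<and> square_integrable (H j)) sequentially"
    using order_tendstoD(2)[OF L2_tendstoD(3)[OF H(3)], of "e/2"] L2_tendstoD(1)[OF H(3)] e
    by (simp add: eventually_conj)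
  then obtain j where j: "L2_norm (\<lambda>x. H j x - ?f k x) < e / 2" "square_integrable (H j)"
    using eventually_happens'[OF sequentially_bot] by blast
  have "L2_norm (\<lambda>x. f x - H j x) < e"
    using L2_norm_triangle_diff[OF f k(2) j(2)] j(1) k(1)
      L2_norm_minus_commute[of f "?f k"] L2_norm_minus_commute[of "?f k" "H j"] by linarith
  then show ?thesis using H j by blast
qed

lemma L2_norm_lborel:
  fixes f :: "real^'n \<Rightarrow> 'b::euclidean_space"
  assumes [measurable]: "f \<in> borel_measurable borel"
  shows "square_integrable f \<longleftrightarrow> integrable lborel (\<lambda>x. (norm (f x))\<^sup>2)"
    "(L2_norm f)\<^sup>2 = (LINT x|lborel. (norm (f x))\<^sup>2)"
proof -
  have "f \<in> borel_measurable lebesgue" by (rule borel_lebesgue) measurable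
  then show "square_integrable f \<longleftrightarrow> integrable lborel (\<lambda>x. (norm (f x))\<^sup>2)"
    by (simp add: square_integrable_def integrable_completion)
  show "(L2_norm f)\<^sup>2 = (LINT x|lborel. (norm (f x))\<^sup>2)"
    by (simp add: L2_norm_power2 integral_completion)
qed

lemma L2_norm_translate:
  fixes f :: "real^'n \<Rightarrow> 'b::euclidean_space"
  assumes [measurable]: "f \<in> borel_measurable borel" and f: "square_integrable f"
  shows "square_integrable (\<lambda>x. f (x - z))" "L2_norm (\<lambda>x. f (x - z)) = L2_norm f"
proof -
  show "square_integrable (\<lambda>x. f (x - z))"
    using f lborel_integral_translate(2)[of "\<lambda>x. (norm (f x))\<^sup>2" z] by (simp add: L2_norm_lborel)
  have "(L2_norm (\<lambda>x. f (x - z)))\<^sup>2 = (L2_norm f)\<^sup>2"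
    using lborel_integral_translate(1)[of "\<lambda>x. (norm (f x))\<^sup>2" z] by (simp add: L2_norm_lborel)
  then show "L2_norm (\<lambda>x. f (x - z)) = L2_norm f" by simp
qed

text \<open>Translations are isometries, so replacing \<open>f\<close> by a continuous
  \<open>h\<close> of bounded support costs less than \<open>e / 3\<close> twice; the remaining
  third comes from the uniform continuity of \<open>h\<close>.\<close>

lemma L2_translation_continuous:
  fixes f :: "real^'n \<Rightarrow> 'b::euclidean_space"
  assumes [measurable]: "f \<in> borel_measurable borel" and f: "square_integrable f"
  shows "((\<lambda>z. L2_norm (\<lambda>x. f (x - z) - f x)) \<longlongrightarrow> 0) (at 0)"
proof (rule tendstoI)
  fix e :: real assume e: "0 < e"
  obtain h R where h: "continuous_on UNIV h" "\<And>x. norm x > R \<Longrightarrow> h x = 0" "square_integrable h"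
    "L2_norm (\<lambda>x. f x - h x) < e / 3"
    using L2_dense_continuous[OF f, of "e/3"] e by auto
  note [measurable] = borel_measurable_continuous_onI[OF h(1)]
  define I where "I = L2_norm (\<lambda>x::real^'n. 1 * indicator (cball 0 (R + 1)) x :: real)"
  have I: "0 \<le> I" by (simp add: I_def)
  \<comment> \<open>A sup-norm error \<epsilon> on the ball costs \<open>\<epsilon> * I\<close> in
    L^2; dividing by \<open>I + 1\<close> also covers \<open>I = 0\<close>.\<close>
  define \<epsilon> where "\<epsilon> = e / 3 / (I + 1)"
  have \<epsilon>: "\<epsilon> > 0" "\<epsilon> * I < e / 3" using e I by (auto simp: \<epsilon>_def field_simps add_pos_nonneg)
  \<comment> \<open>For \<open>|z| < 1\<close> the difference \<open>h (x - z) - h x\<close>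
    vanishes for \<open>|x| > R + 1\<close>, and for the other \<open>x\<close> both arguments lie
    in the ball of radius \<open>R + 2\<close>.\<close>
  have "uniformly_continuous_on (cball 0 (R + 2)) h"
    by (intro compact_uniformly_continuous continuous_on_subset[OF h(1)]) auto
  then obtain d where d: "d > 0"
    "\<And>x y. norm x \<le> R + 2 \<Longrightarrow> norm y \<le> R + 2 \<Longrightarrow> dist x y < d \<Longrightarrow> dist (h x) (h y) < \<epsilon>"
    unfolding uniformly_continuous_on_def using \<epsilon>(1) by (metis mem_cball_0)
  have "L2_norm (\<lambda>x. f (x - z) - f x) < e" if z: "norm z < min d 1" for z
  proof -
    have b: "norm (h (x - z) - h x) \<le> \<epsilon> * norm (1 * indicator (cball 0 (R + 1)) x :: real)" for x
    proof (cases "norm x \<le> R + 1")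
      case True
      have "norm (x - z) \<le> R + 2" using norm_triangle_ineq4[of x z] True z by linarith
      then have "dist (h (x - z)) (h x) < \<epsilon>" using True z by (intro d) (auto simp: dist_norm)
      then show ?thesis using True by (simp add: dist_norm)
    next
      case False
      have "norm x \<le> norm (x - z) + norm z" using norm_triangle_ineq[of "x - z" z] by simp
      then have "norm (x - z) > R" using False z by linarith
      then show ?thesis using False h(2)[of x] h(2)[of "x - z"] by simp
    qed
    have bh: "L2_norm (\<lambda>x. h (x - z) - h x) \<le> \<epsilon> * I" unfolding I_def
    proof (rule square_integrable_bound(2)[OF _ square_integrable_indicator_cball])
      show "(\<lambda>x. h (x - z) - h x) \<in> borel_measurable lebesgue"
        by (rule borel_lebesgue) measurable
    qed (use b \<epsilon> in auto)
    note fz = L2_norm_translate(1)[OF assms(1) f, of z]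
    note hz = L2_norm_translate(1)[OF _ h(3), of z]
    have "L2_norm (\<lambda>x. f (x - z) - f x) \<le> L2_norm (\<lambda>x. f (x - z) - h (x - z)) + L2_norm (\<lambda>x. h (x - z) - f x)"
      by (rule L2_norm_triangle_diff[OF fz hz f]) measurable
    also have "L2_norm (\<lambda>x. h (x - z) - f x) \<le> L2_norm (\<lambda>x. h (x - z) - h x) + L2_norm (\<lambda>x. h x - f x)"
      by (rule L2_norm_triangle_diff[OF hz h(3) f]) measurable
    also have "L2_norm (\<lambda>x. f (x - z) - h (x - z)) = L2_norm (\<lambda>x. f x - h x)"
      using L2_norm_translate(2)[OF _ square_integrable_diff[OF f h(3)], of z] by simp
    also have "L2_norm (\<lambda>x. h x - f x) = L2_norm (\<lambda>x. f x - h x)" by (rule L2_norm_minus_commute)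
    finally show ?thesis using bh h(4) \<epsilon>(2) by linarith
  qed
  then show "\<forall>\<^sub>F z in at 0. dist (L2_norm (\<lambda>x. f (x - z) - f x)) 0 < e"
    unfolding eventually_at using d(1) by (intro exI[of _ "min d 1"]) auto
qed

section \<open>Plancherel's theorem\<close>

lemma borel_measurable_cnj [measurable (raw)]:
  assumes "f \<in> borel_measurable M"
  shows "(\<lambda>x. cnj (f x)) \<in> borel_measurable M"
  by (rule measurable_compose[OF assms borel_measurable_continuous_onI]) (intro continuous_intros)

lemma fourier_lborel:
  assumes "f \<in> borel_measurable borel"
  shows "fourier f \<xi> = (LINT x|lborel. exp (- \<i> * complex_of_real (x \<bullet> \<xi>)) * f x)"
proof -
  note [measurable] = assms
  show ?thesis unfolding fourier_def by (rule integral_completion) measurable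
qed

lemma norm_fourier_le: "norm (fourier f \<xi>) \<le> (LINT x|lebesgue. norm (f x))"
  unfolding fourier_def by (rule order_trans[OF integral_norm_bound]) (simp add: norm_mult)

lemma integrable_fourier_kernel:
  assumes "integrable lebesgue f"
  shows "integrable lebesgue (\<lambda>x. exp (- \<i> * complex_of_real (x \<bullet> \<xi>)) * f x)"
proof (rule Bochner_Integration.integrable_bound[OF assms])
  have "(\<lambda>x. exp (- \<i> * complex_of_real (x \<bullet> \<xi>))) \<in> borel_measurable lebesgue"
    by (rule borel_lebesgue) measurable
  then show "(\<lambda>x. exp (- \<i> * complex_of_real (x \<bullet> \<xi>)) * f x) \<in> borel_measurable lebesgue"
    using assms by measurable
qed (simp add: norm_mult)

lemma continuous_on_fourier:
  assumes "integrable lebesgue f"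
  shows "continuous_on UNIV (fourier f)"
  unfolding continuous_on_sequentially
proof (intro allI ballI impI, unfold o_def)
  fix X \<xi> assume "(\<forall>n. X n \<in> UNIV) \<and> X \<longlonglongrightarrow> (\<xi> :: real^'a)"
  then have X: "X \<longlonglongrightarrow> \<xi>" by simp
  show "(\<lambda>n. fourier f (X n)) \<longlonglongrightarrow> fourier f \<xi>"
    unfolding fourier_def
  proof (rule integral_dominated_convergence)
    show "integrable lebesgue (\<lambda>x. norm (f x))" using assms by simp
    show "AE x in lebesgue. (\<lambda>n. exp (- \<i> * complex_of_real (x \<bullet> X n)) * f x)
        \<longlonglongrightarrow> exp (- \<i> * complex_of_real (x \<bullet> \<xi>)) * f x"
      by (intro AE_I2 tendsto_intros X)
  qed (use integrable_fourier_kernel[OF assms] in \<open>auto simp: norm_mult\<close>)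
qed

lemma fourier_measurable:
  "integrable lebesgue f \<Longrightarrow> fourier f \<in> borel_measurable borel"
  by (intro borel_measurable_continuous_onI continuous_on_fourier)

text \<open>Fubini and the substitutions below are carried out for Borel functions, for which
  expressions such as \<open>f (x - z)\<close> are jointly measurable. A Borel representative
  suffices, as the transform ignores null sets.\<close>

lemma lebesgue_ex_borel:
  fixes f :: "'a::euclidean_space \<Rightarrow> complex"
  assumes f: "f \<in> borel_measurable lebesgue"
  shows "\<exists>g\<in>borel_measurable borel. AE x in lebesgue. f x = g x"
proof -
  have "(\<lambda>x. Re (f x)) \<in> borel_measurable lebesgue" "(\<lambda>x. Im (f x)) \<in> borel_measurable lebesgue"
    using f by measurable
  then obtain a b where ab[measurable]: "a \<in> borel_measurable lborel" "b \<in> borel_measurable lborel"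
    and ae: "AE x in lborel. Re (f x) = a x" "AE x in lborel. Im (f x) = b x"
    using completion_ex_borel_measurable_real by blast
  have "(\<lambda>x. Complex (a x) (b x)) \<in> borel_measurable borel"
    unfolding borel_measurable_complex_iff using ab by simp
  moreover have "AE x in lebesgue. f x = Complex (a x) (b x)"
    using AE_completion[OF ae(1)] AE_completion[OF ae(2)] by eventually_elim (simp add: complex_eq_iff)
  ultimately show ?thesis by (intro bexI[of _ "\<lambda>x. Complex (a x) (b x)"])
qed

lemma fourier_cong_AE:
  fixes f g :: "real^'n \<Rightarrow> complex"
  assumes "AE x in lebesgue. f x = g x" "f \<in> borel_measurable lebesgue"
  shows "fourier f = fourier g"
proof
  fix \<xi> :: "real^'n"
  have g: "g \<in> borel_measurable lebesgue" by (rule borel_measurable_AE[OF assms(2,1)])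
  have [measurable]: "(\<lambda>x. exp (- \<i> * complex_of_real (x \<bullet> \<xi>))) \<in> borel_measurable lebesgue"
    by (rule borel_lebesgue) measurable
  show "fourier f \<xi> = fourier g \<xi>"
    unfolding fourier_def
  proof (rule integral_cong_AE)
    show "AE x in lebesgue. exp (- \<i> * complex_of_real (x \<bullet> \<xi>)) * f x = exp (- \<i> * complex_of_real (x \<bullet> \<xi>)) * g x"
      using assms(1) by eventually_elim simp
  qed (use assms(2) g in measurable)
qed

text \<open>Fubini: the kernel has modulus 1 and is symmetric in \<open>x\<close> and \<xi>, so it
  may be attached to either function.\<close>

lemma fourier_multiplication:
  fixes f g :: "real^'n \<Rightarrow> complex"
  assumes [measurable]: "f \<in> borel_measurable borel" "g \<in> borel_measurable borel"
    and f: "integrable lborel f" and g: "integrable lborel g"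
  shows "(LINT \<xi>|lborel. fourier f \<xi> * g \<xi>) = (LINT x|lborel. f x * fourier g x)"
proof -
  define K where "K x \<xi> = exp (- \<i> * complex_of_real (x \<bullet> \<xi>)) * f x * g \<xi>" for x \<xi>
  have [measurable]: "(\<lambda>p. K (fst p) (snd p)) \<in> borel_measurable (lborel \<Otimes>\<^sub>M lborel)"
    unfolding K_def by measurable
  have "integrable (lborel \<Otimes>\<^sub>M lborel) (\<lambda>p. K (fst p) (snd p))"
  proof (rule lborel_pair.Fubini_integrable)
    show "integrable lborel (\<lambda>x. LINT y|lborel. norm (K (fst (x, y)) (snd (x, y))))"
      using f g by (simp add: K_def norm_mult)
    show "AE x in lborel. integrable lborel (\<lambda>y. K (fst (x, y)) (snd (x, y)))"
    proof (rule AE_I2)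
      fix x
      show "integrable lborel (\<lambda>y. K (fst (x, y)) (snd (x, y)))"
      proof (rule Bochner_Integration.integrable_bound)
        show "integrable lborel (\<lambda>y. norm (f x) * norm (g y))" using g by simp
      qed (auto simp: K_def norm_mult)
    qed
  qed measurable
  then have K: "integrable (lborel \<Otimes>\<^sub>M lborel) (case_prod K)" by (simp add: case_prod_beta')
  have "(LINT \<xi>|lborel. fourier f \<xi> * g \<xi>) = (LINT \<xi>|lborel. LINT x|lborel. K x \<xi>)"
    by (simp add: fourier_lborel K_def)
  also have "\<dots> = (LINT x|lborel. LINT \<xi>|lborel. K x \<xi>)"
    by (rule lborel_pair.Fubini_integral[OF K])
  also have "\<dots> = (LINT x|lborel. f x * fourier g x)"
  proof (rule Bochner_Integration.integral_cong[OF refl])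
    fix x
    have "(LINT \<xi>|lborel. K x \<xi>) = (LINT \<xi>|lborel. f x * (exp (- \<i> * complex_of_real (\<xi> \<bullet> x)) * g \<xi>))"
      by (simp add: K_def inner_commute mult_ac)
    then show "(LINT \<xi>|lborel. K x \<xi>) = f x * fourier g x"
      by (simp add: fourier_lborel)
  qed
  finally show ?thesis .
qed

lemma gauss_scaled_fourier:
  fixes z :: "real^'n"
  assumes c: "c > 0"
  shows "(LINT \<xi>|lborel. exp (- \<i> * complex_of_real (\<xi> \<bullet> z)) * complex_of_real (gauss (c *\<^sub>R \<xi>)))
    = complex_of_real (sqrt (2 * pi) ^ CARD('n) * gauss ((1 / c) *\<^sub>R z) / c ^ CARD('n))"
proof -
  let ?g = "\<lambda>\<xi>. exp (- \<i> * complex_of_real (\<xi> \<bullet> ((1 / c) *\<^sub>R z))) * complex_of_real (gauss \<xi>)"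
  have "complex_of_real (sqrt (2 * pi) ^ CARD('n) * gauss ((1 / c) *\<^sub>R z)) = (LINT \<xi>|lborel. ?g \<xi>)"
    by (subst gauss_fourier(2)) simp
  also have "\<dots> = c ^ CARD('n) *\<^sub>R (LINT \<xi>|lborel. ?g (c *\<^sub>R \<xi>))"
    by (subst lborel_integral_scaleR[OF _ c]) auto
  also have "(\<lambda>\<xi>. ?g (c *\<^sub>R \<xi>)) = (\<lambda>\<xi>. exp (- \<i> * complex_of_real (\<xi> \<bullet> z)) * complex_of_real (gauss (c *\<^sub>R \<xi>)))"
    using c by simp
  finally show ?thesis using c by (simp add: field_simps scaleR_conv_of_real)
qed

lemma gauss_pos: "0 < gauss x"
  by (auto simp: gauss_def)

lemma norm_inner_L2_le:
  fixes f g :: "real^'n \<Rightarrow> complex"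
  assumes [measurable]: "f \<in> borel_measurable borel" "g \<in> borel_measurable borel"
    and f: "square_integrable f" and g: "square_integrable g"
  shows "integrable lborel (\<lambda>x. norm (f x * cnj (g x)))" "integrable lborel (\<lambda>x. f x * cnj (g x))"
    "(LINT x|lborel. norm (f x * cnj (g x))) \<le> L2_norm f * L2_norm g"
    "norm (LINT x|lborel. f x * cnj (g x)) \<le> L2_norm f * L2_norm g"
proof -
  have m: "(\<lambda>x. norm (f x * cnj (g x))) \<in> borel_measurable lborel" by simp
  show i: "integrable lborel (\<lambda>x. norm (f x * cnj (g x)))"
    using L2_Cauchy_Schwarz(1)[OF f g] integrable_completion[OF m] by (simp add: norm_mult)
  show "integrable lborel (\<lambda>x. f x * cnj (g x))"
    using i by (subst (asm) integrable_norm_iff) auto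
  show "(LINT x|lborel. norm (f x * cnj (g x))) \<le> L2_norm f * L2_norm g"
    using L2_Cauchy_Schwarz(2)[OF f g] integral_completion[OF m] by (simp add: norm_mult)
  then show "norm (LINT x|lborel. f x * cnj (g x)) \<le> L2_norm f * L2_norm g"
    by (rule order_trans[OF integral_norm_bound])
qed

text \<open>Inserting a Gaussian factor makes the integral of $|\hat f|^2$ absolutely convergent, so that Fubini turns it into an average of the autocorrelation of \<open>f\<close>, which is continuous at \<open>0\<close>.\<close>

lemma Plancherel_gauss:
  fixes f :: "real^'n \<Rightarrow> complex"
  assumes fm[measurable]: "f \<in> borel_measurable borel"
    and f1: "integrable lborel f" and f2: "square_integrable f" and c: "c > 0"
  shows "integrable lborel (\<lambda>\<xi>. (norm (fourier f \<xi>))\<^sup>2 * gauss (c *\<^sub>R \<xi>))" (is ?thesis1)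
    "complex_of_real (LINT \<xi>|lborel. (norm (fourier f \<xi>))\<^sup>2 * gauss (c *\<^sub>R \<xi>)) =
      complex_of_real (sqrt (2 * pi) ^ CARD('n)) *
      (LINT y|lborel. complex_of_real (gauss y) * (LINT x|lborel. f x * cnj (f (x - c *\<^sub>R y))))" (is ?thesis2)
proof -
  have f1': "integrable lebesgue f" using f1 by (simp add: integrable_completion)
  have [measurable]: "fourier f \<in> borel_measurable borel" by (rule fourier_measurable[OF f1'])
  define w where "w \<xi> = complex_of_real (gauss (c *\<^sub>R \<xi>))" for \<xi> :: "real^'n"
  have wm[measurable]: "w \<in> borel_measurable borel" unfolding w_def by measurable
  have wi: "integrable lborel w"
    unfolding w_def
    by (rule integrable_bounded_linear[OF bounded_linear_of_real lborel_integrable_scaleR[OF _ c gauss_integral(1)]]) simp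
  \<comment> \<open>\<open>W\<close> is the transform of the Gaussian weight \<open>w\<close>. Its
    total mass is \<open>(2 * pi) ^ CARD('n)\<close> for every \<open>c\<close>, and it concentrates
    at 0 as \<open>c\<close> tends to 0.\<close>
  define W where "W z = complex_of_real (sqrt (2 * pi) ^ CARD('n) * gauss ((1 / c) *\<^sub>R z) / c ^ CARD('n))"
    for z :: "real^'n"
  have [measurable]: "W \<in> borel_measurable borel" unfolding W_def by measurable
  have Wi: "integrable lborel W"
    unfolding W_def
    by (rule integrable_bounded_linear[OF bounded_linear_of_real])
      (intro integrable_divide integrable_mult_right lborel_integrable_scaleR gauss_integral(1) gauss_measurable, use c in simp)
  have Wf: "fourier w z = W z" for z
    unfolding fourier_lborel[OF wm] w_def W_def by (rule gauss_scaled_fourier[OF c])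
  define B where "B = (LINT x|lebesgue. norm (f x))"
  have B: "norm (fourier f \<xi>) \<le> B" for \<xi> unfolding B_def by (rule norm_fourier_le)
  have B0: "0 \<le> B" unfolding B_def by simp
  show ?thesis1
  proof (rule Bochner_Integration.integrable_bound)
    show "integrable lborel (\<lambda>\<xi>. B\<^sup>2 * norm (w \<xi>))" using wi by simp
    show "AE \<xi> in lborel. norm ((norm (fourier f \<xi>))\<^sup>2 * gauss (c *\<^sub>R \<xi>)) \<le> norm (B\<^sup>2 * norm (w \<xi>))"
      using B by (auto simp: w_def norm_mult abs_mult intro!: mult_right_mono power_mono)
  qed measurable
  define g where "g \<xi> = cnj (fourier f \<xi>) * w \<xi>" for \<xi>
  have gm[measurable]: "g \<in> borel_measurable borel" unfolding g_def by measurable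
  have gi: "integrable lborel g"
  proof (rule Bochner_Integration.integrable_bound)
    show "integrable lborel (\<lambda>\<xi>. B * norm (w \<xi>))" using wi by simp
    show "AE \<xi> in lborel. norm (g \<xi>) \<le> norm (B * norm (w \<xi>))"
      using B B0 by (auto simp: g_def norm_mult intro!: mult_right_mono)
  qed measurable
  \<comment> \<open>Conjugating and reflecting \<open>f\<close> turns the conjugate of its transform
    into the transform of an integrable function, so that the multiplication formula can be used a
    second time, to compute \<open>fourier g\<close>.\<close>
  define h where "h y = cnj (f (- y))" for y
  have hm[measurable]: "h \<in> borel_measurable borel" unfolding h_def by measurable
  have hi: "integrable lborel h"
    unfolding h_def using lborel_integral_reflect(2)[OF fm] f1 by simp
  have cnjf: "cnj (fourier f \<xi>) = fourier h \<xi>" for \<xi>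
  proof -
    have "fourier h \<xi> = (LINT x|lborel. exp (- \<i> * complex_of_real ((- x) \<bullet> \<xi>)) * h (- x))"
      unfolding fourier_lborel[OF hm]
      by (subst lborel_integral_reflect(1)[where g = "\<lambda>x. exp (- \<i> * complex_of_real (x \<bullet> \<xi>)) * h x"]) auto
    also have "\<dots> = (LINT x|lborel. cnj (exp (- \<i> * complex_of_real (x \<bullet> \<xi>)) * f x))"
      by (simp add: h_def exp_cnj)
    also have "\<dots> = cnj (fourier f \<xi>)"
      unfolding fourier_lborel[OF fm]
    proof (rule integral_bounded_linear[OF bounded_linear_cnj])
      show "integrable lborel (\<lambda>x. exp (- \<i> * complex_of_real (x \<bullet> \<xi>)) * f x)"
        by (rule Bochner_Integration.integrable_bound[OF f1]) (auto simp: norm_mult)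
    qed
    finally show ?thesis by simp
  qed
  have gf: "fourier g x = (LINT z|lborel. W z * cnj (f (x - z)))" for x
  proof -
    \<comment> \<open>Modulating the weight by the character belonging to \<open>x\<close>
      translates its transform by \<open>x\<close>; this produces the shift in the
      autocorrelation.\<close>
    define G where "G \<xi> = exp (- \<i> * complex_of_real (\<xi> \<bullet> x)) * w \<xi>" for \<xi>
    have Gm[measurable]: "G \<in> borel_measurable borel" unfolding G_def by measurable
    have Gi: "integrable lborel G"
      by (rule Bochner_Integration.integrable_bound[OF wi]) (auto simp: G_def norm_mult)
    have GW: "fourier G y = W (y + x)" for y
    proof -
      have e: "exp (- \<i> * complex_of_real (\<xi> \<bullet> (y + x))) =
          exp (- \<i> * complex_of_real (\<xi> \<bullet> y)) * exp (- \<i> * complex_of_real (\<xi> \<bullet> x))" for \<xi>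
        unfolding exp_add[symmetric] by (simp add: inner_add_right distrib_left)
      have "fourier G y = fourier w (y + x)"
        unfolding fourier_lborel[OF Gm] fourier_lborel[OF wm] G_def e mult.assoc ..
      then show ?thesis by (simp add: Wf)
    qed
    have "fourier g x = (LINT \<xi>|lborel. fourier h \<xi> * G \<xi>)"
      unfolding fourier_lborel[OF gm] g_def cnjf G_def by (simp add: mult_ac)
    also have "\<dots> = (LINT y|lborel. h y * W (y + x))"
      by (subst fourier_multiplication[OF hm Gm hi Gi]) (simp add: GW)
    also have "\<dots> = (LINT z|lborel. h (z - x) * W (z - x + x))"
      by (subst lborel_integral_translate(1)[where g = "\<lambda>y. h y * W (y + x)"]) auto
    finally show ?thesis by (simp add: h_def mult.commute)
  qed
  define A where "A z = (LINT x|lborel. f x * cnj (f (x - z)))" for z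
  have [measurable]: "A \<in> borel_measurable borel"
    unfolding A_def by measurable
  define K where "K z x = W z * (f x * cnj (f (x - z)))" for z x
  have [measurable]: "(\<lambda>p. K (fst p) (snd p)) \<in> borel_measurable (lborel \<Otimes>\<^sub>M lborel)"
    unfolding K_def by measurable
  note tr = L2_norm_translate[OF fm f2]
  have ip: "integrable lborel (\<lambda>x. f x * cnj (f (x - z)))"
    "(LINT x|lborel. norm (f x * cnj (f (x - z)))) \<le> (L2_norm f)\<^sup>2" for z
    using norm_inner_L2_le(2)[OF fm _ f2 tr(1)[of z]] norm_inner_L2_le(3)[OF fm _ f2 tr(1)[of z]]
    by (auto simp: tr(2) power2_eq_square)
  have "integrable (lborel \<Otimes>\<^sub>M lborel) (\<lambda>p. K (fst p) (snd p))"
  proof (rule lborel_pair.Fubini_integrable)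
    show "integrable lborel (\<lambda>z. LINT x|lborel. norm (K (fst (z, x)) (snd (z, x))))"
    proof (rule Bochner_Integration.integrable_bound)
      show "integrable lborel (\<lambda>z. norm (W z) * (L2_norm f)\<^sup>2)" using Wi by simp
      have "(LINT x|lborel. norm (K z x)) \<le> norm (W z) * (L2_norm f)\<^sup>2" for z
      proof -
        have "(LINT x|lborel. norm (K z x)) = norm (W z) * (LINT x|lborel. norm (f x * cnj (f (x - z))))"
          by (simp add: K_def norm_mult)
        also have "\<dots> \<le> norm (W z) * (L2_norm f)\<^sup>2" by (intro mult_left_mono ip) simp
        finally show ?thesis .
      qed
      then show "AE z in lborel. norm (LINT x|lborel. norm (K (fst (z, x)) (snd (z, x)))) \<le> norm (norm (W z) * (L2_norm f)\<^sup>2)"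
        by (auto simp: integral_nonneg_AE)
    qed measurable
    show "AE z in lborel. integrable lborel (\<lambda>x. K (fst (z, x)) (snd (z, x)))"
      by (rule AE_I2) (simp add: K_def ip)
  qed measurable
  then have K: "integrable (lborel \<Otimes>\<^sub>M lborel) (case_prod K)" by (simp add: case_prod_beta')
  have "complex_of_real (LINT \<xi>|lborel. (norm (fourier f \<xi>))\<^sup>2 * gauss (c *\<^sub>R \<xi>))
      = (LINT \<xi>|lborel. complex_of_real ((norm (fourier f \<xi>))\<^sup>2 * gauss (c *\<^sub>R \<xi>)))"
    by (rule integral_complex_of_real[symmetric])
  also have "\<dots> = (LINT \<xi>|lborel. fourier f \<xi> * g \<xi>)"
    unfolding of_real_mult complex_norm_square g_def w_def mult.assoc ..
  also have "\<dots> = (LINT x|lborel. f x * fourier g x)"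
    by (rule fourier_multiplication[OF fm gm f1 gi])
  also have "\<dots> = (LINT x|lborel. LINT z|lborel. K z x)"
  proof (rule Bochner_Integration.integral_cong[OF refl])
    fix x
    show "f x * fourier g x = (LINT z|lborel. K z x)"
      unfolding gf integral_mult_right_zero[symmetric] K_def mult.left_commute[of "f x"] ..
  qed
  also have "\<dots> = (LINT z|lborel. LINT x|lborel. K z x)"
    by (rule lborel_pair.Fubini_integral[OF K])
  also have "\<dots> = (LINT z|lborel. W z * A z)"
    unfolding K_def A_def by simp
  \<comment> \<open>After the substitution \<open>z = c *\<^sub>R y\<close> the Gaussian no longer
    depends on \<open>c\<close>, which remains only in the argument of \<open>A\<close>.\<close>
  also have "\<dots> = c ^ CARD('n) *\<^sub>R (LINT y|lborel. W (c *\<^sub>R y) * A (c *\<^sub>R y))"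
    by (subst lborel_integral_scaleR[OF _ c]) auto
  also have "\<dots> = complex_of_real (sqrt (2 * pi) ^ CARD('n)) * (LINT y|lborel. complex_of_real (gauss y) * A (c *\<^sub>R y))"
  proof -
    have "c ^ CARD('n) *\<^sub>R (W (c *\<^sub>R y) * A (c *\<^sub>R y))
        = complex_of_real (sqrt (2 * pi) ^ CARD('n)) * (complex_of_real (gauss y) * A (c *\<^sub>R y))" for y
      using c by (simp add: W_def scaleR_conv_of_real[where 'a = complex])
    then show ?thesis unfolding integral_mult_right_zero[symmetric] integral_scaleR_right[symmetric] by simp
  qed
  finally show ?thesis2 by (simp add: A_def)
qed

text \<open>Let \<open>c\<close> tend to 0 in the weighted identity. On the frequency side the
  weights increase to 1, and monotone convergence also supplies integrability; on the other side
  dominated convergence applies, because the autocorrelation is bounded, continuous at 0 and equal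
  to the squared norm of \<open>f\<close> there.\<close>

lemma Plancherel_borel:
  fixes f :: "real^'n \<Rightarrow> complex"
  assumes fm[measurable]: "f \<in> borel_measurable borel"
    and f1: "integrable lborel f" and f2: "square_integrable f"
  shows "integrable lborel (\<lambda>\<xi>. (norm (fourier f \<xi>))\<^sup>2)"
    "(LINT \<xi>|lborel. (norm (fourier f \<xi>))\<^sup>2) = (2 * pi) ^ CARD('n) * (L2_norm f)\<^sup>2"
proof -
  have f1': "integrable lebesgue f" using f1 by (simp add: integrable_completion)
  have [measurable]: "fourier f \<in> borel_measurable borel" by (rule fourier_measurable[OF f1'])
  define A where "A z = (LINT x|lborel. f x * cnj (f (x - z)))" for z
  have [measurable]: "A \<in> borel_measurable borel"
    unfolding A_def by measurable
  note tr = L2_norm_translate[OF fm f2]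
  have A_le: "norm (A z) \<le> (L2_norm f)\<^sup>2" for z
    using norm_inner_L2_le(4)[OF fm _ f2 tr(1)[of z]] by (simp add: A_def tr(2) power2_eq_square)
  have A0: "A 0 = complex_of_real ((L2_norm f)\<^sup>2)"
    by (simp add: A_def L2_norm_lborel flip: complex_norm_square integral_complex_of_real)
  have A_diff: "norm (A z - A 0) \<le> L2_norm f * L2_norm (\<lambda>x. f (x - z) - f x)" for z
  proof -
    have "A z - A 0 = (LINT x|lborel. f x * cnj (f (x - z)) - f x * cnj (f x))"
      unfolding A_def
      using norm_inner_L2_le(2)[OF fm _ f2 tr(1)[of z]] norm_inner_L2_le(2)[OF fm fm f2 f2] by simp
    also have "\<dots> = (LINT x|lborel. f x * cnj (f (x - z) - f x))" by (simp add: algebra_simps)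
    also have "norm \<dots> \<le> L2_norm f * L2_norm (\<lambda>x. f (x - z) - f x)"
      by (rule norm_inner_L2_le(4)[OF fm _ f2 square_integrable_diff[OF tr(1) f2]]) measurable
    finally show ?thesis .
  qed
  have A_lim: "A \<midarrow>0\<rightarrow> A 0"
  proof (rule LIM_zero_cancel, rule Lim_null_comparison)
    show "\<forall>\<^sub>F z in at 0. norm (A z - A 0) \<le> L2_norm f * L2_norm (\<lambda>x. f (x - z) - f x)"
      using A_diff by simp
    show "((\<lambda>z. L2_norm f * L2_norm (\<lambda>x. f (x - z) - f x)) \<longlongrightarrow> 0) (at 0)"
      by (rule tendsto_mult_right_zero[OF L2_translation_continuous[OF fm f2]])
  qed
  \<comment> \<open>A decreasing sequence, so that the weights
    \<open>gauss (c k *\<^sub>R \<xi>)\<close> increase in \<open>k\<close>.\<close>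
  define c where "c k = 1 / real (Suc k)" for k
  have c: "c k > 0" for k by (simp add: c_def)
  have c_lim: "c \<longlonglongrightarrow> 0" unfolding c_def using lim_inverse_n'[THEN LIMSEQ_Suc] by simp
  have lim: "(\<lambda>k. LINT y|lborel. complex_of_real (gauss y) * A (c k *\<^sub>R y))
      \<longlonglongrightarrow> (LINT y::real^'n|lborel. complex_of_real (gauss y) * A 0)"
  proof (rule integral_dominated_convergence)
    show "integrable lborel (\<lambda>y::real^'n. gauss y * (L2_norm f)\<^sup>2)"
      using gauss_integral(1)[where 'a = "real^'n"] by simp
    show "AE y in lborel. (\<lambda>k. complex_of_real (gauss y) * A (c k *\<^sub>R y)) \<longlonglongrightarrow> complex_of_real (gauss y) * A 0"
    proof (rule AE_I2, rule tendsto_mult_left)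
      fix y :: "real^'n"
      have "(\<lambda>k. c k *\<^sub>R y) \<longlonglongrightarrow> 0 *\<^sub>R y" by (intro tendsto_intros c_lim)
      moreover have "isCont A 0" using A_lim by (simp add: isCont_def)
      ultimately show "(\<lambda>k. A (c k *\<^sub>R y)) \<longlonglongrightarrow> A 0"
        using isCont_tendsto_compose by force
    qed
    show "AE y in lborel. norm (complex_of_real (gauss y) * A (c k *\<^sub>R y)) \<le> gauss y * (L2_norm f)\<^sup>2" for k
      by (rule AE_I2) (simp add: norm_mult abs_of_pos[OF gauss_pos] mult_left_mono[OF A_le] less_imp_le[OF gauss_pos])
  qed measurable
  have val: "(LINT y::real^'n|lborel. complex_of_real (gauss y) * A 0)
      = complex_of_real (sqrt (2 * pi) ^ CARD('n) * (L2_norm f)\<^sup>2)"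
    using gauss_integral(2)[where 'a = "real^'n"] by (simp add: A0)
  \<comment> \<open>One factor comes from the transform of the Gaussian, the other from its
    integral.\<close>
  have sq: "sqrt (2 * pi) ^ CARD('n) * sqrt (2 * pi) ^ CARD('n) = (2 * pi) ^ CARD('n)"
    unfolding power_mult_distrib[symmetric] by simp
  have "(\<lambda>k. complex_of_real (LINT \<xi>|lborel. (norm (fourier f \<xi>))\<^sup>2 * gauss (c k *\<^sub>R \<xi>)))
      \<longlonglongrightarrow> complex_of_real (sqrt (2 * pi) ^ CARD('n)) * complex_of_real (sqrt (2 * pi) ^ CARD('n) * (L2_norm f)\<^sup>2)"
    unfolding Plancherel_gauss(2)[OF fm f1 f2 c] using tendsto_mult_left[OF lim, of "complex_of_real (sqrt (2 * pi) ^ CARD('n))"]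
    by (simp only: A_def[symmetric] val)
  then have ilim: "(\<lambda>k. LINT \<xi>|lborel. (norm (fourier f \<xi>))\<^sup>2 * gauss (c k *\<^sub>R \<xi>))
      \<longlonglongrightarrow> (2 * pi) ^ CARD('n) * (L2_norm f)\<^sup>2"
    unfolding of_real_mult[symmetric] tendsto_of_real_iff mult.assoc[symmetric] sq .
  have mono: "AE \<xi> in lborel. mono (\<lambda>k. (norm (fourier f \<xi>))\<^sup>2 * gauss (c k *\<^sub>R \<xi>))"
  proof (intro AE_I2 monoI mult_left_mono)
    fix \<xi> :: "real^'n" and j k :: nat assume "j \<le> k"
    then have "c k \<le> c j" by (simp add: c_def field_simps)
    then have "(c k * norm \<xi>)\<^sup>2 \<le> (c j * norm \<xi>)\<^sup>2"
      using c[of k] by (intro power_mono mult_right_mono) auto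
    then show "gauss (c j *\<^sub>R \<xi>) \<le> gauss (c k *\<^sub>R \<xi>)"
      using c[of k] c[of j] by (simp add: gauss_def)
  qed simp
  have ptw: "AE \<xi> in lborel. (\<lambda>k. (norm (fourier f \<xi>))\<^sup>2 * gauss (c k *\<^sub>R \<xi>)) \<longlonglongrightarrow> (norm (fourier f \<xi>))\<^sup>2"
  proof (rule AE_I2)
    fix \<xi> :: "real^'n"
    have "(\<lambda>k. (norm (fourier f \<xi>))\<^sup>2 * exp (- (norm (c k *\<^sub>R \<xi>))\<^sup>2 / 2))
        \<longlonglongrightarrow> (norm (fourier f \<xi>))\<^sup>2 * exp (- (norm (0 *\<^sub>R \<xi>))\<^sup>2 / 2)"
      by (intro tendsto_intros c_lim) simp
    then show "(\<lambda>k. (norm (fourier f \<xi>))\<^sup>2 * gauss (c k *\<^sub>R \<xi>)) \<longlonglongrightarrow> (norm (fourier f \<xi>))\<^sup>2"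
      by (simp add: gauss_def)
  qed
  note M = integral_monotone_convergence_nonneg[OF Plancherel_gauss(1)[OF fm f1 f2 c] mono _ ptw ilim]
  show "integrable lborel (\<lambda>\<xi>. (norm (fourier f \<xi>))\<^sup>2)"
    by (rule M(1)) (auto simp: less_imp_le[OF gauss_pos])
  show "(LINT \<xi>|lborel. (norm (fourier f \<xi>))\<^sup>2) = (2 * pi) ^ CARD('n) * (L2_norm f)\<^sup>2"
    by (rule M(2)) (auto simp: less_imp_le[OF gauss_pos])
qed

theorem Plancherel:
  fixes f :: "real^'n \<Rightarrow> complex"
  assumes f1: "integrable lebesgue f" and f2: "square_integrable f"
  shows "square_integrable (fourier f)" "L2_norm (fourier f) = sqrt ((2 * pi) ^ CARD('n)) * L2_norm f"
proof -
  obtain g where gm: "g \<in> borel_measurable borel" and ae: "AE x in lebesgue. f x = g x"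
    using lebesgue_ex_borel[OF square_integrableD(1)[OF f2]] by blast
  have ff: "fourier f = fourier g" by (rule fourier_cong_AE[OF ae]) (use f1 in simp)
  have g2: "square_integrable g" by (rule square_integrable_cong_AE[OF ae f2])
  have "integrable lebesgue g"
    by (rule integrable_cong_AE_imp[OF f1 borel_lebesgue[OF gm]]) (use ae in auto)
  then have g1: "integrable lborel g" using gm by (simp add: integrable_completion)
  have m: "fourier f \<in> borel_measurable borel" by (rule fourier_measurable[OF f1])
  note P = Plancherel_borel[OF gm g1 g2, folded ff]
  show "square_integrable (fourier f)" using P(1) L2_norm_lborel(1)[OF m] by simp
  have "(L2_norm (fourier f))\<^sup>2 = (sqrt ((2 * pi) ^ CARD('n)) * L2_norm f)\<^sup>2"
    using P(2) L2_norm_cong_AE[OF ae f2] by (simp add: L2_norm_lborel(2)[OF m] power_mult_distrib)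
  then show "L2_norm (fourier f) = sqrt ((2 * pi) ^ CARD('n)) * L2_norm f"
    by (rule power2_eq_imp_eq) auto
qed

section \<open>The Fourier transform on $L^2$ and weak derivatives\<close>

lemma fourier_add_cmult:
  assumes f: "integrable lebesgue f" and g: "integrable lebesgue g"
  shows "fourier (\<lambda>x. f x + c * g x) \<xi> = fourier f \<xi> + c * fourier g \<xi>"
proof -
  note i = integrable_fourier_kernel[OF f, of \<xi>] integrable_fourier_kernel[OF g, of \<xi>]
  have "fourier (\<lambda>x. f x + c * g x) \<xi> = (LINT x|lebesgue. exp (- \<i> * complex_of_real (x \<bullet> \<xi>)) * f x
      + c * (exp (- \<i> * complex_of_real (x \<bullet> \<xi>)) * g x))"
    unfolding fourier_def by (simp add: algebra_simps)
  also have "\<dots> = fourier f \<xi> + c * fourier g \<xi>"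
    unfolding fourier_def integral_mult_right_zero[symmetric]
    by (rule Bochner_Integration.integral_add) (intro integrable_mult_right i)+
  finally show ?thesis .
qed

text \<open>Plancherel's identity holds along the approximating sequence once its members are square
  integrable, and norms are continuous under the two limits. Uniqueness and continuity of the
  transform on L^2 rest on this identity.\<close>

lemma is_fourierD:
  fixes f g :: "real^'n \<Rightarrow> complex"
  assumes "is_fourier f g"
  shows "square_integrable f" "square_integrable g" "L2_norm g = sqrt ((2 * pi) ^ CARD('n)) * L2_norm f"
proof -
  obtain F where F: "\<And>k. integrable lebesgue (F k)" "L2_tendsto F f sequentially"
    "L2_tendsto (\<lambda>k. fourier (F k)) g sequentially"
    using assms unfolding is_fourier_def by blast
  show "square_integrable f" "square_integrable g" using F(2,3) by (auto dest: L2_tendstoD)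
  have ev: "\<forall>\<^sub>F k in sequentially. L2_norm (fourier (F k)) = sqrt ((2 * pi) ^ CARD('n)) * L2_norm (F k)"
    using L2_tendstoD(1)[OF F(2)] by eventually_elim (rule Plancherel(2)[OF F(1)])
  have "(\<lambda>k. L2_norm (fourier (F k))) \<longlonglongrightarrow> sqrt ((2 * pi) ^ CARD('n)) * L2_norm f"
    using tendsto_mult_left[OF L2_tendsto_norm[OF F(2)]] ev by (simp add: tendsto_cong)
  with L2_tendsto_norm[OF F(3)] show "L2_norm g = sqrt ((2 * pi) ^ CARD('n)) * L2_norm f"
    by (rule LIMSEQ_unique)
qed

lemma is_fourier_add_cmult:
  assumes "is_fourier f g" "is_fourier f' g'"
  shows "is_fourier (\<lambda>x. f x + c * f' x) (\<lambda>\<xi>. g \<xi> + c * g' \<xi>)"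
proof -
  obtain F where F: "\<And>k. integrable lebesgue (F k)" "L2_tendsto F f sequentially"
    "L2_tendsto (\<lambda>k. fourier (F k)) g sequentially"
    using assms(1) unfolding is_fourier_def by blast
  obtain F' where F': "\<And>k. integrable lebesgue (F' k)" "L2_tendsto F' f' sequentially"
    "L2_tendsto (\<lambda>k. fourier (F' k)) g' sequentially"
    using assms(2) unfolding is_fourier_def by blast
  have eq: "fourier (\<lambda>x. F k x + c * F' k x) = (\<lambda>\<xi>. fourier (F k) \<xi> + c * fourier (F' k) \<xi>)" for k
    by (rule ext) (rule fourier_add_cmult[OF F(1) F'(1)])
  show ?thesis
    unfolding is_fourier_def
  proof (intro exI[of _ "\<lambda>k x. F k x + c * F' k x"] conjI allI)
    show "integrable lebesgue (\<lambda>x. F k x + c * F' k x)" for k using F(1) F'(1) by simp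
    show "L2_tendsto (\<lambda>k x. F k x + c * F' k x) (\<lambda>x. f x + c * f' x) sequentially"
      by (intro L2_tendsto_add L2_tendsto_cmult F F')
    show "L2_tendsto (\<lambda>k. fourier (\<lambda>x. F k x + c * F' k x)) (\<lambda>\<xi>. g \<xi> + c * g' \<xi>) sequentially"
      unfolding eq by (intro L2_tendsto_add L2_tendsto_cmult F F')
  qed
qed

lemma is_fourier_zero: "is_fourier (\<lambda>x. 0) (\<lambda>\<xi>. 0)"
  unfolding is_fourier_def
  by (intro exI[of _ "\<lambda>_ _. 0"]) (simp add: L2_tendsto_def fourier_def[abs_def])

lemma is_fourier_cmult: "is_fourier f g \<Longrightarrow> is_fourier (\<lambda>x. c * f x) (\<lambda>\<xi>. c * g \<xi>)"
  using is_fourier_add_cmult[OF is_fourier_zero] by fastforce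

lemma is_fourier_add: "is_fourier f g \<Longrightarrow> is_fourier f' g' \<Longrightarrow> is_fourier (\<lambda>x. f x + f' x) (\<lambda>\<xi>. g \<xi> + g' \<xi>)"
  using is_fourier_add_cmult[of f g f' g' 1] by simp

lemma is_fourier_diff: "is_fourier f g \<Longrightarrow> is_fourier f' g' \<Longrightarrow> is_fourier (\<lambda>x. f x - f' x) (\<lambda>\<xi>. g \<xi> - g' \<xi>)"
  using is_fourier_add_cmult[of f g f' g' "-1"] by simp

lemma is_fourier_sum:
  "finite I \<Longrightarrow> (\<And>i. i \<in> I \<Longrightarrow> is_fourier (f i) (g i)) \<Longrightarrow>
    is_fourier (\<lambda>x. \<Sum>i\<in>I. f i x) (\<lambda>\<xi>. \<Sum>i\<in>I. g i \<xi>)"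
  by (induction I rule: finite_induct) (auto intro: is_fourier_zero is_fourier_add)

lemma is_fourier_cong_AE:
  assumes f: "is_fourier f g" and "AE x in lebesgue. f x = f' x" "AE \<xi> in lebesgue. g \<xi> = g' \<xi>"
  shows "is_fourier f' g'"
proof -
  obtain F where F: "\<And>k. integrable lebesgue (F k)" "L2_tendsto F f sequentially"
    "L2_tendsto (\<lambda>k. fourier (F k)) g sequentially"
    using f unfolding is_fourier_def by blast
  show ?thesis
    unfolding is_fourier_def
    using F(1) L2_tendsto_cong_AE[OF F(2) _ assms(2)] L2_tendsto_cong_AE[OF F(3) _ assms(3)]
    by (intro exI[of _ F]) auto
qed

text \<open>The difference is a transform of \<open>f - f\<close>, so its norm is 0.\<close>

lemma is_fourier_unique:
  assumes "is_fourier f g" "is_fourier f g'"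
  shows "AE \<xi> in lebesgue. g \<xi> = g' \<xi>"
proof -
  note D = is_fourierD[OF is_fourier_diff[OF assms]]
  have "AE \<xi> in lebesgue. g \<xi> - g' \<xi> = 0"
    by (rule L2_norm_eq_0[OF D(2)]) (simp add: D(3))
  then show ?thesis by simp
qed

lemma is_fourier_fourier:
  assumes "integrable lebesgue f" "square_integrable f"
  shows "is_fourier f (fourier f)"
  unfolding is_fourier_def
  by (intro exI[of _ "\<lambda>_. f"]) (simp add: assms L2_tendsto_const Plancherel(1))

lemma is_fourier_tendsto:
  fixes f g :: "real^'n \<Rightarrow> complex"
  assumes ev: "\<forall>\<^sub>F i in net. is_fourier (F i) (G i)" and f: "is_fourier f g" and F: "L2_tendsto F f net"
  shows "L2_tendsto G g net"
proof (rule L2_tendsto_bound[OF F])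
  show "\<forall>\<^sub>F i in net. square_integrable (G i)" using ev by eventually_elim (rule is_fourierD)
  show "square_integrable g" using f by (rule is_fourierD)
  show "\<forall>\<^sub>F i in net. L2_norm (\<lambda>x. G i x - g x) \<le> sqrt ((2 * pi) ^ CARD('n)) * L2_norm (\<lambda>x. F i x - f x)"
    using ev by eventually_elim (use is_fourierD(3)[OF is_fourier_diff[OF _ f]] in simp)
qed

lemma borel_measurable_indicator_cball:
  "(\<lambda>x::'a::euclidean_space. complex_of_real (indicator (cball 0 R) x)) \<in> borel_measurable borel"
proof -
  have "(\<lambda>x::'a. indicator (cball 0 R) x :: real) \<in> borel_measurable borel"
    by (intro borel_measurable_indicator borel_closed) auto
  then show ?thesis by measurable
qed

text \<open>On a ball L^2 is contained in L^1, by Cauchy-Schwarz against the indicator of the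
  ball.\<close>

lemma integrable_mult_compact_support:
  fixes f :: "real^'n \<Rightarrow> complex"
  assumes m: "m \<in> borel_measurable borel" "\<And>x. norm (m x) \<le> C" "\<And>x. norm x > R \<Longrightarrow> m x = 0"
    and f: "square_integrable f"
  shows "integrable lebesgue (\<lambda>x. m x * f x)"
proof (rule Bochner_Integration.integrable_bound)
  show "integrable lebesgue (\<lambda>x::real^'n. norm (C * indicator (cball 0 R) x :: real) * norm (f x))"
    by (rule L2_Cauchy_Schwarz(1)[OF square_integrable_indicator_cball f])
  show "(\<lambda>x. m x * f x) \<in> borel_measurable lebesgue"
    using borel_lebesgue[OF m(1)] square_integrableD(1)[OF f] by measurable
  have "norm (m x * f x) \<le> norm (norm (C * indicator (cball 0 R) x :: real) * norm (f x))" for x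
  proof (cases "norm x > R")
    case False
    then show ?thesis using m(2)[of x] by (auto simp: norm_mult intro!: mult_right_mono)
  qed (simp add: m)
  then show "AE x in lebesgue. norm (m x * f x) \<le> norm (norm (C * indicator (cball 0 R) x :: real) * norm (f x))"
    by simp
qed

text \<open>Truncations of \<open>f\<close> to balls are integrable and tend to \<open>f\<close> in
  L^2. By Plancherel their transforms form a Cauchy sequence, and completeness provides the
  limit.\<close>

lemma is_fourier_exists:
  fixes f :: "real^'n \<Rightarrow> complex"
  assumes f: "square_integrable f"
  shows "\<exists>g. is_fourier f g"
proof -
  define F where "F k x = complex_of_real (indicator (cball 0 (real k)) x) * f x" for k and x :: "real^'n"
  have m: "(\<lambda>x::real^'n. complex_of_real (indicator (cball 0 (real k)) x)) \<in> borel_measurable borel" for k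
    by (rule borel_measurable_indicator_cball)
  have Fi: "integrable lebesgue (F k)" for k
    unfolding F_def
    by (rule integrable_mult_compact_support[OF m, where C = 1 and R = "real k"])
      (use f in \<open>auto split: split_indicator\<close>)
  have Fs: "square_integrable (F k)" for k
    unfolding F_def
    by (rule square_integrable_mult_bounded(1)[where C = 1, OF borel_lebesgue[OF m]])
      (use f in \<open>auto split: split_indicator\<close>)
  have Ff: "L2_tendsto F f sequentially"
  proof (rule L2_dominated_convergence[OF _ square_integrable_norm[OF f]])
    show "AE x in lebesgue. (\<lambda>k. F k x) \<longlonglongrightarrow> f x"
    proof (rule AE_I2, rule tendsto_eventually)
      fix x
      show "\<forall>\<^sub>F k in sequentially. F k x = f x"
        using eventually_ge_at_top[of "nat \<lceil>norm x\<rceil>"]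
      proof eventually_elim
        case (elim k)
        then have "norm x \<le> real k" by linarith
        then show ?case by (simp add: F_def)
      qed
    qed
  qed (use f Fs in \<open>auto simp: F_def square_integrableD(1) norm_mult split: split_indicator\<close>)
  have "\<exists>g. L2_tendsto (\<lambda>k. fourier (F k)) g sequentially"
  proof (rule L2_complete)
    show "square_integrable (fourier (F k))" for k by (rule Plancherel(1)[OF Fi Fs])
    let ?c = "sqrt ((2 * pi) ^ CARD('n))"
    have c: "?c > 0" by simp
    fix e :: real assume e: "e > 0"
    then have "0 < e / (2 * ?c)" using c by simp
    then obtain N where N: "\<And>k. k \<ge> N \<Longrightarrow> L2_norm (\<lambda>x. F k x - f x) < e / (2 * ?c)"
      using order_tendstoD(2)[OF L2_tendstoD(3)[OF Ff]] by (auto simp: eventually_sequentially)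
    show "\<exists>N. \<forall>m\<ge>N. \<forall>n\<ge>N. L2_norm (\<lambda>\<xi>. fourier (F m) \<xi> - fourier (F n) \<xi>) < e"
    proof (intro exI[of _ N] allI impI)
      fix m n assume mn: "N \<le> m" "N \<le> n"
      have "L2_norm (\<lambda>x. F m x - F n x) \<le> L2_norm (\<lambda>x. F m x - f x) + L2_norm (\<lambda>x. F n x - f x)"
        using L2_norm_triangle_diff[OF Fs f Fs, of m n] L2_norm_minus_commute[of f "F n"] by simp
      also have "\<dots> < e / ?c" using N[OF mn(1)] N[OF mn(2)] c by (simp add: field_simps)
      finally have "?c * L2_norm (\<lambda>x. F m x - F n x) < e" using c by (simp add: field_simps)
      then show "L2_norm (\<lambda>\<xi>. fourier (F m) \<xi> - fourier (F n) \<xi>) < e"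
        using is_fourierD(3)[OF is_fourier_diff[OF is_fourier_fourier[OF Fi Fs] is_fourier_fourier[OF Fi Fs]], of m n]
        by simp
    qed
  qed
  then show ?thesis unfolding is_fourier_def using Fi Ff by blast
qed

section \<open>Cutoffs and the transform of a weak gradient\<close>

definition cutoff :: "real \<Rightarrow> real^'n \<Rightarrow> real" where
  "cutoff \<epsilon> x = (max 0 (1 - \<epsilon>\<^sup>2 * (x \<bullet> x)))\<^sup>2"

definition cutoff_grad :: "real \<Rightarrow> real^'n \<Rightarrow> real^'n" where
  "cutoff_grad \<epsilon> x = (- (4 * \<epsilon>\<^sup>2 * max 0 (1 - \<epsilon>\<^sup>2 * (x \<bullet> x)))) *\<^sub>R x"

lemma continuous_on_cutoff: "continuous_on UNIV (cutoff \<epsilon>)" "continuous_on UNIV (cutoff_grad \<epsilon>)"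
  unfolding cutoff_def cutoff_grad_def by (intro continuous_intros)+

text \<open>Squaring the positive part makes it continuously differentiable, also at 0. The cutoff
  built from it is therefore an admissible test function, as \<open>has_weak_gradient\<close> tests
  against C^1 functions.\<close>

lemma DERIV_max_power2: "((\<lambda>s. (max 0 s)\<^sup>2) has_real_derivative 2 * max 0 s) (at s)" for s :: real
proof -
  consider "s > 0" | "s < 0" | "s = 0" by linarith
  then show ?thesis
  proof cases
    case 1
    have "((\<lambda>s. s\<^sup>2) has_real_derivative 2 * s) (at s)" by (auto intro!: derivative_eq_intros)
    then have "((\<lambda>s. (max 0 s)\<^sup>2) has_real_derivative 2 * s) (at s)"
      by (rule has_field_derivative_transform_within_open[of _ _ _ "{0<..}"]) (use 1 in auto)
    then show ?thesis using 1 by simp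
  next
    case 2
    have "((\<lambda>s. 0) has_real_derivative 0) (at s)" by simp
    then have "((\<lambda>s. (max 0 s)\<^sup>2) has_real_derivative 0) (at s)"
      by (rule has_field_derivative_transform_within_open[of _ _ _ "{..<0}"]) (use 2 in auto)
    then show ?thesis using 2 by simp
  next
    case 3
    have "((\<lambda>h. (max 0 h)\<^sup>2 / h) \<longlongrightarrow> 0) (at (0::real))"
    proof (rule Lim_null_comparison)
      show "\<forall>\<^sub>F h in at (0::real). norm ((max 0 h)\<^sup>2 / h) \<le> \<bar>h\<bar>"
        by (rule always_eventually) (auto simp: power2_eq_square max_def)
      show "((\<lambda>h. \<bar>h\<bar>) \<longlongrightarrow> 0) (at (0::real))" by (rule tendsto_eq_intros refl | simp)+
    qed
    then show ?thesis using 3 by (simp add: DERIV_def)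
  qed
qed

lemma GDERIV_cutoff: "GDERIV (cutoff \<epsilon>) x :> cutoff_grad \<epsilon> x"
proof -
  have "GDERIV (\<lambda>x. 1 - \<epsilon>\<^sup>2 * (x \<bullet> x)) x :> (- (2 * \<epsilon>\<^sup>2)) *\<^sub>R x"
    unfolding gderiv_def
    by (auto intro!: derivative_eq_intros simp: inner_commute algebra_simps)
  from GDERIV_DERIV_compose[OF this DERIV_max_power2]
  show ?thesis unfolding cutoff_def[abs_def] cutoff_grad_def by (simp add: mult_ac)
qed

text \<open>The gradient has size at most \<open>4 * \<epsilon>\<^sup>2 * norm x\<close> and
  vanishes unless \<open>\<epsilon> * norm x \<le> 1\<close>, which leaves one power of \<epsilon>.
  That power makes the gradient term disappear when the cutoff is removed.\<close>

lemma cutoff_bounds: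
  "0 \<le> cutoff \<epsilon> x" "cutoff \<epsilon> x \<le> 1"
  "\<epsilon> > 0 \<Longrightarrow> norm x > 1 / \<epsilon> \<Longrightarrow> cutoff \<epsilon> x = 0"
  "\<epsilon> > 0 \<Longrightarrow> norm x > 1 / \<epsilon> \<Longrightarrow> cutoff_grad \<epsilon> x = 0"
  "\<epsilon> > 0 \<Longrightarrow> norm (cutoff_grad \<epsilon> x) \<le> 4 * \<epsilon>"
proof -
  show "0 \<le> cutoff \<epsilon> x" by (simp add: cutoff_def)
  show "cutoff \<epsilon> x \<le> 1" unfolding cutoff_def by (rule power_le_one) auto
  have neg: "1 - \<epsilon>\<^sup>2 * (x \<bullet> x) \<le> 0" if "\<epsilon> > 0" "norm x > 1 / \<epsilon>"
  proof -
    have "1 < \<epsilon> * norm x" using that by (simp add: field_simps)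
    then have "1 < (\<epsilon> * norm x)\<^sup>2" using one_less_power by fastforce
    then show ?thesis by (simp add: power_mult_distrib power2_norm_eq_inner)
  qed
  show z: "\<epsilon> > 0 \<Longrightarrow> norm x > 1 / \<epsilon> \<Longrightarrow> cutoff_grad \<epsilon> x = 0"
    and "\<epsilon> > 0 \<Longrightarrow> norm x > 1 / \<epsilon> \<Longrightarrow> cutoff \<epsilon> x = 0"
    using neg by (auto simp: cutoff_def cutoff_grad_def)
  assume e: "\<epsilon> > 0"
  show "norm (cutoff_grad \<epsilon> x) \<le> 4 * \<epsilon>"
  proof (cases "norm x > 1 / \<epsilon>")
    case False
    then have x: "\<epsilon> * norm x \<le> 1" using e by (simp add: field_simps)
    have "norm (cutoff_grad \<epsilon> x) = 4 * \<epsilon>\<^sup>2 * max 0 (1 - \<epsilon>\<^sup>2 * (x \<bullet> x)) * norm x"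
      by (simp add: cutoff_grad_def abs_mult)
    also have "\<dots> \<le> 4 * \<epsilon>\<^sup>2 * 1 * norm x"
      by (intro mult_right_mono mult_left_mono) auto
    also have "\<dots> = 4 * \<epsilon> * (\<epsilon> * norm x)" by (simp add: power2_eq_square)
    also have "\<dots> \<le> 4 * \<epsilon> * 1" using e x by (intro mult_left_mono) auto
    finally show ?thesis by simp
  qed (use z e in simp)
qed

lemma square_integrable_component:
  fixes G :: "real^'n \<Rightarrow> complex^'n"
  assumes G: "square_integrable G"
  shows "square_integrable (\<lambda>x. G x $ j)"
proof (rule square_integrable_bound(1)[where C = 1, OF _ G])
  have "(\<lambda>v::complex^'n. v $ j) \<in> borel_measurable borel"
    by (intro borel_measurable_continuous_onI continuous_intros)
  from measurable_compose[OF square_integrableD(1)[OF G] this]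
  show "(\<lambda>x. G x $ j) \<in> borel_measurable lebesgue" .
qed (simp add: Finite_Cartesian_Product.norm_nth_le)

text \<open>The definition of the weak gradient is tested with a cutoff times the real and the imaginary part of $e^{-ix\cdot\zeta}$.\<close>

lemma weak_gradient_fourier_cutoff:
  fixes f :: "real^'n \<Rightarrow> complex"
  assumes G: "has_weak_gradient f G" and e: "\<epsilon> > 0"
  shows "fourier (\<lambda>x. complex_of_real (cutoff_grad \<epsilon> x $ j) * f x) \<zeta>
      - \<i> * complex_of_real (\<zeta> $ j) * fourier (\<lambda>x. complex_of_real (cutoff \<epsilon> x) * f x) \<zeta>
    = - fourier (\<lambda>x. complex_of_real (cutoff \<epsilon> x) * G x $ j) \<zeta>"
    and "integrable lebesgue (\<lambda>x. complex_of_real (cutoff_grad \<epsilon> x $ j) * f x)"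
    and "integrable lebesgue (\<lambda>x. complex_of_real (cutoff \<epsilon> x) * f x)"
    and "integrable lebesgue (\<lambda>x. complex_of_real (cutoff \<epsilon> x) * G x $ j)"
proof -
  have f: "square_integrable f" and G2: "square_integrable G"
    using G by (auto simp: has_weak_gradient_def)
  have int_cut: "integrable lebesgue (\<lambda>x. complex_of_real (cutoff \<epsilon> x * b x) * h x)"
    if h: "square_integrable h" and b: "continuous_on UNIV b" "\<And>x. \<bar>b x\<bar> \<le> B" for h :: "real^'n \<Rightarrow> complex" and b B
  proof (rule integrable_mult_compact_support[OF _ _ _ h])
    show "(\<lambda>x. complex_of_real (cutoff \<epsilon> x * b x)) \<in> borel_measurable borel"
      by (intro borel_measurable_continuous_onI continuous_intros continuous_on_cutoff b)
    show "norm (complex_of_real (cutoff \<epsilon> x * b x)) \<le> 1 * B" for x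
      unfolding norm_of_real abs_mult using cutoff_bounds(1,2)[of \<epsilon> x] b(2)[of x] by (intro mult_mono) auto
    show "norm x > 1 / \<epsilon> \<Longrightarrow> complex_of_real (cutoff \<epsilon> x * b x) = 0" for x
      using cutoff_bounds(3)[OF e, of x] by simp
  qed
  have int_grad: "integrable lebesgue (\<lambda>x. complex_of_real (cutoff_grad \<epsilon> x $ j * b x) * h x)"
    if h: "square_integrable h" and b: "continuous_on UNIV b" "\<And>x. \<bar>b x\<bar> \<le> B" for h :: "real^'n \<Rightarrow> complex" and b B
  proof (rule integrable_mult_compact_support[OF _ _ _ h])
    show "(\<lambda>x. complex_of_real (cutoff_grad \<epsilon> x $ j * b x)) \<in> borel_measurable borel"
      by (intro borel_measurable_continuous_onI continuous_intros continuous_on_cutoff b)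
    show "norm (complex_of_real (cutoff_grad \<epsilon> x $ j * b x)) \<le> 4 * \<epsilon> * B" for x
      unfolding norm_of_real abs_mult
      using order_trans[OF component_le_norm_cart cutoff_bounds(5)[OF e]] b(2)[of x] e
      by (intro mult_mono) auto
    show "norm x > 1 / \<epsilon> \<Longrightarrow> complex_of_real (cutoff_grad \<epsilon> x $ j * b x) = 0" for x
      using cutoff_bounds(4)[OF e, of x] by simp
  qed
  have test: "(LINT x|lebesgue. (D x $ j) *\<^sub>R f x) = - (LINT x|lebesgue. \<phi> x *\<^sub>R (G x $ j))"
    if "\<And>x. GDERIV \<phi> x :> D x" "continuous_on UNIV D" "\<And>x. norm x > 1 / \<epsilon> \<Longrightarrow> \<phi> x = 0" for \<phi> D
  proof -
    have "closure {x. \<phi> x \<noteq> 0} \<subseteq> cball 0 (1 / \<epsilon>)"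
      by (rule closure_minimal) (use that(3) in \<open>auto simp: not_less[symmetric]\<close>)
    then have "compact (closure {x. \<phi> x \<noteq> 0})"
      by (meson bounded_cball bounded_subset closed_closure compact_eq_bounded_closed)
    then show ?thesis using G that by (simp add: has_weak_gradient_def)
  qed
  have gcos: "GDERIV (\<lambda>x. cos (x \<bullet> \<zeta>)) x :> (- sin (x \<bullet> \<zeta>)) *\<^sub>R \<zeta>" for x
    unfolding gderiv_def by (auto intro!: derivative_eq_intros)
  have gsin: "GDERIV (\<lambda>x. sin (x \<bullet> \<zeta>)) x :> (cos (x \<bullet> \<zeta>)) *\<^sub>R \<zeta>" for x
    unfolding gderiv_def by (auto intro!: derivative_eq_intros)
  have C: "(LINT x|lebesgue. ((cutoff \<epsilon> x *\<^sub>R ((- sin (x \<bullet> \<zeta>)) *\<^sub>R \<zeta>) + cos (x \<bullet> \<zeta>) *\<^sub>R cutoff_grad \<epsilon> x) $ j) *\<^sub>R f x)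
      = - (LINT x|lebesgue. (cutoff \<epsilon> x * cos (x \<bullet> \<zeta>)) *\<^sub>R (G x $ j))"
    by (rule test[OF GDERIV_mult[OF GDERIV_cutoff gcos]])
      (use cutoff_bounds(3)[OF e] in \<open>auto intro!: continuous_intros continuous_on_cutoff\<close>)
  have S: "(LINT x|lebesgue. ((cutoff \<epsilon> x *\<^sub>R (cos (x \<bullet> \<zeta>) *\<^sub>R \<zeta>) + sin (x \<bullet> \<zeta>) *\<^sub>R cutoff_grad \<epsilon> x) $ j) *\<^sub>R f x)
      = - (LINT x|lebesgue. (cutoff \<epsilon> x * sin (x \<bullet> \<zeta>)) *\<^sub>R (G x $ j))"
    by (rule test[OF GDERIV_mult[OF GDERIV_cutoff gsin]])
      (use cutoff_bounds(3)[OF e] in \<open>auto intro!: continuous_intros continuous_on_cutoff\<close>)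
  have ccos: "continuous_on UNIV (\<lambda>x::real^'n. cos (x \<bullet> \<zeta>))" and csin: "continuous_on UNIV (\<lambda>x::real^'n. sin (x \<bullet> \<zeta>))"
    by (intro continuous_intros)+
  have kernel: "exp (- \<i> * complex_of_real s) = complex_of_real (cos s) - \<i> * complex_of_real (sin s)" for s
    using cis_conv_exp[of "- s"] by (simp add: complex_eq_iff)
  have Gj: "square_integrable (\<lambda>x. G x $ j)" by (rule square_integrable_component[OF G2])
  show int_g: "integrable lebesgue (\<lambda>x. complex_of_real (cutoff_grad \<epsilon> x $ j) * f x)"
    using int_grad[OF f, of "\<lambda>_. 1" 1] by simp
  show int_f: "integrable lebesgue (\<lambda>x. complex_of_real (cutoff \<epsilon> x) * f x)"
    using int_cut[OF f, of "\<lambda>_. 1" 1] by simp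
  show "integrable lebesgue (\<lambda>x. complex_of_real (cutoff \<epsilon> x) * G x $ j)"
    using int_cut[OF Gj, of "\<lambda>_. 1" 1] by simp
  define Ac where "Ac x = ((cutoff \<epsilon> x *\<^sub>R ((- sin (x \<bullet> \<zeta>)) *\<^sub>R \<zeta>) + cos (x \<bullet> \<zeta>) *\<^sub>R cutoff_grad \<epsilon> x) $ j) *\<^sub>R f x" for x
  define As where "As x = ((cutoff \<epsilon> x *\<^sub>R (cos (x \<bullet> \<zeta>) *\<^sub>R \<zeta>) + sin (x \<bullet> \<zeta>) *\<^sub>R cutoff_grad \<epsilon> x) $ j) *\<^sub>R f x" for x
  define Bc where "Bc x = (cutoff \<epsilon> x * cos (x \<bullet> \<zeta>)) *\<^sub>R (G x $ j)" for x
  define Bs where "Bs x = (cutoff \<epsilon> x * sin (x \<bullet> \<zeta>)) *\<^sub>R (G x $ j)" for x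
  note ic = int_cut[OF _ ccos abs_cos_le_one] int_cut[OF _ csin abs_sin_le_one]
  note ig = int_grad[OF f ccos abs_cos_le_one] int_grad[OF f csin abs_sin_le_one]
  have iB: "integrable lebesgue Bc" "integrable lebesgue Bs"
    using ic[OF Gj] by (simp_all add: Bc_def[abs_def] Bs_def[abs_def] scaleR_conv_of_real[where 'a = complex])
  have "Ac = (\<lambda>x. complex_of_real (cutoff_grad \<epsilon> x $ j * cos (x \<bullet> \<zeta>)) * f x
      - complex_of_real (\<zeta> $ j) * (complex_of_real (cutoff \<epsilon> x * sin (x \<bullet> \<zeta>)) * f x))"
    "As = (\<lambda>x. complex_of_real (cutoff_grad \<epsilon> x $ j * sin (x \<bullet> \<zeta>)) * f x
      + complex_of_real (\<zeta> $ j) * (complex_of_real (cutoff \<epsilon> x * cos (x \<bullet> \<zeta>)) * f x))"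
    by (auto simp: Ac_def As_def scaleR_conv_of_real[where 'a = complex] algebra_simps)
  then have iA: "integrable lebesgue Ac" "integrable lebesgue As"
    by (simp_all only:) (intro Bochner_Integration.integrable_diff Bochner_Integration.integrable_add integrable_mult_right ig ic f)+
  \<comment> \<open>The real tests \<open>C\<close> and \<open>S\<close> are combined as
    \<open>C - \<i> * S\<close>: the first term is the derivative of the cutoff, the factor
    \<open>- \<i> * \<zeta> $ j\<close> comes from differentiating the exponential.\<close>
  have "fourier (\<lambda>x. complex_of_real (cutoff_grad \<epsilon> x $ j) * f x) \<zeta>
      - \<i> * complex_of_real (\<zeta> $ j) * fourier (\<lambda>x. complex_of_real (cutoff \<epsilon> x) * f x) \<zeta>
    = (LINT x|lebesgue. exp (- \<i> * complex_of_real (x \<bullet> \<zeta>)) * (complex_of_real (cutoff_grad \<epsilon> x $ j) * f x)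
      - \<i> * complex_of_real (\<zeta> $ j) * (exp (- \<i> * complex_of_real (x \<bullet> \<zeta>)) * (complex_of_real (cutoff \<epsilon> x) * f x)))"
    unfolding fourier_def integral_mult_right_zero[symmetric]
    by (intro Bochner_Integration.integral_diff[symmetric] integrable_mult_right integrable_fourier_kernel int_f int_g)
  also have "\<dots> = (LINT x|lebesgue. Ac x - \<i> * As x)"
    unfolding kernel Ac_def As_def by (simp add: scaleR_conv_of_real[where 'a = complex] algebra_simps)
  also have "\<dots> = (LINT x|lebesgue. Ac x) - \<i> * (LINT x|lebesgue. As x)"
    using iA by simp
  also have "\<dots> = - ((LINT x|lebesgue. Bc x) - \<i> * (LINT x|lebesgue. Bs x))"
    unfolding Ac_def As_def C S Bc_def Bs_def by simp
  also have "\<dots> = - (LINT x|lebesgue. Bc x - \<i> * Bs x)"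
    using iB by simp
  also have "\<dots> = - fourier (\<lambda>x. complex_of_real (cutoff \<epsilon> x) * G x $ j) \<zeta>"
    unfolding fourier_def kernel Bc_def Bs_def by (simp add: scaleR_conv_of_real[where 'a = complex] algebra_simps)
  finally show "fourier (\<lambda>x. complex_of_real (cutoff_grad \<epsilon> x $ j) * f x) \<zeta>
      - \<i> * complex_of_real (\<zeta> $ j) * fourier (\<lambda>x. complex_of_real (cutoff \<epsilon> x) * f x) \<zeta>
    = - fourier (\<lambda>x. complex_of_real (cutoff \<epsilon> x) * G x $ j) \<zeta>" .
qed

lemma L2_tendsto_cutoff:
  fixes f :: "real^'n \<Rightarrow> complex"
  assumes f: "square_integrable f"
  shows "square_integrable (\<lambda>x. complex_of_real (cutoff \<epsilon> x) * f x)"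
    "L2_tendsto (\<lambda>k x. complex_of_real (cutoff (1 / real (Suc k)) x) * f x) f sequentially"
proof -
  have m: "(\<lambda>x. complex_of_real (cutoff \<epsilon> x)) \<in> borel_measurable lebesgue" for \<epsilon>
    by (intro borel_lebesgue borel_measurable_continuous_onI continuous_intros continuous_on_cutoff)
  have b: "norm (complex_of_real (cutoff \<epsilon> x)) \<le> 1" for \<epsilon> and x :: "real^'n"
    using cutoff_bounds(1,2)[of \<epsilon> x] by simp
  show sq: "square_integrable (\<lambda>x. complex_of_real (cutoff \<epsilon> x) * f x)" for \<epsilon>
    by (rule square_integrable_mult_bounded(1)[OF m b f])
  show "L2_tendsto (\<lambda>k x. complex_of_real (cutoff (1 / real (Suc k)) x) * f x) f sequentially"
  proof (rule L2_dominated_convergence[OF _ square_integrable_norm[OF f]])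
    show "(\<lambda>x. complex_of_real (cutoff (1 / real (Suc k)) x) * f x) \<in> borel_measurable lebesgue" for k
      using sq by (rule square_integrableD)
    show "norm (complex_of_real (cutoff (1 / real (Suc k)) x) * f x) \<le> norm (f x)" for k x
      unfolding norm_mult using b by (simp add: mult_left_le_one_le)
    show "AE x in lebesgue. (\<lambda>k. complex_of_real (cutoff (1 / real (Suc k)) x) * f x) \<longlonglongrightarrow> f x"
    proof (rule AE_I2)
      fix x :: "real^'n"
      have c: "(\<lambda>k. 1 / real (Suc k)) \<longlonglongrightarrow> 0" using lim_inverse_n'[THEN LIMSEQ_Suc] by simp
      have "(\<lambda>k. complex_of_real ((max 0 (1 - (1 / real (Suc k))\<^sup>2 * (x \<bullet> x)))\<^sup>2) * f x)
          \<longlonglongrightarrow> complex_of_real ((max 0 (1 - 0\<^sup>2 * (x \<bullet> x)))\<^sup>2) * f x"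
        by (intro tendsto_intros c)
      then show "(\<lambda>k. complex_of_real (cutoff (1 / real (Suc k)) x) * f x) \<longlonglongrightarrow> f x"
        by (simp add: cutoff_def)
    qed
  qed (rule square_integrableD(1)[OF f])
qed

text \<open>Let the cutoff tend to 1: its gradient is at most \<open>4 * \<epsilon> k\<close>, so
  the corresponding term tends to 0 in L^2, while the other two terms converge to multiples of
  \<open>fh\<close> and to the transform \<open>Gh\<close> of the j-th component.\<close>

theorem is_fourier_weak_gradient:
  fixes f :: "real^'n \<Rightarrow> complex"
  assumes G: "has_weak_gradient f G" and fh: "is_fourier f fh"
  shows "is_fourier (\<lambda>x. G x $ j) (\<lambda>\<xi>. \<i> * complex_of_real (\<xi> $ j) * fh \<xi>)"
proof -
  have f: "square_integrable f" and G2: "square_integrable G"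
    using G by (auto simp: has_weak_gradient_def)
  have Gj: "square_integrable (\<lambda>x. G x $ j)" by (rule square_integrable_component[OF G2])
  obtain Gh where Gh: "is_fourier (\<lambda>x. G x $ j) Gh" using is_fourier_exists[OF Gj] by blast
  define \<epsilon> where "\<epsilon> k = 1 / real (Suc k)" for k
  have \<epsilon>: "\<epsilon> k > 0" for k by (simp add: \<epsilon>_def)
  note W = weak_gradient_fourier_cutoff[OF G \<epsilon>]
  note cf = L2_tendsto_cutoff[OF f]
  note cG = L2_tendsto_cutoff[OF Gj]
  have lim_f: "L2_tendsto (\<lambda>k. fourier (\<lambda>x. complex_of_real (cutoff (\<epsilon> k) x) * f x)) fh sequentially"
    by (rule is_fourier_tendsto[OF always_eventually fh cf(2)[folded \<epsilon>_def]])
      (intro allI is_fourier_fourier W cf(1))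
  have lim_G: "L2_tendsto (\<lambda>k. fourier (\<lambda>x. complex_of_real (cutoff (\<epsilon> k) x) * G x $ j)) Gh sequentially"
    by (rule is_fourier_tendsto[OF always_eventually Gh cG(2)[folded \<epsilon>_def]])
      (intro allI is_fourier_fourier W cG(1))
  have gm: "(\<lambda>x. complex_of_real (cutoff_grad (\<epsilon> k) x $ j)) \<in> borel_measurable lebesgue" for k
    by (intro borel_lebesgue borel_measurable_continuous_onI continuous_intros continuous_on_cutoff)
  have gb: "norm (complex_of_real (cutoff_grad (\<epsilon> k) x $ j)) \<le> 4 * \<epsilon> k" for k and x :: "real^'n"
    unfolding norm_of_real by (rule order_trans[OF component_le_norm_cart cutoff_bounds(5)[OF \<epsilon>]])
  note gsq = square_integrable_mult_bounded[OF gm gb f]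
  have grad0: "L2_tendsto (\<lambda>k x. complex_of_real (cutoff_grad (\<epsilon> k) x $ j) * f x) (\<lambda>x. 0) sequentially"
  proof -
    have "(\<lambda>k. L2_norm (\<lambda>x. complex_of_real (cutoff_grad (\<epsilon> k) x $ j) * f x)) \<longlonglongrightarrow> 0"
    proof (rule tendsto_sandwich[OF _ _ tendsto_const])
      show "\<forall>\<^sub>F k in sequentially. L2_norm (\<lambda>x. complex_of_real (cutoff_grad (\<epsilon> k) x $ j) * f x) \<le> 4 * \<epsilon> k * L2_norm f"
        using gsq(2) by simp
      have "(\<lambda>k. 4 * \<epsilon> k * L2_norm f) \<longlonglongrightarrow> 4 * 0 * L2_norm f"
        unfolding \<epsilon>_def using lim_inverse_n'[THEN LIMSEQ_Suc] by (intro tendsto_intros) simp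
      then show "(\<lambda>k. 4 * \<epsilon> k * L2_norm f) \<longlonglongrightarrow> 0" by simp
    qed simp
    then show ?thesis using gsq(1) by (simp add: L2_tendsto_def)
  qed
  have lim_g: "L2_tendsto (\<lambda>k. fourier (\<lambda>x. complex_of_real (cutoff_grad (\<epsilon> k) x $ j) * f x)) (\<lambda>\<xi>. 0) sequentially"
    by (rule is_fourier_tendsto[OF always_eventually is_fourier_zero grad0])
      (intro allI is_fourier_fourier W gsq)
  have lhs: "L2_tendsto (\<lambda>k \<xi>. fourier (\<lambda>x. complex_of_real (cutoff (\<epsilon> k) x) * G x $ j) \<xi>
      + fourier (\<lambda>x. complex_of_real (cutoff_grad (\<epsilon> k) x $ j) * f x) \<xi>) (\<lambda>\<xi>. Gh \<xi> + 0) sequentially"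
    by (rule L2_tendsto_add[OF lim_G lim_g])
  have eq: "fourier (\<lambda>x. complex_of_real (cutoff (\<epsilon> k) x) * G x $ j) \<xi>
      + fourier (\<lambda>x. complex_of_real (cutoff_grad (\<epsilon> k) x $ j) * f x) \<xi>
    = \<i> * complex_of_real (\<xi> $ j) * fourier (\<lambda>x. complex_of_real (cutoff (\<epsilon> k) x) * f x) \<xi>" for k \<xi>
    using W(1)[of k j \<xi>] by (simp add: algebra_simps)
  \<comment> \<open>Multiplication by \<open>\<xi> $ j\<close> is unbounded on L^2, so the two
    limits are compared on one ball at a time, where it is a bounded multiplier.\<close>
  have ae_N: "AE \<xi> in lebesgue. norm \<xi> \<le> real N \<longrightarrow> Gh \<xi> = \<i> * complex_of_real (\<xi> $ j) * fh \<xi>" for N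
  proof -
    define cut where "cut \<xi> = complex_of_real (indicator (cball 0 (real N)) \<xi>)" for \<xi> :: "real^'n"
    define m where "m \<xi> = cut \<xi> * (\<i> * complex_of_real (\<xi> $ j))" for \<xi> :: "real^'n"
    have X: "cut \<in> borel_measurable borel" unfolding cut_def
      by (rule borel_measurable_indicator_cball)
    have "(\<lambda>\<xi>::real^'n. \<i> * complex_of_real (\<xi> $ j)) \<in> borel_measurable borel"
      by (intro borel_measurable_continuous_onI continuous_intros)
    then have m: "m \<in> borel_measurable lebesgue"
      unfolding m_def by (intro borel_lebesgue borel_measurable_times[OF X])
    have mb: "norm (m \<xi>) \<le> real N" for \<xi>
      using component_le_norm_cart[of \<xi> j] by (auto simp: m_def cut_def norm_mult split: split_indicator)
    have "L2_tendsto (\<lambda>k \<xi>. m \<xi> * fourier (\<lambda>x. complex_of_real (cutoff (\<epsilon> k) x) * f x) \<xi>) (\<lambda>\<xi>. m \<xi> * fh \<xi>) sequentially"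
      by (rule L2_tendsto_mult_bounded[OF m mb lim_f])
    moreover have "L2_tendsto (\<lambda>k \<xi>. m \<xi> * fourier (\<lambda>x. complex_of_real (cutoff (\<epsilon> k) x) * f x) \<xi>) (\<lambda>\<xi>. cut \<xi> * (Gh \<xi> + 0)) sequentially"
    proof -
      have "norm (cut \<xi>) \<le> 1" for \<xi> by (simp add: cut_def split: split_indicator)
      from L2_tendsto_mult_bounded[OF borel_lebesgue[OF X] this lhs]
      show ?thesis unfolding eq m_def by (simp add: mult.assoc)
    qed
    ultimately have "AE \<xi> in lebesgue. m \<xi> * fh \<xi> = cut \<xi> * (Gh \<xi> + 0)"
      by (rule L2_tendsto_unique) simp
    then show ?thesis by eventually_elim (auto simp: m_def cut_def mult.assoc)
  qed
  have "AE \<xi> in lebesgue. \<forall>N. norm \<xi> \<le> real N \<longrightarrow> Gh \<xi> = \<i> * complex_of_real (\<xi> $ j) * fh \<xi>"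
    unfolding AE_all_countable using ae_N by (rule allI)
  then have "AE \<xi> in lebesgue. Gh \<xi> = \<i> * complex_of_real (\<xi> $ j) * fh \<xi>"
    by eventually_elim (use real_arch_simple in blast)
  from is_fourier_cong_AE[OF Gh _ this] show ?thesis by simp
qed

lemma norm_power2_cart: "(norm x)\<^sup>2 = (\<Sum>j\<in>UNIV. (norm (x $ j))\<^sup>2)" for x :: "'a::real_normed_vector^'n"
  by (simp add: norm_vec_def L2_set_def sum_nonneg)

lemma is_fourier_laplacian:
  fixes f :: "real^'n \<Rightarrow> complex"
  assumes h: "has_laplacian f h" and fh: "is_fourier f fh"
  shows "is_fourier h (\<lambda>\<xi>. - complex_of_real ((norm \<xi>)\<^sup>2) * fh \<xi>)"
proof -
  obtain G H where GH: "has_weak_gradient f G" "\<And>j. has_weak_gradient (\<lambda>x. G x $ j) (H j)"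
    "\<And>x. h x = (\<Sum>j\<in>UNIV. H j x $ j)"
    using h unfolding has_laplacian_def by blast
  have "is_fourier (\<lambda>x. \<Sum>j\<in>UNIV. H j x $ j)
      (\<lambda>\<xi>. \<Sum>j\<in>UNIV. \<i> * complex_of_real (\<xi> $ j) * (\<i> * complex_of_real (\<xi> $ j) * fh \<xi>))"
    by (intro is_fourier_sum is_fourier_weak_gradient[OF GH(2)] is_fourier_weak_gradient[OF GH(1) fh]) simp
  moreover have "(\<Sum>j\<in>UNIV. \<i> * complex_of_real (\<xi> $ j) * (\<i> * complex_of_real (\<xi> $ j) * fh \<xi>))
      = - complex_of_real ((norm \<xi>)\<^sup>2) * fh \<xi>" for \<xi>
  proof -
    have "\<i> * complex_of_real (\<xi> $ j) * (\<i> * complex_of_real (\<xi> $ j) * fh \<xi>)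
        = - (complex_of_real ((norm (\<xi> $ j))\<^sup>2) * fh \<xi>)" for j
      by (simp add: power2_eq_square algebra_simps)
    then show ?thesis unfolding norm_power2_cart of_real_sum sum_distrib_right
      by (simp add: sum_negf sum_distrib_right)
  qed
  ultimately show ?thesis by (simp add: GH(3)[abs_def, symmetric] flip: GH(3))
qed

text \<open>Plancherel for every component, summed: the potential part of the energy is read off the
  transform of \<open>f\<close>.\<close>

lemma weak_gradient_fourier_norm:
  fixes f :: "real^'n \<Rightarrow> complex"
  assumes G: "has_weak_gradient f G" and fh: "is_fourier f fh"
  shows "integrable lebesgue (\<lambda>\<xi>. (norm \<xi>)\<^sup>2 * (norm (fh \<xi>))\<^sup>2)"
    "(LINT \<xi>|lebesgue. (norm \<xi>)\<^sup>2 * (norm (fh \<xi>))\<^sup>2) = (2 * pi) ^ CARD('n) * (L2_norm G)\<^sup>2"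
proof -
  have G2: "square_integrable G" using G by (simp add: has_weak_gradient_def)
  note Gj = square_integrable_component[OF G2]
  note D = is_fourierD[OF is_fourier_weak_gradient[OF G fh]]
  have eq: "(norm \<xi>)\<^sup>2 * (norm (fh \<xi>))\<^sup>2 = (\<Sum>j\<in>UNIV. (norm (\<i> * complex_of_real (\<xi> $ j) * fh \<xi>))\<^sup>2)" for \<xi>
    unfolding norm_power2_cart[of \<xi>] sum_distrib_right by (simp add: norm_mult power_mult_distrib)
  show "integrable lebesgue (\<lambda>\<xi>. (norm \<xi>)\<^sup>2 * (norm (fh \<xi>))\<^sup>2)"
    unfolding eq by (intro Bochner_Integration.integrable_sum square_integrableD(2) D)
  have "(LINT \<xi>|lebesgue. (norm \<xi>)\<^sup>2 * (norm (fh \<xi>))\<^sup>2)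
      = (\<Sum>j\<in>UNIV. (L2_norm (\<lambda>\<xi>. \<i> * complex_of_real (\<xi> $ j) * fh \<xi>))\<^sup>2)"
    unfolding eq L2_norm_power2 by (intro Bochner_Integration.integral_sum square_integrableD(2) D)
  also have "\<dots> = (\<Sum>j\<in>UNIV. (2 * pi) ^ CARD('n) * (L2_norm (\<lambda>x. G x $ j))\<^sup>2)"
    unfolding D(3) by (simp add: power_mult_distrib)
  also have "\<dots> = (2 * pi) ^ CARD('n) * (LINT x|lebesgue. (\<Sum>j\<in>UNIV. (norm (G x $ j))\<^sup>2))"
    unfolding L2_norm_power2 sum_distrib_left[symmetric]
    by (subst Bochner_Integration.integral_sum) (use square_integrableD(2)[OF Gj] in auto)
  also have "\<dots> = (2 * pi) ^ CARD('n) * (L2_norm G)\<^sup>2"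
    unfolding L2_norm_power2 norm_power2_cart ..
  finally show "(LINT \<xi>|lebesgue. (norm \<xi>)\<^sup>2 * (norm (fh \<xi>))\<^sup>2) = (2 * pi) ^ CARD('n) * (L2_norm G)\<^sup>2" .
qed

section \<open>Pointwise energy estimates on the Fourier side\<close>

definition wprod :: "(real^'n \<Rightarrow> real) \<Rightarrow> (real^'n \<Rightarrow> complex) \<Rightarrow> (real^'n \<Rightarrow> complex) \<Rightarrow> real^'n \<Rightarrow> real" where
  "wprod m f g \<xi> = m \<xi> * (f \<xi> \<bullet> g \<xi>)"

text \<open>The inner product on complex numbers is the real one, \<open>Re (z * cnj w)\<close>, so
  the form is real and symmetric. Each energy below is a sum of such forms with bounded weights,
  which may be negative; the lower energy bound uses this.\<close>

definition wdot :: "(real^'n \<Rightarrow> real) \<Rightarrow> (real^'n \<Rightarrow> complex) \<Rightarrow> (real^'n \<Rightarrow> complex) \<Rightarrow> real" where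
  "wdot m f g = (LINT \<xi>|lebesgue. wprod m f g \<xi>)"

lemma wprod_integrable:
  assumes m: "m \<in> borel_measurable lebesgue" "\<And>\<xi>. \<bar>m \<xi>\<bar> \<le> M"
    and f: "square_integrable f" and g: "square_integrable g"
  shows "integrable lebesgue (wprod m f g)" "\<bar>wdot m f g\<bar> \<le> M * (L2_norm f * L2_norm g)"
proof -
  note [measurable] = m(1) square_integrableD(1)[OF f] square_integrableD(1)[OF g]
  have M: "0 \<le> M" using m(2) abs_ge_zero order_trans by blast
  have le: "norm (wprod m f g \<xi>) \<le> M * (norm (f \<xi>) * norm (g \<xi>))" for \<xi>
    unfolding wprod_def real_norm_def abs_mult
    by (intro mult_mono m Cauchy_Schwarz_ineq2) (use M in auto)
  have meas: "wprod m f g \<in> borel_measurable lebesgue"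
    unfolding wprod_def[abs_def] by measurable
  have i: "integrable lebesgue (\<lambda>\<xi>. M * (norm (f \<xi>) * norm (g \<xi>)))"
    by (intro integrable_mult_right L2_Cauchy_Schwarz f g)
  show j: "integrable lebesgue (wprod m f g)"
    by (rule Bochner_Integration.integrable_bound[OF i meas]) (use le M in auto)
  have "\<bar>wdot m f g\<bar> \<le> (LINT \<xi>|lebesgue. norm (wprod m f g \<xi>))"
    unfolding wdot_def real_norm_def[symmetric] by (rule integral_norm_bound)
  also have "\<dots> \<le> (LINT \<xi>|lebesgue. M * (norm (f \<xi>) * norm (g \<xi>)))"
    by (rule integral_mono[OF _ i le]) (use j in auto)
  also have "\<dots> \<le> M * (L2_norm f * L2_norm g)"
    using L2_Cauchy_Schwarz(2)[OF f g] M by (simp add: mult_left_mono)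
  finally show "\<bar>wdot m f g\<bar> \<le> M * (L2_norm f * L2_norm g)" .
qed

lemma wdot_diff:
  assumes m: "m \<in> borel_measurable lebesgue" "\<And>\<xi>. \<bar>m \<xi>\<bar> \<le> M"
    and "square_integrable f" "square_integrable g" "square_integrable f'" "square_integrable g'"
  shows "wdot m f g - wdot m f' g' = wdot m (\<lambda>x. f x - f' x) g + wdot m f' (\<lambda>x. g x - g' x)"
proof -
  note i = wprod_integrable(1)[OF m]
  have "wdot m f g - wdot m f' g' = (LINT x|lebesgue. wprod m f g x - wprod m f' g' x)"
    unfolding wdot_def by (intro Bochner_Integration.integral_diff[symmetric] i assms)
  also have "\<dots> = (LINT x|lebesgue. wprod m (\<lambda>x. f x - f' x) g x + wprod m f' (\<lambda>x. g x - g' x) x)"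
    by (simp add: wprod_def inner_diff_left inner_diff_right algebra_simps)
  also have "\<dots> = wdot m (\<lambda>x. f x - f' x) g + wdot m f' (\<lambda>x. g x - g' x)"
    unfolding wdot_def by (intro Bochner_Integration.integral_add i square_integrable_diff assms)
  finally show ?thesis .
qed

lemma wdot_tendsto:
  assumes m: "m \<in> borel_measurable lebesgue" "\<And>\<xi>. \<bar>m \<xi>\<bar> \<le> M"
    and F: "L2_tendsto F f net" and G: "L2_tendsto G g net"
  shows "((\<lambda>i. wdot m (F i) (G i)) \<longlongrightarrow> wdot m f g) net"
proof -
  note D = L2_tendstoD[OF F] L2_tendstoD[OF G]
  have "((\<lambda>i. wdot m (F i) (G i) - wdot m f g) \<longlongrightarrow> 0) net"
  proof (rule Lim_null_comparison)
    show "\<forall>\<^sub>F i in net. norm (wdot m (F i) (G i) - wdot m f g)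
        \<le> M * (L2_norm (\<lambda>x. F i x - f x) * L2_norm (G i)) + M * (L2_norm f * L2_norm (\<lambda>x. G i x - g x))"
      using D(1,4)
    proof eventually_elim
      case (elim i)
      show ?case
        unfolding wdot_diff[OF m elim D(2,5)]
        using wprod_integrable(2)[OF m square_integrable_diff[OF elim(1) D(2)] elim(2)]
          wprod_integrable(2)[OF m D(2) square_integrable_diff[OF elim(2) D(5)]]
        by simp
    qed
    have "((\<lambda>i. M * (L2_norm (\<lambda>x. F i x - f x) * L2_norm (G i)) + M * (L2_norm f * L2_norm (\<lambda>x. G i x - g x)))
        \<longlongrightarrow> M * (0 * L2_norm g) + M * (L2_norm f * 0)) net"
      by (intro tendsto_intros D L2_tendsto_norm[OF G])
    then show "((\<lambda>i. M * (L2_norm (\<lambda>x. F i x - f x) * L2_norm (G i)) + M * (L2_norm f * L2_norm (\<lambda>x. G i x - g x)))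
        \<longlongrightarrow> 0) net" by simp
  qed
  then show ?thesis by (rule LIM_zero_cancel)
qed

text \<open>The norm of \<open>f s - f t\<close> is \<open>\<bar>s - t\<bar>\<close> times that of
  the difference quotient, and the latter converges.\<close>

lemma has_time_deriv_continuous:
  assumes d: "has_time_deriv f f' t" and f: "\<And>s. s \<ge> 0 \<Longrightarrow> square_integrable (f s)" and t: "t \<ge> 0"
  shows "L2_tendsto f (f t) (at t within {0..})"
proof -
  note D = d[unfolded has_time_deriv_def]
  have ev: "\<forall>\<^sub>F s in at t within {0..}. s \<ge> 0 \<and> s \<noteq> t" by (simp add: eventually_at_filter)
  have "((\<lambda>s. L2_norm (\<lambda>x. f s x - f t x)) \<longlongrightarrow> 0) (at t within {0..})"
  proof (rule Lim_transform_eventually)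
    have "((\<lambda>s. \<bar>s - t\<bar> * L2_norm (\<lambda>x. (f s x - f t x) / complex_of_real (s - t))) \<longlongrightarrow> \<bar>t - t\<bar> * L2_norm f') (at t within {0..})"
      by (intro tendsto_intros L2_tendsto_norm[OF D])
    then show "((\<lambda>s. \<bar>s - t\<bar> * L2_norm (\<lambda>x. (f s x - f t x) / complex_of_real (s - t))) \<longlongrightarrow> 0) (at t within {0..})"
      by simp
    show "\<forall>\<^sub>F s in at t within {0..}. \<bar>s - t\<bar> * L2_norm (\<lambda>x. (f s x - f t x) / complex_of_real (s - t)) = L2_norm (\<lambda>x. f s x - f t x)"
      using ev
    proof eventually_elim
      case (elim s)
      have "L2_norm (\<lambda>x. (1 / complex_of_real (s - t)) * (f s x - f t x)) = norm (1 / complex_of_real (s - t)) * L2_norm (\<lambda>x. f s x - f t x)"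
        using elim t by (intro square_integrable_cmult(2) square_integrable_diff f) auto
      then show ?case using elim by (simp add: norm_divide flip: of_real_diff)
    qed
  qed
  moreover have "\<forall>\<^sub>F s in at t within {0..}. square_integrable (f s)"
    using ev by eventually_elim (simp add: f)
  ultimately show ?thesis using f t by (simp add: L2_tendsto_def)
qed

text \<open>Product rule: the difference quotient splits into the quotient of \<open>f\<close>
  paired with the moving \<open>g s\<close>, and the fixed \<open>f t\<close> paired with the
  quotient of \<open>g\<close>. At time 0 the derivative is one-sided.\<close>

lemma wdot_has_derivative:
  assumes m: "m \<in> borel_measurable lebesgue" "\<And>\<xi>. \<bar>m \<xi>\<bar> \<le> M" and t: "t \<ge> 0"
    and f: "\<And>s. s \<ge> 0 \<Longrightarrow> square_integrable (f s)" "has_time_deriv f f' t"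
    and g: "\<And>s. s \<ge> 0 \<Longrightarrow> square_integrable (g s)" "has_time_deriv g g' t"
  shows "((\<lambda>s. wdot m (f s) (g s)) has_real_derivative (wdot m f' (g t) + wdot m (f t) g')) (at t within {0..})"
  unfolding has_field_derivative_iff
proof (rule Lim_transform_eventually)
  let ?D = "\<lambda>f s x. (f s x - f t x) / complex_of_real (s - t)"
  show "((\<lambda>s. wdot m (?D f s) (g s) + wdot m (f t) (?D g s)) \<longlongrightarrow> wdot m f' (g t) + wdot m (f t) g') (at t within {0..})"
    using f(2) g(2) f(1)[OF t] unfolding has_time_deriv_def
    by (intro tendsto_add wdot_tendsto[OF m] has_time_deriv_continuous[OF g(2) g(1) t] L2_tendsto_const)
  have ev: "\<forall>\<^sub>F s in at t within {0..}. s \<ge> 0 \<and> s \<noteq> t" by (simp add: eventually_at_filter)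
  have div: "z / complex_of_real r = (1 / r) *\<^sub>R z" for z r by (simp add: scaleR_conv_of_real)
  show "\<forall>\<^sub>F s in at t within {0..}. wdot m (?D f s) (g s) + wdot m (f t) (?D g s)
      = (wdot m (f s) (g s) - wdot m (f t) (g t)) / (s - t)"
    using ev
  proof eventually_elim
    case (elim s)
    have "wdot m (?D f s) (g s) = wdot m (\<lambda>x. f s x - f t x) (g s) / (s - t)"
      unfolding wdot_def wprod_def div inner_scaleR_left integral_divide_zero[symmetric] by (simp add: mult_ac)
    moreover have "wdot m (f t) (?D g s) = wdot m (f t) (\<lambda>x. g s x - g t x) / (s - t)"
      unfolding wdot_def wprod_def div inner_scaleR_right integral_divide_zero[symmetric] by (simp add: mult_ac)
    moreover have "wdot m (f s) (g s) - wdot m (f t) (g t) = wdot m (\<lambda>x. f s x - f t x) (g s) + wdot m (f t) (\<lambda>x. g s x - g t x)"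
      by (rule wdot_diff[OF m]) (use f(1) g(1) t elim in auto)
    ultimately show ?case by (simp add: add_divide_distrib)
  qed
qed

section \<open>From integral inequalities to pointwise bounds\<close>

lemma exp_decay_comparison:
  fixes \<phi> \<phi>' :: "real \<Rightarrow> real"
  assumes d: "\<And>t. t \<ge> 0 \<Longrightarrow> (\<phi> has_real_derivative \<phi>' t) (at t within {0..})"
    and le: "\<And>t. t \<ge> 0 \<Longrightarrow> \<phi>' t \<le> - c * \<phi> t" and T: "T \<ge> 0"
  shows "\<phi> T \<le> exp (- c * T) * \<phi> 0"
proof -
  \<comment> \<open>Gronwall's integrating factor. The sign of \<phi> is left open: the lower energy
    bound applies this to the negative of an energy.\<close>
  define \<psi> where "\<psi> t = exp (c * t) * \<phi> t" for t
  have d\<psi>: "(\<psi> has_real_derivative exp (c * t) * (c * \<phi> t + \<phi>' t)) (at t within {0..})" if "t \<ge> 0" for t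
    unfolding \<psi>_def
    by (rule derivative_eq_intros d[OF that] refl | simp add: algebra_simps)+
  have "\<psi> T \<le> \<psi> 0"
  proof (rule DERIV_nonpos_imp_decreasing_open[OF T])
    fix x :: real assume x: "0 < x" "x < T"
    have "at x within {0..} = at x"
      by (rule at_within_open_subset[of _ "{0<..}"]) (use x in auto)
    then have "(\<psi> has_real_derivative exp (c * x) * (c * \<phi> x + \<phi>' x)) (at x)"
      using d\<psi>[of x] x by simp
    moreover have "exp (c * x) * (c * \<phi> x + \<phi>' x) \<le> 0"
      using le[of x] x by (intro mult_nonneg_nonpos) auto
    ultimately show "\<exists>y. (\<psi> has_real_derivative y) (at x) \<and> y \<le> 0" by blast
  next
    have "continuous_on {0..} \<psi>"
      unfolding continuous_on_eq_continuous_within using d\<psi> DERIV_continuous by blast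
    then show "continuous_on {0..T} \<psi>" by (rule continuous_on_subset) auto
  qed
  then have "exp (- c * T) * \<psi> T \<le> exp (- c * T) * \<psi> 0" by (rule mult_left_mono) simp
  moreover have "exp (- c * T) * \<psi> T = \<phi> T"
    by (simp add: \<psi>_def exp_minus)
  moreover have "\<psi> 0 = \<phi> 0" by (simp add: \<psi>_def)
  ultimately show ?thesis by metis
qed

text \<open>The exceptional set is itself one of the test sets; over it the difference
  \<open>f - g\<close> is positive and has integral at most 0.\<close>

lemma AE_le_if_integrals_le:
  fixes f g :: "'a \<Rightarrow> real"
  assumes f: "integrable M f" and g: "integrable M g" and S: "S \<in> sets M"
    and le: "\<And>A. A \<in> sets M \<Longrightarrow> A \<subseteq> S \<Longrightarrow>
      (LINT x|M. indicator A x * f x) \<le> (LINT x|M. indicator A x * g x)"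
  shows "AE x in M. x \<in> S \<longrightarrow> f x \<le> g x"
proof -
  note [measurable] = borel_measurable_integrable[OF f] borel_measurable_integrable[OF g]
  have sub: "S \<subseteq> space M" using S by (rule sets.sets_into_space)
  define A where "A = {x \<in> space M. g x < f x} \<inter> S"
  have A: "A \<in> sets M" "A \<subseteq> S" unfolding A_def using S by auto
  have i: "integrable M (\<lambda>x. indicator A x * f x)" "integrable M (\<lambda>x. indicator A x * g x)"
    using integrable_mult_indicator[OF A(1) f] integrable_mult_indicator[OF A(1) g] by simp_all
  have nn: "AE x in M. 0 \<le> indicator A x * f x - indicator A x * g x"
    by (auto simp: A_def split: split_indicator)
  have "(LINT x|M. indicator A x * f x - indicator A x * g x) \<le> 0"
    using le[OF A] i by simp
  then have "(LINT x|M. indicator A x * f x - indicator A x * g x) = 0"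
    using integral_nonneg_AE[OF nn] by simp
  then have "AE x in M. indicator A x * f x - indicator A x * g x = 0"
    using integral_nonneg_eq_0_iff_AE[OF Bochner_Integration.integrable_diff[OF i] nn] by simp
  then show ?thesis
    using AE_space
  proof eventually_elim
    case (elim x)
    show ?case
    proof (intro impI leI notI)
      assume "x \<in> S" "g x < f x"
      then have "x \<in> A" using sub by (auto simp: A_def)
      then show False using elim \<open>g x < f x\<close> by simp
    qed
  qed
qed

text \<open>Each \<open>q\<close> below comes with its own null set, and only countably many of
  these may be discarded; hence the bounds are available for rational \<open>q\<close> on one side
  of \<open>a\<close>. Density and continuity give the value at \<open>a\<close>.\<close>

lemma isCont_le_if_Rats_le:
  fixes h :: "real \<Rightarrow> real"
  assumes h: "isCont h a" and le: "(\<forall>q\<in>\<rat>. q > a \<longrightarrow> h q \<le> c) \<or> (\<forall>q\<in>\<rat>. q < a \<longrightarrow> h q \<le> c)"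
  shows "h a \<le> c"
proof (rule ccontr)
  assume "\<not> h a \<le> c"
  then have "\<forall>\<^sub>F x in at a. h x > c"
    using order_tendstoD(1)[OF h[unfolded isCont_def]] by simp
  then obtain d where d: "d > 0" "\<And>x. x \<noteq> a \<Longrightarrow> \<bar>x - a\<bar> < d \<Longrightarrow> h x > c"
    unfolding eventually_at by (auto simp: dist_real_def)
  obtain q where "q \<in> \<rat>" "a < q" "q < a + d" using Rats_dense_in_real[of a "a + d"] d by auto
  moreover obtain r where "r \<in> \<rat>" "a - d < r" "r < a" using Rats_dense_in_real[of "a - d" a] d by auto
  ultimately show False using le d(2)[of q] d(2)[of r] by force
qed

text \<open>The cross term has weight \<open>a / K \<le> \<rho>\<close>, so it is at most
  \<open>P / 2\<close>. The weight \<open>a\<^sup>2 / (2 * K)\<close> is chosen because its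
  derivative \<open>(a\<^sup>2 / K) * (u \<bullet> v)\<close> cancels the term of opposite sign that
  the damping produces in the derivative of the cross term. What is left is at most
  \<open>- (a / K) * P\<close>, since \<open>K \<ge> 1\<close> bounds the gain
  \<open>(a / K) * (v \<bullet> v)\<close> by half of the dissipation.\<close>

lemma lyapunov_bounds:
  fixes u v :: complex and K \<rho> a :: real
  assumes K: "K \<ge> 1" and \<rho>: "0 \<le> \<rho>" and a: "0 \<le> a" "a \<le> K * \<rho>"
  defines "P \<equiv> v \<bullet> v + \<rho>\<^sup>2 * (u \<bullet> u)"
  defines "G \<equiv> P + (a / K) * (u \<bullet> v) + (a\<^sup>2 / (2 * K)) * (u \<bullet> u)"
  shows "P \<le> 2 * G" "0 \<le> G"
    "- 2 * a * (v \<bullet> v) + (a / K) * (v \<bullet> v) - (a / K) * \<rho>\<^sup>2 * (u \<bullet> u) \<le> - (a / (2 * K\<^sup>2)) * G"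
proof -
  have uv: "\<bar>(a / K) * (u \<bullet> v)\<bar> \<le> P / 2"
  proof -
    have "\<bar>(a / K) * (u \<bullet> v)\<bar> = (a / K) * \<bar>u \<bullet> v\<bar>" using a K by (simp add: abs_mult)
    also have "\<dots> \<le> \<rho> * (norm u * norm v)"
      using a K \<rho> by (intro mult_mono Cauchy_Schwarz_ineq2) (auto simp: field_simps)
    also have "\<dots> \<le> P / 2"
      using sum_squares_bound[of "\<rho> * norm u" "norm v"]
      by (simp add: P_def power2_norm_eq_inner[symmetric] power_mult_distrib)
    finally show ?thesis .
  qed
  have P0: "0 \<le> P" unfolding P_def by simp
  have uu: "0 \<le> (a\<^sup>2 / (2 * K)) * (u \<bullet> u)" using K by simp
  have aux: "P \<le> 2 * (P + x + y)" if "\<bar>x\<bar> \<le> P / 2" "0 \<le> y" for x y :: real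
  proof -
    have "- x \<le> P / 2" using abs_ge_minus_self[of x] that(1) by (rule order_trans)
    then show ?thesis using that(2) by (simp add: field_simps)
  qed
  show "P \<le> 2 * G" unfolding G_def by (rule aux[OF uv uu])
  then show "0 \<le> G" using P0 by linarith
  have "a\<^sup>2 \<le> K\<^sup>2 * \<rho>\<^sup>2" using a power_mono[OF a(2) a(1), of 2] by (simp add: power_mult_distrib)
  then have "(a\<^sup>2 / (2 * K)) * (u \<bullet> u) \<le> (K\<^sup>2 * \<rho>\<^sup>2 / (2 * K)) * (u \<bullet> u)"
    using K by (intro mult_right_mono divide_right_mono) auto
  also have "\<dots> = (K / 2) * (\<rho>\<^sup>2 * (u \<bullet> u))" using K by (simp add: power2_eq_square)
  also have "\<dots> \<le> (K / 2) * P" using K by (intro mult_left_mono) (auto simp: P_def)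
  finally have uu2: "(a\<^sup>2 / (2 * K)) * (u \<bullet> u) \<le> (K / 2) * P" .
  have uv2: "(a / K) * (u \<bullet> v) \<le> P / 2" using abs_ge_self uv by (rule order_trans)
  have eq: "(3 / 2 + K / 2) * P = P + P / 2 + (K / 2) * P" by (simp add: algebra_simps)
  have "G \<le> (3 / 2 + K / 2) * P" unfolding G_def eq by (intro add_mono order_refl uv2 uu2)
  \<comment> \<open>Here \<open>K \<ge> 1\<close> gives \<open>3 / 2 + K / 2 \<le> 2 * K\<close>.
    Comparing \<open>G\<close> with \<open>P\<close> thus reduces the rate from \<open>a / K\<close>
    to \<open>a / (2 * K\<^sup>2)\<close>.\<close>
  also have "\<dots> \<le> (2 * K) * P" using K P0 by (intro mult_right_mono) auto
  finally have "(a / (2 * K\<^sup>2)) * G \<le> (a / (2 * K\<^sup>2)) * ((2 * K) * P)"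
    using a by (intro mult_left_mono) auto
  also have "\<dots> = (a / K) * P" using K by (simp add: power2_eq_square)
  finally have 1: "(a / (2 * K\<^sup>2)) * G \<le> (a / K) * P" .
  have "a / K \<le> a" using a K divide_left_mono[of 1 K a] by simp
  then have *: "(a / K) * (v \<bullet> v) \<le> a * (v \<bullet> v)" by (intro mult_right_mono) auto
  show "- 2 * a * (v \<bullet> v) + (a / K) * (v \<bullet> v) - (a / K) * \<rho>\<^sup>2 * (u \<bullet> u) \<le> - (a / (2 * K\<^sup>2)) * G"
  proof -
    have "(a / K) * P = (a / K) * (v \<bullet> v) + (a / K) * \<rho>\<^sup>2 * (u \<bullet> u)"
      by (simp add: P_def distrib_left)
    with * 1 show ?thesis by linarith
  qed
qed

text \<open>The left-hand side is the time derivative of the perturbed energy, with $r = \rho^2$ and \<open>uu\<close>, \<open>uv\<close>, \<open>vv\<close> the inner products of $u$ and $v = u_t$.\<close>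

lemma lyapunov_derivative:
  fixes a K r uu uv vv :: real
  assumes "K \<noteq> 0"
  shows "2 * 1 * (- r * uv - a * vv) + 2 * (r + a\<^sup>2 / (2 * K)) * uv + a / K * (vv + (- r * uu - a * uv))
    = - 2 * a * vv + a / K * vv - a / K * r * uu"
  using assms by (simp add: field_simps power2_eq_square)

text \<open>The product rule for \<open>wdot\<close> makes the derivative of the integrated form the
  integral of the expression in \<open>le\<close>, although \<open>U\<close> and \<open>V\<close>
  are differentiable only as L^2-valued functions; Gronwall then applies. The wave equation enters
  only through \<open>le\<close>, so one lemma covers the energy with reversed sign and the
  perturbed energy.\<close>

lemma energy_form_decay:
  fixes U V V' :: "real \<Rightarrow> real^'n \<Rightarrow> complex"
  assumes m: "m1 \<in> borel_measurable lebesgue" "m2 \<in> borel_measurable lebesgue" "m3 \<in> borel_measurable lebesgue"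
    and b: "\<And>\<xi>. \<bar>m1 \<xi>\<bar> \<le> M" "\<And>\<xi>. \<bar>m2 \<xi>\<bar> \<le> M" "\<And>\<xi>. \<bar>m3 \<xi>\<bar> \<le> M"
    and sq: "\<And>t. t \<ge> 0 \<Longrightarrow> square_integrable (U t)" "\<And>t. t \<ge> 0 \<Longrightarrow> square_integrable (V t)"
      "\<And>t. t \<ge> 0 \<Longrightarrow> square_integrable (V' t)"
    and d: "\<And>t. t \<ge> 0 \<Longrightarrow> has_time_deriv U (V t) t" "\<And>t. t \<ge> 0 \<Longrightarrow> has_time_deriv V (V' t) t"
  defines "g \<equiv> \<lambda>t \<xi>. m1 \<xi> * (V t \<xi> \<bullet> V t \<xi>) + m2 \<xi> * (U t \<xi> \<bullet> U t \<xi>) + m3 \<xi> * (U t \<xi> \<bullet> V t \<xi>)"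
  assumes le: "\<And>t \<xi>. t \<ge> 0 \<Longrightarrow> 2 * m1 \<xi> * (V' t \<xi> \<bullet> V t \<xi>) + 2 * m2 \<xi> * (U t \<xi> \<bullet> V t \<xi>)
      + m3 \<xi> * (V t \<xi> \<bullet> V t \<xi> + U t \<xi> \<bullet> V' t \<xi>) \<le> - c * g t \<xi>" and T: "T \<ge> 0"
  shows "integrable lebesgue (g T)" "(LINT \<xi>|lebesgue. g T \<xi>) \<le> exp (- c * T) * (LINT \<xi>|lebesgue. g 0 \<xi>)"
proof -
  note i = wprod_integrable(1)[OF m(1) b(1)] wprod_integrable(1)[OF m(2) b(2)] wprod_integrable(1)[OF m(3) b(3)]
  define \<phi> where "\<phi> t = wdot m1 (V t) (V t) + wdot m2 (U t) (U t) + wdot m3 (U t) (V t)" for t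
  define \<phi>' where "\<phi>' t = (wdot m1 (V' t) (V t) + wdot m1 (V t) (V' t)) + (wdot m2 (V t) (U t) + wdot m2 (U t) (V t))
    + (wdot m3 (V t) (V t) + wdot m3 (U t) (V' t))" for t
  have g_eq: "g t = (\<lambda>\<xi>. wprod m1 (V t) (V t) \<xi> + wprod m2 (U t) (U t) \<xi> + wprod m3 (U t) (V t) \<xi>)" for t
    by (simp add: g_def wprod_def)
  have g_int: "integrable lebesgue (g t)" and \<phi>_g: "\<phi> t = (LINT \<xi>|lebesgue. g t \<xi>)" if "t \<ge> 0" for t
    unfolding g_eq \<phi>_def wdot_def using i(1)[OF sq(2,2)] i(2)[OF sq(1,1)] i(3)[OF sq(1,2)] that by simp_all
  show "integrable lebesgue (g T)" by (rule g_int[OF T])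
  have "\<phi> T \<le> exp (- c * T) * \<phi> 0"
  proof (rule exp_decay_comparison[OF _ _ T])
    fix t :: real assume t: "t \<ge> 0"
    show "(\<phi> has_real_derivative \<phi>' t) (at t within {0..})"
      unfolding \<phi>_def \<phi>'_def
      by (intro DERIV_add wdot_has_derivative[OF m(1) b(1)] wdot_has_derivative[OF m(2) b(2)]
          wdot_has_derivative[OF m(3) b(3)] t sq d)
    note sqt = sq[OF t]
    note ints = i(1)[OF sqt(3,2)] i(1)[OF sqt(2,3)] i(2)[OF sqt(2,1)] i(2)[OF sqt(1,2)] i(3)[OF sqt(2,2)] i(3)[OF sqt(1,3)]
    have "\<phi>' t = (LINT \<xi>|lebesgue. (wprod m1 (V' t) (V t) \<xi> + wprod m1 (V t) (V' t) \<xi>)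
        + (wprod m2 (V t) (U t) \<xi> + wprod m2 (U t) (V t) \<xi>) + (wprod m3 (V t) (V t) \<xi> + wprod m3 (U t) (V' t) \<xi>))"
      unfolding \<phi>'_def wdot_def using ints by simp
    also have "\<dots> \<le> (LINT \<xi>|lebesgue. - c * g t \<xi>)"
    proof (rule integral_mono)
      show "integrable lebesgue (\<lambda>\<xi>. - c * g t \<xi>)" using g_int[OF t] by (rule integrable_mult_right)
      show "(wprod m1 (V' t) (V t) \<xi> + wprod m1 (V t) (V' t) \<xi>)
        + (wprod m2 (V t) (U t) \<xi> + wprod m2 (U t) (V t) \<xi>) + (wprod m3 (V t) (V t) \<xi> + wprod m3 (U t) (V' t) \<xi>)
        \<le> - c * g t \<xi>" for \<xi>
      proof -
        have "V t \<xi> \<bullet> V' t \<xi> = V' t \<xi> \<bullet> V t \<xi>" "V t \<xi> \<bullet> U t \<xi> = U t \<xi> \<bullet> V t \<xi>"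
          by (rule inner_commute)+
        then show ?thesis using le[OF t, of \<xi>] by (simp add: wprod_def distrib_left)
      qed
    qed (use ints in auto)
    also have "\<dots> = - c * \<phi> t" unfolding \<phi>_g[OF t] by simp
    finally show "\<phi>' t \<le> - c * \<phi> t" .
  qed
  then show "(LINT \<xi>|lebesgue. g T \<xi>) \<le> exp (- c * T) * (LINT \<xi>|lebesgue. g 0 \<xi>)"
    by (simp add: \<phi>_g T)
qed

theorem damped_wave_energy:
  fixes U V :: "real \<Rightarrow> real^'n \<Rightarrow> complex" and \<rho> a :: "real^'n \<Rightarrow> real"
  assumes K: "K \<ge> 1"
    and \<rho>: "\<rho> \<in> borel_measurable lebesgue" "\<And>\<xi>. 0 \<le> \<rho> \<xi>" "\<And>\<xi>. \<rho> \<xi> \<le> R"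
    and a: "a \<in> borel_measurable lebesgue" "\<And>\<xi>. 0 \<le> a \<xi>" "\<And>\<xi>. a \<xi> \<le> K * \<rho> \<xi>"
    and U: "\<And>t. t \<ge> 0 \<Longrightarrow> square_integrable (U t)" "\<And>t. t \<ge> 0 \<Longrightarrow> has_time_deriv U (V t) t"
    and V: "\<And>t. t \<ge> 0 \<Longrightarrow> square_integrable (V t)"
      "\<And>t. t \<ge> 0 \<Longrightarrow> has_time_deriv V
        (\<lambda>\<xi>. - complex_of_real ((\<rho> \<xi>)\<^sup>2) * U t \<xi> - complex_of_real (a \<xi>) * V t \<xi>) t"
    and U0: "AE \<xi> in lebesgue. U 0 \<xi> = 0" and T: "T \<ge> 0"
  defines "P \<equiv> \<lambda>\<xi>. (norm (V T \<xi>))\<^sup>2 + (\<rho> \<xi>)\<^sup>2 * (norm (U T \<xi>))\<^sup>2"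
  shows "AE \<xi> in lebesgue. exp (- 2 * a \<xi> * T) * (norm (V 0 \<xi>))\<^sup>2 \<le> P \<xi>"
    "AE \<xi> in lebesgue. P \<xi> \<le> 2 * exp (- a \<xi> * T / (2 * K\<^sup>2)) * (norm (V 0 \<xi>))\<^sup>2"
proof -
  note [measurable] = \<rho>(1) a(1)
  define V' where "V' t \<xi> = - complex_of_real ((\<rho> \<xi>)\<^sup>2) * U t \<xi> - complex_of_real (a \<xi>) * V t \<xi>" for t \<xi>
  note dV = V(2)[folded V'_def]
  have R0: "0 \<le> R" using \<rho>(2,3) order_trans by blast
  have \<rho>2: "\<bar>(\<rho> \<xi>)\<^sup>2\<bar> \<le> R\<^sup>2" for \<xi> using \<rho> by (simp add: power_mono)
  have aR: "\<bar>a \<xi>\<bar> \<le> K * R" for \<xi>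
    using order_trans[OF a(3)[of \<xi>] mult_left_mono[OF \<rho>(3)[of \<xi>], of K]] a(2)[of \<xi>] K by simp
  have V'2: "square_integrable (V' t)" if "t \<ge> 0" for t
    unfolding V'_def[abs_def]
  proof (intro square_integrable_diff)
    show "square_integrable (\<lambda>\<xi>. - complex_of_real ((\<rho> \<xi>)\<^sup>2) * U t \<xi>)"
      by (rule square_integrable_mult_bounded(1)[where C = "R\<^sup>2", OF _ _ U(1)[OF that]])
        (use \<rho>2 in \<open>auto simp: norm_power\<close>)
    show "square_integrable (\<lambda>\<xi>. complex_of_real (a \<xi>) * V t \<xi>)"
      by (rule square_integrable_mult_bounded(1)[where C = "K * R", OF _ _ V(1)[OF that]]) (use aR in auto)
  qed
  have P_int: "integrable lebesgue P"
  proof -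
    have "integrable lebesgue (wprod (\<lambda>\<xi>. (\<rho> \<xi>)\<^sup>2) (U T) (U T))"
      by (rule wprod_integrable[OF _ \<rho>2 U(1)[OF T] U(1)[OF T]]) measurable
    then show ?thesis
      unfolding P_def wprod_def[abs_def] power2_norm_eq_inner[of "U T _"]
      using square_integrableD(2)[OF V(1)[OF T]] by simp
  qed
  note V0_int = square_integrableD(2)[OF V(1)[OF order_refl]]
  \<comment> \<open>A common bound for all weights: 1 for the kinetic part,
    \<open>R\<^sup>2 + (K * R)\<^sup>2\<close> for the potential part with its correction,
    \<open>K * R\<close> for the cross term.\<close>
  define M where "M = 1 + R\<^sup>2 + (K * R)\<^sup>2 + K * R"
  have KR: "0 \<le> K * R" using K R0 by simp
  have V'v: "V' t \<xi> \<bullet> V t \<xi> = - (\<rho> \<xi>)\<^sup>2 * (U t \<xi> \<bullet> V t \<xi>) - a \<xi> * (V t \<xi> \<bullet> V t \<xi>)"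
    and uV': "U t \<xi> \<bullet> V' t \<xi> = - (\<rho> \<xi>)\<^sup>2 * (U t \<xi> \<bullet> U t \<xi>) - a \<xi> * (U t \<xi> \<bullet> V t \<xi>)" for t \<xi>
    unfolding V'_def by (simp_all add: inner_diff_left inner_diff_right flip: scaleR_conv_of_real of_real_power)
  \<comment> \<open>Both weights are negated: on \<open>A\<close> the energy loses at most the rate
    \<open>2 * q\<close>, and for its negative this is the kind of upper differential inequality
    that Gronwall accepts.\<close>
  have lower: "exp (- (2 * q) * T) * (LINT \<xi>|lebesgue. indicator A \<xi> * (norm (V 0 \<xi>))\<^sup>2)
      \<le> (LINT \<xi>|lebesgue. indicator A \<xi> * P \<xi>)"
    if A: "A \<in> sets lebesgue" and Aq: "A \<subseteq> {\<xi>. a \<xi> \<le> q}" for A q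
  proof -
    note [measurable] = A
    define m1 where "m1 \<xi> = (- indicator A \<xi> :: real)" for \<xi> :: "real^'n"
    define m2 where "m2 \<xi> = - indicator A \<xi> * (\<rho> \<xi>)\<^sup>2" for \<xi>
    define g where "g t \<xi> = m1 \<xi> * (V t \<xi> \<bullet> V t \<xi>) + m2 \<xi> * (U t \<xi> \<bullet> U t \<xi>) + 0 * (U t \<xi> \<bullet> V t \<xi>)" for t \<xi>
    have b: "\<bar>m1 \<xi>\<bar> \<le> M" "\<bar>m2 \<xi>\<bar> \<le> M" "\<bar>0\<bar> \<le> M" for \<xi>
      using \<rho>2[of \<xi>] KR by (auto simp: m1_def m2_def M_def add_increasing2 split: split_indicator)
    have m: "m1 \<in> borel_measurable lebesgue" "m2 \<in> borel_measurable lebesgue" "(\<lambda>_. 0) \<in> borel_measurable lebesgue"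
      unfolding m1_def[abs_def] m2_def[abs_def] by measurable
    have decay: "(LINT \<xi>|lebesgue. g T \<xi>) \<le> exp (- (2 * q) * T) * (LINT \<xi>|lebesgue. g 0 \<xi>)"
    proof -
      have "2 * m1 \<xi> * (V' t \<xi> \<bullet> V t \<xi>) + 2 * m2 \<xi> * (U t \<xi> \<bullet> V t \<xi>) + 0 * (V t \<xi> \<bullet> V t \<xi> + U t \<xi> \<bullet> V' t \<xi>)
          \<le> - (2 * q) * g t \<xi>" for t \<xi>
      proof (cases "\<xi> \<in> A")
        case True
        then have aq: "a \<xi> \<le> q" using Aq by auto
        \<comment> \<open>A point of \<open>A\<close> exists in this case, and \<open>a\<close> is
          nonnegative there; this fixes the sign of \<open>q\<close>.\<close>
        then have q: "0 \<le> q" using a(2) order_trans by blast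
        have "2 * a \<xi> * (V t \<xi> \<bullet> V t \<xi>) \<le> 2 * q * (V t \<xi> \<bullet> V t \<xi>)" using aq by (intro mult_right_mono) auto
        moreover have "0 \<le> 2 * q * ((\<rho> \<xi>)\<^sup>2 * (U t \<xi> \<bullet> U t \<xi>))" using q by simp
        ultimately show ?thesis using True by (simp add: V'v g_def m1_def m2_def algebra_simps)
      qed (simp add: g_def m1_def m2_def)
      then show ?thesis
        using energy_form_decay(2)[OF m b U(1) V(1) V'2 U(2) dV _ T] unfolding g_def by blast
    qed
    \<comment> \<open>As \<open>U 0\<close> vanishes, the initial energy is purely kinetic.\<close>
    have "(LINT \<xi>|lebesgue. g 0 \<xi>) = - (LINT \<xi>|lebesgue. indicator A \<xi> * (norm (V 0 \<xi>))\<^sup>2)"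
      unfolding integral_minus[symmetric]
    proof (rule integral_cong_AE)
      show "AE \<xi> in lebesgue. g 0 \<xi> = - (indicator A \<xi> * (norm (V 0 \<xi>))\<^sup>2)"
        using U0 by eventually_elim (simp add: g_def m1_def power2_norm_eq_inner)
    qed (use m square_integrableD(1)[OF V(1)] square_integrableD(1)[OF U(1)] in \<open>simp_all add: g_def\<close>)
    moreover have "(LINT \<xi>|lebesgue. g T \<xi>) = - (LINT \<xi>|lebesgue. indicator A \<xi> * P \<xi>)"
      unfolding integral_minus[symmetric]
      by (simp add: g_def m1_def m2_def P_def power2_norm_eq_inner algebra_simps)
    ultimately show ?thesis using decay by simp
  qed
  have upper: "(LINT \<xi>|lebesgue. indicator A \<xi> * P \<xi>)
      \<le> 2 * exp (- (q / (2 * K\<^sup>2)) * T) * (LINT \<xi>|lebesgue. indicator A \<xi> * (norm (V 0 \<xi>))\<^sup>2)"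
    if A: "A \<in> sets lebesgue" and Aq: "A \<subseteq> {\<xi>. q \<le> a \<xi>}" for A q
  proof -
    note [measurable] = A
    define m1 where "m1 \<xi> = (indicator A \<xi> :: real)" for \<xi> :: "real^'n"
    define m2 where "m2 \<xi> = indicator A \<xi> * ((\<rho> \<xi>)\<^sup>2 + (a \<xi>)\<^sup>2 / (2 * K))" for \<xi>
    define m3 where "m3 \<xi> = indicator A \<xi> * (a \<xi> / K)" for \<xi>
    note ms = m1_def m2_def m3_def
    define g where "g t \<xi> = m1 \<xi> * (V t \<xi> \<bullet> V t \<xi>) + m2 \<xi> * (U t \<xi> \<bullet> U t \<xi>) + m3 \<xi> * (U t \<xi> \<bullet> V t \<xi>)" for t \<xi>
    have g_eq: "g t \<xi> = V t \<xi> \<bullet> V t \<xi> + (\<rho> \<xi>)\<^sup>2 * (U t \<xi> \<bullet> U t \<xi>)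
        + (a \<xi> / K) * (U t \<xi> \<bullet> V t \<xi>) + ((a \<xi>)\<^sup>2 / (2 * K)) * (U t \<xi> \<bullet> U t \<xi>)" if "\<xi> \<in> A" for t \<xi>
      using that by (simp add: g_def ms distrib_right)
    have aK: "a \<xi> / K \<le> K * R" "(a \<xi>)\<^sup>2 / (2 * K) \<le> (K * R)\<^sup>2" for \<xi>
    proof -
      have "a \<xi> / K \<le> a \<xi>" using K a(2)[of \<xi>] divide_left_mono[of 1 K "a \<xi>"] by simp
      then show "a \<xi> / K \<le> K * R" using aR[of \<xi>] by simp
      have "(a \<xi>)\<^sup>2 / (2 * K) \<le> (a \<xi>)\<^sup>2 / 1" using K by (intro divide_left_mono) auto
      also have "\<dots> \<le> (K * R)\<^sup>2" using aR[of \<xi>] a(2)[of \<xi>] by (simp add: power_mono)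
      finally show "(a \<xi>)\<^sup>2 / (2 * K) \<le> (K * R)\<^sup>2" .
    qed
    have b: "\<bar>m1 \<xi>\<bar> \<le> M" "\<bar>m2 \<xi>\<bar> \<le> M" "\<bar>m3 \<xi>\<bar> \<le> M" for \<xi>
    proof -
      have pos: "0 \<le> a \<xi> / K" "0 \<le> (a \<xi>)\<^sup>2 / (2 * K)" "0 \<le> R\<^sup>2" "0 \<le> (K * R)\<^sup>2" using a(2)[of \<xi>] K by auto
      have "0 \<le> (\<rho> \<xi>)\<^sup>2" "(\<rho> \<xi>)\<^sup>2 \<le> R\<^sup>2" using \<rho>2[of \<xi>] by auto
      with pos aK[of \<xi>] KR have le: "1 \<le> M" "(\<rho> \<xi>)\<^sup>2 + (a \<xi>)\<^sup>2 / (2 * K) \<le> M" "a \<xi> / K \<le> M"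
        and nn: "0 \<le> (\<rho> \<xi>)\<^sup>2 + (a \<xi>)\<^sup>2 / (2 * K)"
        unfolding M_def by linarith+
      have ind: "\<bar>indicator A \<xi> * x\<bar> \<le> M" if "0 \<le> x" "x \<le> M" for x :: real
        using that le(1) by (cases "\<xi> \<in> A") auto
      show "\<bar>m1 \<xi>\<bar> \<le> M" "\<bar>m2 \<xi>\<bar> \<le> M" "\<bar>m3 \<xi>\<bar> \<le> M"
        unfolding m2_def m3_def using ind[of 1] ind[OF nn le(2)] ind[OF pos(1) le(3)] le(1) by (simp_all add: m1_def)
    qed
    have m: "m1 \<in> borel_measurable lebesgue" "m2 \<in> borel_measurable lebesgue" "m3 \<in> borel_measurable lebesgue"
      unfolding m1_def[abs_def] m2_def[abs_def] m3_def[abs_def] by measurable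
    have decay: "integrable lebesgue (g T)"
      "(LINT \<xi>|lebesgue. g T \<xi>) \<le> exp (- (q / (2 * K\<^sup>2)) * T) * (LINT \<xi>|lebesgue. g 0 \<xi>)"
    proof -
      have "2 * m1 \<xi> * (V' t \<xi> \<bullet> V t \<xi>) + 2 * m2 \<xi> * (U t \<xi> \<bullet> V t \<xi>)
          + m3 \<xi> * (V t \<xi> \<bullet> V t \<xi> + U t \<xi> \<bullet> V' t \<xi>) \<le> - (q / (2 * K\<^sup>2)) * g t \<xi>" for t \<xi>
      proof (cases "\<xi> \<in> A")
        case True
        then have aq: "q \<le> a \<xi>" using Aq by auto
        note L = lyapunov_bounds[OF K \<rho>(2)[of \<xi>] a(2,3)[of \<xi>], of "V t \<xi>" "U t \<xi>"]
        \<comment> \<open>Replacing \<open>a\<close> by the smaller constant \<open>q\<close>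
          weakens the decay estimate because the perturbed energy is nonnegative.\<close>
        have "(q / (2 * K\<^sup>2)) * g t \<xi> \<le> (a \<xi> / (2 * K\<^sup>2)) * g t \<xi>"
          using aq L(2) unfolding g_eq[OF True] by (intro mult_right_mono divide_right_mono) auto
        moreover have "2 * m1 \<xi> * (V' t \<xi> \<bullet> V t \<xi>) + 2 * m2 \<xi> * (U t \<xi> \<bullet> V t \<xi>) + m3 \<xi> * (V t \<xi> \<bullet> V t \<xi> + U t \<xi> \<bullet> V' t \<xi>)
            = - 2 * a \<xi> * (V t \<xi> \<bullet> V t \<xi>) + (a \<xi> / K) * (V t \<xi> \<bullet> V t \<xi>) - (a \<xi> / K) * (\<rho> \<xi>)\<^sup>2 * (U t \<xi> \<bullet> U t \<xi>)"
        proof -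
          have ind1: "indicator A \<xi> = (1::real)" using True by simp
          show ?thesis
            unfolding ms ind1 V'v uV' mult_1 by (rule lyapunov_derivative) (use K in simp)
        qed
        ultimately show ?thesis using L(3) unfolding g_eq[OF True] by linarith
      qed (simp add: ms g_def)
      then show "integrable lebesgue (g T)"
        "(LINT \<xi>|lebesgue. g T \<xi>) \<le> exp (- (q / (2 * K\<^sup>2)) * T) * (LINT \<xi>|lebesgue. g 0 \<xi>)"
        using energy_form_decay[OF m b U(1) V(1) V'2 U(2) dV _ T] unfolding g_def by blast+
    qed
    moreover have "(LINT \<xi>|lebesgue. g 0 \<xi>) = (LINT \<xi>|lebesgue. indicator A \<xi> * (norm (V 0 \<xi>))\<^sup>2)"
    proof (rule integral_cong_AE)
      show "AE \<xi> in lebesgue. g 0 \<xi> = indicator A \<xi> * (norm (V 0 \<xi>))\<^sup>2"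
        using U0 by eventually_elim (simp add: g_def m1_def power2_norm_eq_inner)
    qed (use m square_integrableD(1)[OF V(1)] square_integrableD(1)[OF U(1)] in \<open>simp_all add: g_def\<close>)
    \<comment> \<open>The factor 2 of the upper bound is the constant in
      \<open>P \<le> 2 * G\<close>.\<close>
    moreover have "(LINT \<xi>|lebesgue. indicator A \<xi> * P \<xi>) \<le> (LINT \<xi>|lebesgue. 2 * g T \<xi>)"
    proof (rule integral_mono)
      show "integrable lebesgue (\<lambda>\<xi>. indicator A \<xi> * P \<xi>)"
        using integrable_mult_indicator[OF A P_int] by simp
      show "indicator A \<xi> * P \<xi> \<le> 2 * g T \<xi>" for \<xi>
      proof (cases "\<xi> \<in> A")
        case True
        then show ?thesis
          using lyapunov_bounds(1)[OF K \<rho>(2)[of \<xi>] a(2,3)[of \<xi>], of "V T \<xi>" "U T \<xi>"]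
          unfolding g_eq[OF True] P_def power2_norm_eq_inner by simp
      qed (simp add: g_def ms)
    qed (use decay(1) in simp)
    ultimately show ?thesis by simp
  qed
  have set_le: "{\<xi>. a \<xi> \<le> q} \<in> sets lebesgue" "{\<xi>. q \<le> a \<xi>} \<in> sets lebesgue" for q
  proof -
    have "{\<xi> \<in> space lebesgue. a \<xi> \<le> q} \<in> sets lebesgue" "{\<xi> \<in> space lebesgue. q \<le> a \<xi>} \<in> sets lebesgue"
      by measurable
    then show "{\<xi>. a \<xi> \<le> q} \<in> sets lebesgue" "{\<xi>. q \<le> a \<xi>} \<in> sets lebesgue" by simp_all
  qed
  have pull: "(LINT \<xi>|lebesgue. indicator A \<xi> * (c * (norm (V 0 \<xi>))\<^sup>2))
      = c * (LINT \<xi>|lebesgue. indicator A \<xi> * (norm (V 0 \<xi>))\<^sup>2)" for c :: real and A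
    unfolding integral_mult_right_zero[symmetric] by (simp only: mult.left_commute)
  \<comment> \<open>For fixed \<open>q\<close> the integral bounds over all subsets of the level set
    give a pointwise bound off a null set; restricting \<open>q\<close> to the rationals keeps the
    union of these sets null.\<close>
  have "AE \<xi> in lebesgue. \<forall>q\<in>\<rat>. \<xi> \<in> {\<xi>. a \<xi> \<le> q} \<longrightarrow> exp (- (2 * q) * T) * (norm (V 0 \<xi>))\<^sup>2 \<le> P \<xi>"
    unfolding AE_ball_countable[OF countable_rat]
    by (intro ballI AE_le_if_integrals_le integrable_mult_right V0_int P_int set_le)
      (use lower in \<open>simp_all add: pull\<close>)
  then show "AE \<xi> in lebesgue. exp (- 2 * a \<xi> * T) * (norm (V 0 \<xi>))\<^sup>2 \<le> P \<xi>"
  proof eventually_elim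
    case (elim \<xi>)
    have "exp (- (2 * a \<xi>) * T) * (norm (V 0 \<xi>))\<^sup>2 \<le> P \<xi>"
      by (rule isCont_le_if_Rats_le[where h = "\<lambda>q. exp (- (2 * q) * T) * (norm (V 0 \<xi>))\<^sup>2"])
        (use elim in \<open>auto intro!: continuous_intros\<close>)
    then show ?case by simp
  qed
  have "AE \<xi> in lebesgue. \<forall>q\<in>\<rat>. \<xi> \<in> {\<xi>. q \<le> a \<xi>} \<longrightarrow> P \<xi> \<le> 2 * exp (- (q / (2 * K\<^sup>2)) * T) * (norm (V 0 \<xi>))\<^sup>2"
    unfolding AE_ball_countable[OF countable_rat]
    by (intro ballI AE_le_if_integrals_le integrable_mult_right V0_int P_int set_le)
      (use upper in \<open>simp_all add: pull\<close>)
  then show "AE \<xi> in lebesgue. P \<xi> \<le> 2 * exp (- a \<xi> * T / (2 * K\<^sup>2)) * (norm (V 0 \<xi>))\<^sup>2"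
  proof eventually_elim
    case (elim \<xi>)
    \<comment> \<open>The rationals below \<open>a \<xi>\<close> are used here, and signs are
      reversed so that the inequality bounds the continuous function from above.\<close>
    have "- (2 * exp (- (a \<xi> / (2 * K\<^sup>2)) * T) * (norm (V 0 \<xi>))\<^sup>2) \<le> - P \<xi>"
    proof (rule isCont_le_if_Rats_le[where h = "\<lambda>q. - (2 * exp (- (q / (2 * K\<^sup>2)) * T) * (norm (V 0 \<xi>))\<^sup>2)"])
      show "isCont (\<lambda>q. - (2 * exp (- (q / (2 * K\<^sup>2)) * T) * (norm (V 0 \<xi>))\<^sup>2)) (a \<xi>)"
        using K by (intro continuous_intros) auto
    qed (use elim in \<open>intro disjI2, auto\<close>)
    then show ?case by simp
  qed
qed

section \<open>The Fourier transform of a mild solution\<close>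

definition log_symbol :: "real \<Rightarrow> real \<Rightarrow> real" where
  "log_symbol \<theta> r = ln (1 + r powr (2 * \<theta>))"

lemma ln_one_plus_ge:
  assumes "x \<ge> (0::real)"
  shows "x / (1 + x) \<le> ln (1 + x)"
proof -
  have "ln (1 / (1 + x)) \<le> 1 / (1 + x) - 1" by (rule ln_le_minus_one) (use assms in simp)
  then show ?thesis using assms by (simp add: ln_div field_simps)
qed

text \<open>The origin of \<open>K = 1 + 2 * \<theta>\<close>: for \<open>r \<le> 1\<close> the
  condition \<open>2 * \<theta> > 1\<close> gives \<open>r powr (2 * \<theta>) \<le> r\<close>, and
  for \<open>r \<ge> 1\<close> the symbol is at most \<open>ln 2 + 2 * \<theta> * ln r\<close>,
  where both \<open>ln 2\<close> and \<open>ln r\<close> are at most \<open>r\<close>. The power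
  bound from above serves the lower decay rate, the last two bounds serve the upper one on low and
  high frequencies.\<close>

lemma log_symbol_bounds:
  assumes \<theta>: "\<theta> > 1 / 2" and r: "r \<ge> 0"
  shows "0 \<le> log_symbol \<theta> r" "log_symbol \<theta> r \<le> r powr (2 * \<theta>)"
    "log_symbol \<theta> r \<le> (1 + 2 * \<theta>) * r"
    "r \<le> 1 \<Longrightarrow> r powr (2 * \<theta>) / 2 \<le> log_symbol \<theta> r"
    "r \<ge> 1 \<Longrightarrow> 1 / 2 \<le> log_symbol \<theta> r"
proof -
  let ?x = "r powr (2 * \<theta>)"
  show "0 \<le> log_symbol \<theta> r" by (simp add: log_symbol_def)
  show le: "log_symbol \<theta> r \<le> ?x"
    unfolding log_symbol_def by (rule ln_add_one_self_le_self) simp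
  have small: "?x \<le> r" if "r \<le> 1"
    using powr_mono'[of 1 "2 * \<theta>" r] that r \<theta> by simp
  show "log_symbol \<theta> r \<le> (1 + 2 * \<theta>) * r"
  proof (cases "r \<le> 1")
    case True
    have "log_symbol \<theta> r \<le> r" using le small[OF True] by simp
    also have "r \<le> (1 + 2 * \<theta>) * r" using \<theta> r by (simp add: algebra_simps)
    finally show ?thesis .
  next
    case False
    then have x1: "1 \<le> ?x" using \<theta> by (simp add: ge_one_powr_ge_zero)
    have "log_symbol \<theta> r \<le> ln (2 * ?x)" unfolding log_symbol_def
      by (subst ln_le_cancel_iff) (use x1 in auto)
    also have "\<dots> = ln 2 + 2 * \<theta> * ln r" using False by (simp add: ln_mult ln_powr)
    also have "\<dots> \<le> r + 2 * \<theta> * r"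
    proof (intro add_mono mult_left_mono)
      have "ln 2 \<le> (1::real)" using ln_le_minus_one[of "2::real"] by simp
      then show "ln 2 \<le> r" using False by simp
      show "ln r \<le> r" using ln_le_minus_one[of r] False by simp
    qed (use \<theta> in simp)
    finally show ?thesis by (simp add: algebra_simps)
  qed
  have h: "?x / (1 + ?x) \<le> log_symbol \<theta> r"
    unfolding log_symbol_def by (rule ln_one_plus_ge) simp
  show "?x / 2 \<le> log_symbol \<theta> r" if "r \<le> 1"
  proof -
    have "?x \<le> 1" using that r \<theta> by (simp add: powr_le1)
    then have "?x / 2 \<le> ?x / (1 + ?x)" by (intro divide_left_mono) (auto intro!: mult_pos_pos add_pos_nonneg)
    then show ?thesis using h by (rule order_trans)
  qed
  show "1 / 2 \<le> log_symbol \<theta> r" if "r \<ge> 1"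
  proof -
    have "1 \<le> ?x" using that \<theta> by (simp add: ge_one_powr_ge_zero)
    then have "1 / 2 \<le> ?x / (1 + ?x)" by (simp add: field_simps)
    then show ?thesis using h by (rule order_trans)
  qed
qed

section \<open>Time derivatives on the Fourier side\<close>

lemma has_time_deriv_mult_bounded:
  assumes m: "m \<in> borel_measurable lebesgue" "\<And>\<xi>. norm (m \<xi>) \<le> C" and f: "has_time_deriv f f' t"
  shows "has_time_deriv (\<lambda>s \<xi>. m \<xi> * f s \<xi>) (\<lambda>\<xi>. m \<xi> * f' \<xi>) t"
  using L2_tendsto_mult_bounded[OF m f[unfolded has_time_deriv_def]]
  by (simp add: has_time_deriv_def right_diff_distrib)

lemma has_time_deriv_add:
  fixes f g :: "real \<Rightarrow> real^'n \<Rightarrow> complex"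
  assumes f: "has_time_deriv f f' t" and g: "has_time_deriv g g' t"
  shows "has_time_deriv (\<lambda>s \<xi>. f s \<xi> + g s \<xi>) (\<lambda>\<xi>. f' \<xi> + g' \<xi>) t"
  using L2_tendsto_add[OF f[unfolded has_time_deriv_def] g[unfolded has_time_deriv_def]]
  by (simp add: has_time_deriv_def add_diff_add add_divide_distrib[symmetric])

text \<open>The time-independent summand \<open>c\<close> cancels in difference quotients; it stands
  for the initial datum in the mild equation.\<close>

lemma has_time_deriv_cong_AE:
  fixes f g :: "real \<Rightarrow> real^'n \<Rightarrow> complex"
  assumes f: "has_time_deriv f f' t" and t: "t \<ge> 0"
    and ae: "\<And>s. s \<ge> 0 \<Longrightarrow> AE \<xi> in lebesgue. g s \<xi> = c \<xi> + f s \<xi>"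
  shows "has_time_deriv g f' t"
  unfolding has_time_deriv_def
proof (rule L2_tendsto_cong_AE[OF f[unfolded has_time_deriv_def]])
  have "\<forall>\<^sub>F s in at t within {0..}. s \<ge> 0" by (simp add: eventually_at_filter)
  then show "\<forall>\<^sub>F s in at t within {0..}. AE \<xi> in lebesgue.
      (f s \<xi> - f t \<xi>) / complex_of_real (s - t) = (g s \<xi> - g t \<xi>) / complex_of_real (s - t)"
  proof eventually_elim
    case (elim s)
    show ?case using ae[OF elim] ae[OF t] by eventually_elim simp
  qed
qed simp

lemma has_time_deriv_fourier:
  fixes f :: "real \<Rightarrow> real^'n \<Rightarrow> complex"
  assumes f: "has_time_deriv f f' t" and t: "t \<ge> 0"
    and F: "\<And>s. s \<ge> 0 \<Longrightarrow> is_fourier (f s) (F s)" and F': "is_fourier f' F'"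
  shows "has_time_deriv F F' t"
  unfolding has_time_deriv_def
proof (rule is_fourier_tendsto[OF _ F' f[unfolded has_time_deriv_def]])
  have "\<forall>\<^sub>F s in at t within {0..}. s \<ge> 0" by (simp add: eventually_at_filter)
  then show "\<forall>\<^sub>F s in at t within {0..}. is_fourier (\<lambda>x. (f s x - f t x) / complex_of_real (s - t))
      (\<lambda>\<xi>. (F s \<xi> - F t \<xi>) / complex_of_real (s - t))"
  proof eventually_elim
    case (elim s)
    have "is_fourier (\<lambda>x. inverse (complex_of_real (s - t)) * (f s x - f t x))
      (\<lambda>\<xi>. inverse (complex_of_real (s - t)) * (F s \<xi> - F t \<xi>))"
      by (intro is_fourier_cmult is_fourier_diff F elim t)
    then show ?case by (simp add: divide_inverse mult.commute)
  qed
qed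

lemma borel_measurable_log_symbol [measurable]: "log_symbol \<theta> \<in> borel_measurable borel"
  unfolding log_symbol_def[abs_def] by measurable

text \<open>Transforms of L^2 functions are determined up to null sets depending on
  \<open>T\<close>, hence the existential form at a fixed time. Afterwards the bounds are only
  integrated over \<xi>, one time at a time.\<close>

theorem mild_solution_fourier:
  fixes u1 :: "real^'n \<Rightarrow> complex"
  assumes \<theta>: "\<theta> > 1 / 2" and u1: "square_integrable u1" "integrable lebesgue u1"
    and sol: "mild_solution \<theta> u1 u" and T: "T \<ge> 0"
  shows "\<exists>uh vh. is_fourier (u T) uh \<and> is_fourier (time_deriv u T) vh \<and>
    (AE \<xi> in lebesgue. exp (- 2 * log_symbol \<theta> (norm \<xi>) * T) * (norm (fourier u1 \<xi>))\<^sup>2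
        \<le> (norm (vh \<xi>))\<^sup>2 + (norm \<xi>)\<^sup>2 * (norm (uh \<xi>))\<^sup>2) \<and>
    (AE \<xi> in lebesgue. (norm (vh \<xi>))\<^sup>2 + (norm \<xi>)\<^sup>2 * (norm (uh \<xi>))\<^sup>2
        \<le> 2 * exp (- log_symbol \<theta> (norm \<xi>) * T / (2 * (1 + 2 * \<theta>)\<^sup>2)) * (norm (fourier u1 \<xi>))\<^sup>2)"
proof -
  define sb where "sb \<xi> = log_symbol \<theta> (norm \<xi>)" for \<xi> :: "real^'n"
  define v where "v = time_deriv u"
  obtain w where w: "\<And>t. t \<ge> 0 \<Longrightarrow> has_time_deriv w (u t) t"
    and eqn: "\<And>t. t \<ge> 0 \<Longrightarrow> \<exists>h g. has_laplacian (w t) h \<and> L_op \<theta> (u t) g \<and>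
             (AE x in lebesgue. v t x = u1 x + h x - g x)"
    using sol unfolding mild_solution_def v_def by blast
  have u: "square_integrable (u t)" if "t \<ge> 0" for t
    using sol that unfolding mild_solution_def H1_tendsto_def by (blast dest: L2_tendstoD(2))
  have v: "square_integrable (v t)" if "t \<ge> 0" for t
    using sol that unfolding mild_solution_def v_def by (blast dest: L2_tendstoD(2))
  have w2: "square_integrable (w t)" if "t \<ge> 0" for t
    using eqn[OF that] unfolding has_laplacian_def has_weak_gradient_def by blast
  have uv: "has_time_deriv u (v t) t" if "t \<ge> 0" for t
  proof -
    have "\<exists>v. has_time_deriv u v t" using sol that by (simp add: mild_solution_def)
    then show ?thesis unfolding v_def time_deriv_def by (rule someI_ex)
  qed
  define uh where "uh t = (SOME g. is_fourier (u t) g)" for t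
  have uh: "is_fourier (u t) (uh t)" if "t \<ge> 0" for t
    unfolding uh_def by (rule someI_ex[OF is_fourier_exists[OF u[OF that]]])
  define vh where "vh t = (SOME g. is_fourier (v t) g)" for t
  have vh: "is_fourier (v t) (vh t)" if "t \<ge> 0" for t
    unfolding vh_def by (rule someI_ex[OF is_fourier_exists[OF v[OF that]]])
  define wh where "wh t = (SOME g. is_fourier (w t) g)" for t
  have wh: "is_fourier (w t) (wh t)" if "t \<ge> 0" for t
    unfolding wh_def by (rule someI_ex[OF is_fourier_exists[OF w2[OF that]]])
  have duh: "has_time_deriv uh (vh t) t" if "t \<ge> 0" for t
    by (rule has_time_deriv_fourier[OF uv[OF that] that uh vh[OF that]])
  have dwh: "has_time_deriv wh (uh t) t" if "t \<ge> 0" for t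
    by (rule has_time_deriv_fourier[OF w[OF that] that wh uh[OF that]])
  have fu1: "is_fourier u1 (fourier u1)" by (rule is_fourier_fourier[OF u1(2,1)])
  \<comment> \<open>\<open>L_op\<close> brings a transform \<open>fh\<close> of \<open>u t\<close>
    of its own; uniqueness replaces it by the chosen \<open>uh t\<close> almost everywhere.\<close>
  have eqh: "AE \<xi> in lebesgue. vh t \<xi> = fourier u1 \<xi>
      + (- complex_of_real ((norm \<xi>)\<^sup>2) * wh t \<xi> - complex_of_real (sb \<xi>) * uh t \<xi>)" if t: "t \<ge> 0" for t
  proof -
    obtain h g where hg: "has_laplacian (w t) h" "L_op \<theta> (u t) g"
      "AE x in lebesgue. v t x = u1 x + h x - g x" using eqn[OF t] by blast
    obtain fh where fh: "is_fourier (u t) fh" "is_fourier g (\<lambda>\<xi>. complex_of_real (sb \<xi>) * fh \<xi>)"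
      using hg(2) unfolding L_op_def sb_def log_symbol_def by blast
    have "is_fourier (\<lambda>x. u1 x + h x - g x) (\<lambda>\<xi>. fourier u1 \<xi> + - complex_of_real ((norm \<xi>)\<^sup>2) * wh t \<xi>
        - complex_of_real (sb \<xi>) * fh \<xi>)"
      by (intro is_fourier_diff is_fourier_add fu1 fh is_fourier_laplacian[OF hg(1) wh[OF t]])
    moreover have "is_fourier (\<lambda>x. u1 x + h x - g x) (vh t)"
      by (rule is_fourier_cong_AE[OF vh[OF t] hg(3)]) simp
    ultimately have "AE \<xi> in lebesgue. vh t \<xi> = fourier u1 \<xi> + - complex_of_real ((norm \<xi>)\<^sup>2) * wh t \<xi>
        - complex_of_real (sb \<xi>) * fh \<xi>"
      by (intro is_fourier_unique)
    with is_fourier_unique[OF uh[OF t] fh(1)] show ?thesis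
      by eventually_elim simp
  qed
  have u0: "AE x in lebesgue. u 0 x = 0" and v0: "AE x in lebesgue. v 0 x = u1 x"
    using sol unfolding mild_solution_def v_def by auto
  have uh0: "AE \<xi> in lebesgue. uh 0 \<xi> = 0"
    by (rule is_fourier_unique[OF is_fourier_cong_AE[OF uh[OF order_refl] u0] is_fourier_zero]) simp
  have vh0: "AE \<xi> in lebesgue. vh 0 \<xi> = fourier u1 \<xi>"
    by (rule is_fourier_unique[OF is_fourier_cong_AE[OF vh[OF order_refl] v0] fu1]) simp
  have K: "1 \<le> 1 + 2 * \<theta>" using \<theta> by simp
  have sb_m: "sb \<in> borel_measurable borel" unfolding sb_def[abs_def] by measurable
  have sb: "0 \<le> sb \<xi>" "sb \<xi> \<le> (1 + 2 * \<theta>) * norm \<xi>" for \<xi>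
    unfolding sb_def using log_symbol_bounds[OF \<theta>, of "norm \<xi>"] by auto
  define P where "P \<xi> = (norm (vh T \<xi>))\<^sup>2 + (norm \<xi>)\<^sup>2 * (norm (uh T \<xi>))\<^sup>2" for \<xi>
  define lo where "lo \<xi> = exp (- 2 * sb \<xi> * T) * (norm (fourier u1 \<xi>))\<^sup>2" for \<xi>
  define up where "up \<xi> = 2 * exp (- sb \<xi> * T / (2 * (1 + 2 * \<theta>)\<^sup>2)) * (norm (fourier u1 \<xi>))\<^sup>2" for \<xi>
  have bounds: "(AE \<xi> in lebesgue. norm \<xi> \<le> real N \<longrightarrow> lo \<xi> \<le> P \<xi>) \<and>
    (AE \<xi> in lebesgue. norm \<xi> \<le> real N \<longrightarrow> P \<xi> \<le> up \<xi>)" for N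
  proof -
    define I where "I \<xi> = (indicator (cball 0 (real N)) \<xi> :: real)" for \<xi> :: "real^'n"
    have I_m[measurable]: "I \<in> borel_measurable borel"
      unfolding I_def[abs_def] by (intro borel_measurable_indicator borel_closed) auto
    have I: "0 \<le> I \<xi>" "I \<xi> \<le> 1" "I \<xi> * I \<xi> = I \<xi>" for \<xi> by (auto simp: I_def split: split_indicator)
    note [measurable] = sb_m
    \<comment> \<open>Truncating \<rho> and the symbol by the same indicator makes both bounded and
      keeps the inequality between them.\<close>
    define \<rho> where "\<rho> \<xi> = I \<xi> * norm \<xi>" for \<xi>
    define a where "a \<xi> = I \<xi> * sb \<xi>" for \<xi>
    have \<rho>_le: "\<rho> \<xi> \<le> real N" for \<xi> by (auto simp: \<rho>_def I_def split: split_indicator)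
    have a_le: "a \<xi> \<le> (1 + 2 * \<theta>) * \<rho> \<xi>" for \<xi>
      using sb(2)[of \<xi>] by (auto simp: \<rho>_def a_def I_def split: split_indicator)
    define U where "U t \<xi> = complex_of_real (I \<xi>) * uh t \<xi>" for t \<xi>
    define V where "V t \<xi> = complex_of_real (I \<xi>) * vh t \<xi>" for t \<xi>
    have mI: "(\<lambda>\<xi>. complex_of_real (I \<xi>)) \<in> borel_measurable lebesgue" "\<And>\<xi>. norm (complex_of_real (I \<xi>)) \<le> 1"
      using I by (auto intro: borel_lebesgue)
    have m\<rho>: "(\<lambda>\<xi>. - complex_of_real ((\<rho> \<xi>)\<^sup>2)) \<in> borel_measurable lebesgue"
      "\<And>\<xi>. norm (- complex_of_real ((\<rho> \<xi>)\<^sup>2)) \<le> (real N)\<^sup>2"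
    proof -
      have "(\<lambda>\<xi>. - complex_of_real ((\<rho> \<xi>)\<^sup>2)) \<in> borel_measurable borel"
        unfolding \<rho>_def by measurable
      then show "(\<lambda>\<xi>. - complex_of_real ((\<rho> \<xi>)\<^sup>2)) \<in> borel_measurable lebesgue" by (rule borel_lebesgue)
      show "norm (- complex_of_real ((\<rho> \<xi>)\<^sup>2)) \<le> (real N)\<^sup>2" for \<xi>
        unfolding norm_minus_cancel norm_of_real abs_power2
        by (rule power_mono[OF \<rho>_le]) (simp add: \<rho>_def I)
    qed
    have ma: "(\<lambda>\<xi>. - complex_of_real (a \<xi>)) \<in> borel_measurable lebesgue"
      "\<And>\<xi>. norm (- complex_of_real (a \<xi>)) \<le> (1 + 2 * \<theta>) * real N"
    proof -
      have "(\<lambda>\<xi>. - complex_of_real (a \<xi>)) \<in> borel_measurable borel"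
        unfolding a_def by measurable
      then show "(\<lambda>\<xi>. - complex_of_real (a \<xi>)) \<in> borel_measurable lebesgue" by (rule borel_lebesgue)
      show "norm (- complex_of_real (a \<xi>)) \<le> (1 + 2 * \<theta>) * real N" for \<xi>
      proof -
        have "0 \<le> a \<xi>" by (simp add: a_def I sb)
        moreover have "(1 + 2 * \<theta>) * \<rho> \<xi> \<le> (1 + 2 * \<theta>) * real N"
          using K by (intro mult_left_mono \<rho>_le) simp
        ultimately show ?thesis using a_le[of \<xi>] by simp
      qed
    qed
    have dU: "has_time_deriv U (V t) t" if "t \<ge> 0" for t
      unfolding U_def[abs_def] V_def[abs_def] by (rule has_time_deriv_mult_bounded[OF mI duh[OF that]])
    \<comment> \<open>The truncated mild equation shows \<open>V\<close> to be differentiable: up to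
      the constant datum it is a combination of \<open>wh\<close> and \<open>uh\<close> with bounded
      multipliers.\<close>
    have dV: "has_time_deriv V (\<lambda>\<xi>. - complex_of_real ((\<rho> \<xi>)\<^sup>2) * U t \<xi> - complex_of_real (a \<xi>) * V t \<xi>) t"
      if t: "t \<ge> 0" for t
    proof (rule has_time_deriv_cong_AE[OF _ t])
      have "has_time_deriv (\<lambda>s \<xi>. - complex_of_real ((\<rho> \<xi>)\<^sup>2) * wh s \<xi> + - complex_of_real (a \<xi>) * uh s \<xi>)
          (\<lambda>\<xi>. - complex_of_real ((\<rho> \<xi>)\<^sup>2) * uh t \<xi> + - complex_of_real (a \<xi>) * vh t \<xi>) t"
        by (intro has_time_deriv_add has_time_deriv_mult_bounded[OF m\<rho>] has_time_deriv_mult_bounded[OF ma] duh dwh t)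
      \<comment> \<open>The multipliers already contain the indicator, which is idempotent, so
        \<open>uh\<close> and \<open>vh\<close> may be replaced by \<open>U\<close> and
        \<open>V\<close>.\<close>
      also have "(\<lambda>\<xi>. - complex_of_real ((\<rho> \<xi>)\<^sup>2) * uh t \<xi> + - complex_of_real (a \<xi>) * vh t \<xi>)
          = (\<lambda>\<xi>. - complex_of_real ((\<rho> \<xi>)\<^sup>2) * U t \<xi> - complex_of_real (a \<xi>) * V t \<xi>)"
        by (rule ext) (auto simp: \<rho>_def a_def U_def V_def I_def split: split_indicator)
      finally show "has_time_deriv (\<lambda>s \<xi>. - complex_of_real ((\<rho> \<xi>)\<^sup>2) * wh s \<xi> + - complex_of_real (a \<xi>) * uh s \<xi>)
          (\<lambda>\<xi>. - complex_of_real ((\<rho> \<xi>)\<^sup>2) * U t \<xi> - complex_of_real (a \<xi>) * V t \<xi>) t" .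
      show "AE \<xi> in lebesgue. V s \<xi> = complex_of_real (I \<xi>) * fourier u1 \<xi>
          + (- complex_of_real ((\<rho> \<xi>)\<^sup>2) * wh s \<xi> + - complex_of_real (a \<xi>) * uh s \<xi>)" if "s \<ge> 0" for s
        using eqh[OF that]
        by eventually_elim (auto simp: V_def \<rho>_def a_def I_def split: split_indicator)
    qed
    have U0: "AE \<xi> in lebesgue. U 0 \<xi> = 0" using uh0 by eventually_elim (simp add: U_def)
    have \<rho>_m: "\<rho> \<in> borel_measurable lebesgue" and a_m: "a \<in> borel_measurable lebesgue"
      unfolding \<rho>_def[abs_def] a_def[abs_def] by (rule borel_lebesgue, measurable)+
    have \<rho>0: "0 \<le> \<rho> \<xi>" and a0: "0 \<le> a \<xi>" for \<xi> by (simp_all add: \<rho>_def a_def I sb)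
    have U2: "square_integrable (U t)" and V2: "square_integrable (V t)" if "t \<ge> 0" for t
      unfolding U_def[abs_def] V_def[abs_def]
      by (intro square_integrable_mult_bounded(1)[OF mI] is_fourierD(2)[OF uh[OF that]] is_fourierD(2)[OF vh[OF that]])+
    have E: "AE \<xi> in lebesgue. exp (- 2 * a \<xi> * T) * (norm (V 0 \<xi>))\<^sup>2
        \<le> (norm (V T \<xi>))\<^sup>2 + (\<rho> \<xi>)\<^sup>2 * (norm (U T \<xi>))\<^sup>2"
      "AE \<xi> in lebesgue. (norm (V T \<xi>))\<^sup>2 + (\<rho> \<xi>)\<^sup>2 * (norm (U T \<xi>))\<^sup>2
        \<le> 2 * exp (- a \<xi> * T / (2 * (1 + 2 * \<theta>)\<^sup>2)) * (norm (V 0 \<xi>))\<^sup>2"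
      using damped_wave_energy[OF K \<rho>_m \<rho>0 \<rho>_le a_m a0 a_le, of U V, OF U2 dU V2 dV U0 T] by blast+
    show ?thesis
    proof
      show "AE \<xi> in lebesgue. norm \<xi> \<le> real N \<longrightarrow> lo \<xi> \<le> P \<xi>"
        using E(1) vh0 by eventually_elim (auto simp: U_def V_def \<rho>_def a_def I_def lo_def P_def)
      show "AE \<xi> in lebesgue. norm \<xi> \<le> real N \<longrightarrow> P \<xi> \<le> up \<xi>"
        using E(2) vh0 by eventually_elim (auto simp: U_def V_def \<rho>_def a_def I_def up_def P_def)
    qed
  qed
  have ex: "\<exists>N. norm \<xi> \<le> real N" for \<xi> :: "real^'n" by (rule real_arch_simple)
  have "AE \<xi> in lebesgue. \<forall>N. norm \<xi> \<le> real N \<longrightarrow> lo \<xi> \<le> P \<xi>"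
    unfolding AE_all_countable using bounds by blast
  then have 1: "AE \<xi> in lebesgue. lo \<xi> \<le> P \<xi>"
    by eventually_elim (use ex in blast)
  have "AE \<xi> in lebesgue. \<forall>N. norm \<xi> \<le> real N \<longrightarrow> P \<xi> \<le> up \<xi>"
    unfolding AE_all_countable using bounds by blast
  then have 2: "AE \<xi> in lebesgue. P \<xi> \<le> up \<xi>"
    by eventually_elim (use ex in blast)
  from 1 2 uh[OF T] vh[OF T] show ?thesis unfolding P_def lo_def up_def sb_def v_def by blast
qed

section \<open>Decay rates\<close>

lemma integrable_exp_abs:
  assumes l: "l > 0"
  shows "integrable lborel (\<lambda>x::real. exp (- l * \<bar>x\<bar>))"
proof -
  define h where "h x = indicator {0..} x *\<^sub>R exp (- x)" for x :: real
  have h: "integrable lborel h"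
  proof (rule integrableI_bounded)
    have "ennreal (norm (h x)) = ennreal (x ^ 0 * exp (- x)) * indicator {0..} x" for x
      by (simp add: h_def split: split_indicator)
    then have "(\<integral>\<^sup>+x. ennreal (norm (h x)) \<partial>lborel) = 1"
      using nn_intergal_power_times_exp_Ici[of 0] by simp
    then show "(\<integral>\<^sup>+x. ennreal (norm (h x)) \<partial>lborel) < \<infinity>" by simp
  next
    show "h \<in> borel_measurable lborel" unfolding h_def[abs_def] by measurable
  qed
  then have h': "integrable lborel (\<lambda>x. h (- x))" using lborel_integrable_real_affine[OF h, of "-1" 0] by simp
  have "integrable lborel (\<lambda>x::real. exp (- \<bar>x\<bar>))"
  proof (rule Bochner_Integration.integrable_bound)
    show "integrable lborel (\<lambda>x. h x + h (- x))" using h h' by simp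
    show "AE x in lborel. norm (exp (- \<bar>x\<bar>)) \<le> norm (h x + h (- x))"
      by (rule AE_I2) (auto simp: h_def split: split_indicator)
  qed measurable
  from lborel_integrable_real_affine[OF this, of l 0] show ?thesis using l by (simp add: abs_mult)
qed

text \<open>The norm is at least the mean of the absolute coordinates, so a product of
  one-dimensional exponentials of rate \<kappa> over the dimension dominates.\<close>

lemma integrable_exp_norm:
  assumes k: "\<kappa> > 0"
  shows "integrable lborel (\<lambda>x::'a::euclidean_space. exp (- \<kappa> * norm x))"
proof -
  interpret P: product_sigma_finite "\<lambda>_::'a. lborel :: real measure" by standard
  define l where "l = \<kappa> / real DIM('a)"
  have l: "l > 0" using k by (simp add: l_def)
  have m[measurable]: "(\<lambda>f. \<Sum>b\<in>Basis. f b *\<^sub>R b) \<in> (\<Pi>\<^sub>M b\<in>Basis. lborel) \<rightarrow>\<^sub>M (borel :: 'a measure)"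
    by measurable
  have comp: "(\<Prod>b\<in>Basis. exp (- l * \<bar>(\<Sum>b\<in>Basis. f b *\<^sub>R b) \<bullet> b\<bar>)) = (\<Prod>b\<in>Basis. exp (- l * \<bar>f b\<bar>))"
    for f :: "'a \<Rightarrow> real"
    by (intro prod.cong) auto
  have hm: "(\<lambda>x::'a. \<Prod>b\<in>Basis. exp (- l * \<bar>x \<bullet> b\<bar>)) \<in> borel_measurable borel" by measurable
  have i: "integrable lborel (\<lambda>x::'a. \<Prod>b\<in>Basis. exp (- l * \<bar>x \<bullet> b\<bar>))"
    by (subst lborel_eq, subst integrable_distr_eq[OF m hm], unfold comp)
      (intro P.product_integrable_prod integrable_exp_abs[OF l] finite_Basis)
  show ?thesis
  proof (rule Bochner_Integration.integrable_bound[OF i])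
    show "AE x::'a in lborel. norm (exp (- \<kappa> * norm x)) \<le> norm (\<Prod>b\<in>Basis. exp (- l * \<bar>x \<bullet> b\<bar>))"
    proof (rule AE_I2)
      fix x :: 'a
      have "l * (\<Sum>b\<in>Basis. \<bar>x \<bullet> b\<bar>) \<le> l * (\<Sum>b\<in>(Basis::'a set). norm x)"
        using l by (intro mult_left_mono sum_mono Basis_le_norm) auto
      also have "\<dots> = \<kappa> * norm x" by (simp add: l_def)
      finally have "exp (- \<kappa> * norm x) \<le> exp (\<Sum>b\<in>Basis. - l * \<bar>x \<bullet> b\<bar>)"
        by (simp add: sum_distrib_left sum_negf)
      then show "norm (exp (- \<kappa> * norm x)) \<le> norm (\<Prod>b\<in>Basis. exp (- l * \<bar>x \<bullet> b\<bar>))"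
        by (simp add: exp_sum prod_nonneg)
    qed
  qed measurable
qed

lemma powr_real_power: "(T powr p) ^ n = T powr (p * real n)" if "T > 0" for T p :: real
  using that powr_realpow[of "T powr p" n] by (simp add: powr_powr)

text \<open>Rescaling by \<open>s = T powr (1 / (2 * \<theta>))\<close> absorbs \<open>T\<close>
  into the norm, and the volume factor of this substitution is the claimed power of
  \<open>T\<close>.\<close>

lemma exp_powr_integral_bound:
  fixes \<theta> \<kappa> :: real
  assumes \<theta>: "\<theta> > 1 / 2" and k: "\<kappa> > 0"
  shows "\<exists>C\<ge>0. \<forall>T>0. integrable lborel (\<lambda>\<xi>::real^'n. exp (- \<kappa> * (T * norm \<xi> powr (2 * \<theta>)))) \<and>
    (LINT \<xi>::real^'n|lborel. exp (- \<kappa> * (T * norm \<xi> powr (2 * \<theta>)))) \<le> C * T powr (- (real CARD('n) / (2 * \<theta>)))"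
proof -
  define g where "g \<xi> = exp (- \<kappa> * norm \<xi>)" for \<xi> :: "real^'n"
  have gm[measurable]: "g \<in> borel_measurable borel" unfolding g_def by measurable
  have gi: "integrable lborel g" unfolding g_def by (rule integrable_exp_norm[OF k])
  define C where "C = exp \<kappa> * (LINT \<xi>|lborel. g \<xi>)"
  have C: "0 \<le> C" by (simp add: C_def g_def)
  show ?thesis
  proof (intro exI[of _ C] conjI allI impI C)
    fix T :: real assume T: "T > 0"
    define s where "s = T powr (1 / (2 * \<theta>))"
    have s: "s > 0" using T by (simp add: s_def)
    have le: "exp (- \<kappa> * (T * norm \<xi> powr (2 * \<theta>))) \<le> exp \<kappa> * g (s *\<^sub>R \<xi>)" for \<xi>
    proof -
      let ?y = "s * norm \<xi>"
      have "T * norm \<xi> powr (2 * \<theta>) = ?y powr (2 * \<theta>)"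
        using T s \<theta> by (simp add: powr_mult s_def powr_powr)
      \<comment> \<open>A linear lower bound, by \<open>2 * \<theta> \<ge> 1\<close> for
        \<open>?y \<ge> 1\<close> and trivially otherwise; the subtracted 1 costs the factor
        \<open>exp \<kappa>\<close> in \<open>C\<close>.\<close>
      also have "\<dots> \<ge> ?y - 1"
      proof (cases "?y \<ge> 1")
        case True
        then have "?y powr 1 \<le> ?y powr (2 * \<theta>)" using \<theta> by (intro powr_mono) auto
        then show ?thesis using True by simp
      next
        case False
        have "0 \<le> ?y powr (2 * \<theta>)" by simp
        then show ?thesis using False by linarith
      qed
      finally have "\<kappa> * (?y - 1) \<le> \<kappa> * (T * norm \<xi> powr (2 * \<theta>))" using k by simp
      then show ?thesis
        using s by (simp add: g_def exp_add[symmetric] algebra_simps)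
    qed
    have gsi: "integrable lborel (\<lambda>\<xi>. exp \<kappa> * g (s *\<^sub>R \<xi>))"
      by (intro integrable_mult_right lborel_integrable_scaleR gm s gi)
    show i: "integrable lborel (\<lambda>\<xi>::real^'n. exp (- \<kappa> * (T * norm \<xi> powr (2 * \<theta>))))"
      by (rule Bochner_Integration.integrable_bound[OF gsi]) (use le in \<open>auto simp: g_def\<close>)
    have "(LINT \<xi>::real^'n|lborel. exp (- \<kappa> * (T * norm \<xi> powr (2 * \<theta>)))) \<le> (LINT \<xi>|lborel. exp \<kappa> * g (s *\<^sub>R \<xi>))"
      by (rule integral_mono[OF i gsi le])
    also have "\<dots> = exp \<kappa> * ((LINT \<xi>|lborel. g \<xi>) / s ^ CARD('n))"
      using lborel_integral_scaleR[OF gm s] s by simp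
    also have "\<dots> = C * T powr (- (real CARD('n) / (2 * \<theta>)))"
    proof -
      have "s ^ CARD('n) = T powr (real CARD('n) / (2 * \<theta>))"
        unfolding s_def powr_real_power[OF T] by simp
      then have "T powr (- (real CARD('n) / (2 * \<theta>))) = 1 / s ^ CARD('n)"
        by (simp only: powr_minus_divide)
      then show ?thesis by (simp only: C_def) simp
    qed
    finally show "(LINT \<xi>::real^'n|lborel. exp (- \<kappa> * (T * norm \<xi> powr (2 * \<theta>))))
        \<le> C * T powr (- (real CARD('n) / (2 * \<theta>)))" .
  qed
qed

section \<open>From pointwise bounds to the energy norm\<close>

lemma mild_solution_energy:
  fixes u1 :: "real^'n \<Rightarrow> complex"
  assumes sol: "mild_solution \<theta> u1 u" and T: "T \<ge> 0"
    and uh: "is_fourier (u T) uh" and vh: "is_fourier (time_deriv u T) vh"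
  shows "integrable lebesgue (\<lambda>\<xi>. (norm (vh \<xi>))\<^sup>2 + (norm \<xi>)\<^sup>2 * (norm (uh \<xi>))\<^sup>2)"
    "(LINT \<xi>|lebesgue. (norm (vh \<xi>))\<^sup>2 + (norm \<xi>)\<^sup>2 * (norm (uh \<xi>))\<^sup>2) =
      (2 * pi) ^ CARD('n) * ((L2_norm (time_deriv u T))\<^sup>2 + (L2_norm (weak_gradient (u T)))\<^sup>2)"
proof -
  have "in_H1 (u T)" using sol T unfolding mild_solution_def H1_tendsto_def by blast
  then have "has_weak_gradient (u T) (weak_gradient (u T))"
    unfolding in_H1_def weak_gradient_def by (rule someI_ex)
  note G = weak_gradient_fourier_norm[OF this uh]
  note V = is_fourierD[OF vh]
  have V2: "(LINT \<xi>|lebesgue. (norm (vh \<xi>))\<^sup>2) = (2 * pi) ^ CARD('n) * (L2_norm (time_deriv u T))\<^sup>2"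
    unfolding L2_norm_power2[symmetric] V(3) by (simp add: power_mult_distrib)
  show "integrable lebesgue (\<lambda>\<xi>. (norm (vh \<xi>))\<^sup>2 + (norm \<xi>)\<^sup>2 * (norm (uh \<xi>))\<^sup>2)"
    by (intro Bochner_Integration.integrable_add G square_integrableD(2) V)
  show "(LINT \<xi>|lebesgue. (norm (vh \<xi>))\<^sup>2 + (norm \<xi>)\<^sup>2 * (norm (uh \<xi>))\<^sup>2) =
      (2 * pi) ^ CARD('n) * ((L2_norm (time_deriv u T))\<^sup>2 + (L2_norm (weak_gradient (u T)))\<^sup>2)"
    using Bochner_Integration.integral_add[OF square_integrableD(2)[OF V(2)] G(1)]
    by (simp add: V2 G(2) distrib_left)
qed

abbreviation energy_norm :: "(real \<Rightarrow> real^'n \<Rightarrow> complex) \<Rightarrow> real \<Rightarrow> real" where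
  "energy_norm u t \<equiv> L2_norm (time_deriv u t) + L2_norm (weak_gradient (u t))"

text \<open>On the ball of radius \<open>T powr (- (1 / (2 * \<theta>)))\<close> the symbol times
  \<open>T\<close> is at most 1, and once the ball lies inside the \<delta>-ball the transform of
  the datum is at least half its value at 0 in modulus. Only \<delta>, the scale of continuity at 0,
  depends on the datum; \<open>m\<close> does not.\<close>

lemma energy_lower_bound:
  fixes \<theta> :: real
  assumes \<theta>: "\<theta> > 1 / 2"
  shows "\<exists>m>0. \<forall>(u1 :: real^'n \<Rightarrow> complex) u. square_integrable u1 \<longrightarrow> integrable lebesgue u1 \<longrightarrow>
    mild_solution \<theta> u1 u \<longrightarrow>
    (\<exists>\<delta>>0. \<forall>T>0. T powr (- (1 / (2 * \<theta>))) \<le> \<delta> \<longrightarrow>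
      m * norm (LINT x|lebesgue. u1 x) * T powr (- (real CARD('n) / (4 * \<theta>)))
        \<le> energy_norm u T)"
proof -
  define c where "c = (2 * pi) ^ CARD('n)"
  define Vn where "Vn = unit_ball_vol (real CARD('n))"
  \<comment> \<open>\<open>exp (- 2)\<close> is the least damping factor on the ball, 1/4 comes from
    the square of \<open>P1 / 2\<close>, \<open>Vn\<close> from the volume of the ball, and
    \<open>c\<close> from Plancherel.\<close>
  define m where "m = sqrt (exp (- 2) / 4 * Vn / c)"
  have c: "c > 0" and Vn: "Vn > 0" by (simp_all add: c_def Vn_def)
  have m: "m > 0" using c Vn by (simp add: m_def)
  show ?thesis
  proof (rule exI[of _ m], intro conjI m allI impI)
    fix u1 :: "real^'n \<Rightarrow> complex" and u
    assume u2: "square_integrable u1" and u1: "integrable lebesgue u1" and sol: "mild_solution \<theta> u1 u"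
    define P1 where "P1 = norm (LINT x|lebesgue. u1 x)"
    have "\<exists>\<delta>>0. \<forall>\<xi>. norm \<xi> \<le> \<delta> \<longrightarrow> P1 / 2 \<le> norm (fourier u1 \<xi>)"
    proof (cases "P1 = 0")
      case False
      then have P1: "P1 > 0" by (simp add: P1_def)
      have f0: "norm (fourier u1 0) = P1" by (simp add: fourier_def P1_def)
      have "isCont (fourier u1) 0"
        using continuous_on_fourier[OF u1] by (simp add: continuous_on_eq_continuous_at)
      then have "((\<lambda>\<xi>. norm (fourier u1 \<xi>)) \<longlongrightarrow> P1) (at 0)"
        unfolding isCont_def f0[symmetric] by (rule tendsto_norm)
      then have "\<forall>\<^sub>F \<xi> in at 0. P1 / 2 < norm (fourier u1 \<xi>)"
        by (rule order_tendstoD) (use P1 in simp)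
      then obtain d where d: "d > 0" "\<And>\<xi>. \<xi> \<noteq> 0 \<Longrightarrow> norm \<xi> < d \<Longrightarrow> P1 / 2 < norm (fourier u1 \<xi>)"
        unfolding eventually_at by auto
      show ?thesis
      proof (intro exI[of _ "d / 2"] conjI allI impI)
        fix \<xi> :: "real^'n" assume "norm \<xi> \<le> d / 2"
        then show "P1 / 2 \<le> norm (fourier u1 \<xi>)"
          using d P1 f0 by (cases "\<xi> = 0") (auto intro: less_imp_le)
      qed (use d in simp)
    qed (auto intro: exI[of _ 1])
    then obtain \<delta> where \<delta>: "\<delta> > 0" "\<And>\<xi>. norm \<xi> \<le> \<delta> \<Longrightarrow> P1 / 2 \<le> norm (fourier u1 \<xi>)" by blast
    show "\<exists>\<delta>>0. \<forall>T>0. T powr (- (1 / (2 * \<theta>))) \<le> \<delta> \<longrightarrow>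
      m * norm (LINT x|lebesgue. u1 x) * T powr (- (real CARD('n) / (4 * \<theta>)))
        \<le> energy_norm u T"
    proof (intro exI[of _ \<delta>] conjI \<delta>(1) allI impI)
      fix T :: real assume T: "T > 0" and Td: "T powr (- (1 / (2 * \<theta>))) \<le> \<delta>"
      define r where "r = T powr (- (1 / (2 * \<theta>)))"
      have r: "r > 0" using T by (simp add: r_def)
      obtain uh vh where uh: "is_fourier (u T) uh" and vh: "is_fourier (time_deriv u T) vh"
        and low: "AE \<xi> in lebesgue. exp (- 2 * log_symbol \<theta> (norm \<xi>) * T) * (norm (fourier u1 \<xi>))\<^sup>2
          \<le> (norm (vh \<xi>))\<^sup>2 + (norm \<xi>)\<^sup>2 * (norm (uh \<xi>))\<^sup>2"
        using mild_solution_fourier[OF \<theta> u2 u1 sol, of T] T by auto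
      note E = mild_solution_energy[OF sol less_imp_le[OF T] uh vh]
      define X where "X = L2_norm (time_deriv u T)"
      define Y where "Y = L2_norm (weak_gradient (u T))"
      have XY: "0 \<le> X" "0 \<le> Y" by (simp_all add: X_def Y_def)
      define B where "B = exp (- 2) * (P1 / 2)\<^sup>2"
      have fin: "emeasure lborel (cball (0::real^'n) r) < \<infinity>" by (rule emeasure_lborel_cball_finite)
      have "Vn * r ^ CARD('n) * B = (LINT \<xi>::real^'n|lebesgue. indicator (cball 0 r) \<xi> * B)"
        using content_cball[of r "0::real^'n"] r fin by (simp add: Vn_def)
      also have "\<dots> \<le> (LINT \<xi>|lebesgue. (norm (vh \<xi>))\<^sup>2 + (norm \<xi>)\<^sup>2 * (norm (uh \<xi>))\<^sup>2)"
      proof (rule integral_mono_AE[OF _ E(1)])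
        show "integrable lebesgue (\<lambda>\<xi>::real^'n. indicator (cball 0 r) \<xi> * B)"
          by (intro integrable_mult_left integrable_real_indicator) (use fin in auto)
        show "AE \<xi> in lebesgue. indicator (cball 0 r) \<xi> * B \<le> (norm (vh \<xi>))\<^sup>2 + (norm \<xi>)\<^sup>2 * (norm (uh \<xi>))\<^sup>2"
          using low
        proof eventually_elim
          case (elim \<xi>)
          show ?case
          proof (cases "norm \<xi> \<le> r")
            case True
            have "log_symbol \<theta> (norm \<xi>) \<le> norm \<xi> powr (2 * \<theta>)" by (rule log_symbol_bounds[OF \<theta>]) simp
            also have "\<dots> \<le> r powr (2 * \<theta>)" using True \<theta> by (intro powr_mono2) auto
            also have "\<dots> = T powr (- 1)" using \<theta> by (simp add: r_def powr_powr)
            also have "\<dots> = 1 / T" using T by (simp add: powr_minus_divide)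
            finally have "log_symbol \<theta> (norm \<xi>) * T \<le> 1" using T by (simp add: field_simps)
            then have "exp (- 2) \<le> exp (- 2 * log_symbol \<theta> (norm \<xi>) * T)" by simp
            moreover have "(P1 / 2)\<^sup>2 \<le> (norm (fourier u1 \<xi>))\<^sup>2"
              using \<delta>(2)[of \<xi>] True Td by (intro power_mono) (auto simp: r_def P1_def)
            ultimately have "B \<le> exp (- 2 * log_symbol \<theta> (norm \<xi>) * T) * (norm (fourier u1 \<xi>))\<^sup>2"
              unfolding B_def by (intro mult_mono) auto
            then show ?thesis using elim True by simp
          qed simp
        qed
      qed
      also have "\<dots> = c * (X\<^sup>2 + Y\<^sup>2)" unfolding E(2) c_def X_def Y_def ..
      also have "\<dots> \<le> c * (X + Y)\<^sup>2"
        using c XY by (intro mult_left_mono) (auto simp: power2_sum)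
      finally have le: "Vn * r ^ CARD('n) * B / c \<le> (X + Y)\<^sup>2" using c by (simp add: field_simps)
      have rn: "r ^ CARD('n) = (T powr (- (real CARD('n) / (4 * \<theta>))))\<^sup>2"
        using T by (simp add: r_def powr_real_power field_simps)
      have "m\<^sup>2 = exp (- 2) / 4 * Vn / c" unfolding m_def using c Vn by simp
      then have "(m * P1 * T powr (- (real CARD('n) / (4 * \<theta>))))\<^sup>2 = Vn * r ^ CARD('n) * B / c"
        by (simp add: rn B_def power_mult_distrib power_divide)
      from this le have "(m * P1 * T powr (- (real CARD('n) / (4 * \<theta>))))\<^sup>2 \<le> (X + Y)\<^sup>2"
        by (rule ord_eq_le_trans)
      then have "m * P1 * T powr (- (real CARD('n) / (4 * \<theta>))) \<le> X + Y"
        by (rule power2_le_imp_le) (use XY in simp)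
      then show "m * norm (LINT x|lebesgue. u1 x) * T powr (- (real CARD('n) / (4 * \<theta>)))
        \<le> energy_norm u T"
        by (simp add: P1_def X_def Y_def)
    qed
  qed
qed

text \<open>The condition relating \<open>exp (- \<kappa> * T)\<close> to a power of
  \<open>T\<close> absorbs the exponentially small high frequencies into the polynomial rate. It
  involves only the dimension and \<theta>, apart from \<open>T\<close>.\<close>

lemma energy_upper_bound:
  fixes \<theta> :: real
  assumes \<theta>: "\<theta> > 1 / 2"
  shows "\<exists>M>0. \<exists>\<kappa>>0. \<forall>(u1 :: real^'n \<Rightarrow> complex) u T. square_integrable u1 \<longrightarrow> integrable lebesgue u1 \<longrightarrow>
    mild_solution \<theta> u1 u \<longrightarrow> T > 0 \<longrightarrow> exp (- \<kappa> * T) \<le> T powr (- (real CARD('n) / (2 * \<theta>))) \<longrightarrow>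
      energy_norm u T
        \<le> M * ((LINT x|lebesgue. norm (u1 x)) + L2_norm u1) * T powr (- (real CARD('n) / (4 * \<theta>)))"
proof -
  define c where "c = (2 * pi) ^ CARD('n)"
  define K where "K = 1 + 2 * \<theta>"
  \<comment> \<open>Half of the rate \<open>1 / (2 * K\<^sup>2)\<close> in the energy bound, the
    other half being lost in the factors 1/2 of the lower bounds for the symbol.\<close>
  define \<kappa> where "\<kappa> = 1 / (4 * K\<^sup>2)"
  have c: "c > 0" by (simp add: c_def)
  have K: "K > 0" using \<theta> by (simp add: K_def)
  have k: "\<kappa> > 0" using K by (simp add: \<kappa>_def)
  obtain C where C: "C \<ge> 0" "\<And>T. T > 0 \<Longrightarrow> integrable lborel (\<lambda>\<xi>::real^'n. exp (- \<kappa> * (T * norm \<xi> powr (2 * \<theta>))))"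
    "\<And>T. T > 0 \<Longrightarrow> (LINT \<xi>::real^'n|lborel. exp (- \<kappa> * (T * norm \<xi> powr (2 * \<theta>)))) \<le> C * T powr (- (real CARD('n) / (2 * \<theta>)))"
    using exp_powr_integral_bound[OF \<theta> k] by blast
  \<comment> \<open>The outer 2 is the one in
    \<open>(X + Y)\<^sup>2 \<le> 2 * (X\<^sup>2 + Y\<^sup>2)\<close>. Inside, \<open>2 * C\<close>
    accounts for the low frequencies and \<open>2 * c\<close> for the high ones, and the division by
    \<open>c\<close> undoes Plancherel.\<close>
  define M where "M = sqrt (2 * (2 * C + 2 * c) / c)"
  have M: "M > 0" using C(1) c by (simp add: M_def add_nonneg_pos)
  show ?thesis
  proof (rule exI[of _ M], rule conjI[OF M], rule exI[of _ \<kappa>], rule conjI[OF k], intro allI impI)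
    fix u1 :: "real^'n \<Rightarrow> complex" and u T
    assume u2: "square_integrable u1" and u1: "integrable lebesgue u1" and sol: "mild_solution \<theta> u1 u"
      and T: "T > 0" and Te: "exp (- \<kappa> * T) \<le> T powr (- (real CARD('n) / (2 * \<theta>)))"
    obtain uh vh where uh: "is_fourier (u T) uh" and vh: "is_fourier (time_deriv u T) vh"
      and up: "AE \<xi> in lebesgue. (norm (vh \<xi>))\<^sup>2 + (norm \<xi>)\<^sup>2 * (norm (uh \<xi>))\<^sup>2
        \<le> 2 * exp (- log_symbol \<theta> (norm \<xi>) * T / (2 * K\<^sup>2)) * (norm (fourier u1 \<xi>))\<^sup>2"
      using mild_solution_fourier[OF \<theta> u2 u1 sol, of T] T unfolding K_def by auto
    note E = mild_solution_energy[OF sol less_imp_le[OF T] uh vh]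
    define X where "X = L2_norm (time_deriv u T)"
    define Y where "Y = L2_norm (weak_gradient (u T))"
    define N1 where "N1 = (LINT x|lebesgue. norm (u1 x))"
    define N2 where "N2 = L2_norm u1"
    define q where "q = T powr (- (real CARD('n) / (2 * \<theta>)))"
    have N: "0 \<le> N1" "0 \<le> N2" by (simp_all add: N1_def N2_def)
    define g where "g \<xi> = exp (- \<kappa> * (T * norm \<xi> powr (2 * \<theta>)))" for \<xi> :: "real^'n"
    have gm: "g \<in> borel_measurable borel" unfolding g_def by measurable
    have gi: "integrable lebesgue g"
      using C(2)[OF T] gm unfolding g_def[abs_def, symmetric] by (simp add: integrable_completion)
    have gC: "(LINT \<xi>|lebesgue. g \<xi>) \<le> C * q"
      using C(3)[OF T] gm unfolding g_def[symmetric] q_def by (simp add: integral_completion)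
    have fi: "integrable lebesgue (\<lambda>\<xi>. (norm (fourier u1 \<xi>))\<^sup>2)"
      by (rule square_integrableD(2)[OF Plancherel(1)[OF u1 u2]])
    have f2: "(LINT \<xi>|lebesgue. (norm (fourier u1 \<xi>))\<^sup>2) = c * N2\<^sup>2"
      unfolding L2_norm_power2[symmetric] Plancherel(2)[OF u1 u2] by (simp add: power_mult_distrib c_def N2_def)
    \<comment> \<open>The first summand covers \<open>|\<xi>| \<le> 1\<close>, where the transform
      is bounded by the L^1 norm; the second covers the rest, where the transform is kept for its
      L^2 norm. Their sum bounds both cases.\<close>
    have pt: "2 * exp (- log_symbol \<theta> (norm \<xi>) * T / (2 * K\<^sup>2)) * (norm (fourier u1 \<xi>))\<^sup>2
        \<le> 2 * N1\<^sup>2 * g \<xi> + 2 * exp (- \<kappa> * T) * (norm (fourier u1 \<xi>))\<^sup>2" for \<xi>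
    proof -
      let ?r = "norm \<xi>"
      let ?F = "(norm (fourier u1 \<xi>))\<^sup>2"
      have F: "0 \<le> ?F" "?F \<le> N1\<^sup>2"
        using norm_fourier_le[of u1 \<xi>] unfolding N1_def by (auto intro: power_mono)
      have eq: "log_symbol \<theta> ?r * T / (2 * K\<^sup>2) = 2 * \<kappa> * (log_symbol \<theta> ?r * T)"
        by (simp add: \<kappa>_def)
      show ?thesis
      proof (cases "?r \<le> 1")
        case True
        have "?r powr (2 * \<theta>) / 2 * T \<le> log_symbol \<theta> ?r * T"
          using log_symbol_bounds(4)[OF \<theta> _ True] T by (intro mult_right_mono) auto
        then have "2 * \<kappa> * (?r powr (2 * \<theta>) / 2 * T) \<le> 2 * \<kappa> * (log_symbol \<theta> ?r * T)"
          by (rule mult_left_mono) (use k in simp)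
        moreover have "\<kappa> * (T * ?r powr (2 * \<theta>)) = 2 * \<kappa> * (?r powr (2 * \<theta>) / 2 * T)" by simp
        ultimately have "\<kappa> * (T * ?r powr (2 * \<theta>)) \<le> log_symbol \<theta> ?r * T / (2 * K\<^sup>2)"
          unfolding eq by metis
        then have "exp (- log_symbol \<theta> ?r * T / (2 * K\<^sup>2)) \<le> g \<xi>" by (simp add: g_def)
        then have "2 * exp (- log_symbol \<theta> ?r * T / (2 * K\<^sup>2)) * ?F \<le> 2 * g \<xi> * N1\<^sup>2"
          using F by (intro mult_mono) (auto simp: g_def)
        then show ?thesis using F by (simp add: mult_ac add_increasing2)
      next
        case False
        have "1 / 2 * T \<le> log_symbol \<theta> ?r * T"
          using log_symbol_bounds(5)[OF \<theta>, of ?r] False T by (intro mult_right_mono) auto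
        then have "2 * \<kappa> * (1 / 2 * T) \<le> 2 * \<kappa> * (log_symbol \<theta> ?r * T)"
          by (rule mult_left_mono) (use k in simp)
        then have "\<kappa> * T \<le> log_symbol \<theta> ?r * T / (2 * K\<^sup>2)"
          unfolding eq by simp
        then have "exp (- log_symbol \<theta> ?r * T / (2 * K\<^sup>2)) \<le> exp (- \<kappa> * T)" by simp
        then have "2 * exp (- log_symbol \<theta> ?r * T / (2 * K\<^sup>2)) * ?F \<le> 2 * exp (- \<kappa> * T) * ?F"
          using F by (intro mult_right_mono) auto
        moreover have "0 \<le> 2 * N1\<^sup>2 * g \<xi>" by (simp add: g_def)
        ultimately show ?thesis by linarith
      qed
    qed
    have "c * (X\<^sup>2 + Y\<^sup>2) = (LINT \<xi>|lebesgue. (norm (vh \<xi>))\<^sup>2 + (norm \<xi>)\<^sup>2 * (norm (uh \<xi>))\<^sup>2)"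
      unfolding E(2) c_def X_def Y_def ..
    also have "\<dots> \<le> (LINT \<xi>|lebesgue. 2 * N1\<^sup>2 * g \<xi> + 2 * exp (- \<kappa> * T) * (norm (fourier u1 \<xi>))\<^sup>2)"
    proof (rule integral_mono_AE[OF E(1)])
      show "integrable lebesgue (\<lambda>\<xi>. 2 * N1\<^sup>2 * g \<xi> + 2 * exp (- \<kappa> * T) * (norm (fourier u1 \<xi>))\<^sup>2)"
        by (intro Bochner_Integration.integrable_add integrable_mult_right gi fi)
      show "AE \<xi> in lebesgue. (norm (vh \<xi>))\<^sup>2 + (norm \<xi>)\<^sup>2 * (norm (uh \<xi>))\<^sup>2
          \<le> 2 * N1\<^sup>2 * g \<xi> + 2 * exp (- \<kappa> * T) * (norm (fourier u1 \<xi>))\<^sup>2"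
        using up by eventually_elim (use pt order_trans in blast)
    qed
    also have "\<dots> = 2 * N1\<^sup>2 * (LINT \<xi>|lebesgue. g \<xi>) + 2 * exp (- \<kappa> * T) * (c * N2\<^sup>2)"
      unfolding f2[symmetric] integral_mult_right_zero[symmetric]
      by (intro Bochner_Integration.integral_add integrable_mult_right gi fi)
    also have "\<dots> \<le> 2 * N1\<^sup>2 * (C * q) + 2 * q * (c * N2\<^sup>2)"
      using gC Te c by (intro add_mono mult_left_mono mult_right_mono) (auto simp: q_def)
    also have "\<dots> \<le> (2 * C + 2 * c) * (N1 + N2)\<^sup>2 * q"
    proof -
      have q: "0 \<le> q" by (simp add: q_def)
      have "0 \<le> (2 * C * (N2\<^sup>2 + 2 * N1 * N2) + 2 * c * (N1\<^sup>2 + 2 * N1 * N2)) * q"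
        using q C(1) c N by (intro mult_nonneg_nonneg add_nonneg_nonneg) auto
      then show ?thesis by (simp add: power2_sum algebra_simps)
    qed
    finally have le: "X\<^sup>2 + Y\<^sup>2 \<le> (2 * C + 2 * c) / c * (N1 + N2)\<^sup>2 * q"
      using c by (simp add: field_simps)
    have q: "q = (T powr (- (real CARD('n) / (4 * \<theta>))))\<^sup>2"
      using T by (simp add: q_def powr_real_power field_simps)
    have "M\<^sup>2 = 2 * (2 * C + 2 * c) / c" unfolding M_def using c C(1) by simp
    then have M2: "(M * (N1 + N2) * T powr (- (real CARD('n) / (4 * \<theta>))))\<^sup>2 = 2 * ((2 * C + 2 * c) / c * (N1 + N2)\<^sup>2 * q)"
      unfolding q by (simp add: power_mult_distrib)
    have "(X + Y)\<^sup>2 \<le> 2 * (X\<^sup>2 + Y\<^sup>2)"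
      using sum_squares_bound[of X Y] by (simp add: power2_sum)
    also have "\<dots> \<le> 2 * ((2 * C + 2 * c) / c * (N1 + N2)\<^sup>2 * q)"
      using le by (rule mult_left_mono) simp
    finally have "(X + Y)\<^sup>2 \<le> (M * (N1 + N2) * T powr (- (real CARD('n) / (4 * \<theta>))))\<^sup>2"
      unfolding M2 .
    then have "X + Y \<le> M * (N1 + N2) * T powr (- (real CARD('n) / (4 * \<theta>)))"
      by (rule power2_le_imp_le) (use M N in simp)
    then show "energy_norm u T
        \<le> M * ((LINT x|lebesgue. norm (u1 x)) + L2_norm u1) * T powr (- (real CARD('n) / (4 * \<theta>)))"
      by (simp add: X_def Y_def N1_def N2_def)
  qed
qed

theorem theorem1p3:
  fixes \<theta> :: real
  assumes "\<theta> > 1 / 2"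
  shows "\<exists>C>0. \<forall>(u1 :: real^'n \<Rightarrow> complex) u.
           square_integrable u1 \<longrightarrow> L11 u1 \<longrightarrow> mild_solution \<theta> u1 u \<longrightarrow>
           (\<forall>\<^sub>F t in at_top.
              C * norm (LINT x|lebesgue. u1 x) * t powr (- (real CARD('n) / (4 * \<theta>)))
                \<le> L2_norm (time_deriv u t) + L2_norm (weak_gradient (u t)) \<and>
              L2_norm (time_deriv u t) + L2_norm (weak_gradient (u t))
                \<le> inverse C * (L11_norm u1 + L2_norm u1) * t powr (- (real CARD('n) / (4 * \<theta>))))"
proof -
  obtain m where m: "m > 0" and lower: "\<And>(u1 :: real^'n \<Rightarrow> complex) u. square_integrable u1 \<Longrightarrow>
      integrable lebesgue u1 \<Longrightarrow> mild_solution \<theta> u1 u \<Longrightarrow>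
    (\<exists>\<delta>>0. \<forall>T>0. T powr (- (1 / (2 * \<theta>))) \<le> \<delta> \<longrightarrow>
      m * norm (LINT x|lebesgue. u1 x) * T powr (- (real CARD('n) / (4 * \<theta>)))
        \<le> energy_norm u T)"
    using energy_lower_bound[OF assms, where 'n = 'n] by blast
  obtain M \<kappa> where M: "M > 0" and k: "\<kappa> > 0" and upper: "\<And>(u1 :: real^'n \<Rightarrow> complex) u T. square_integrable u1 \<Longrightarrow>
      integrable lebesgue u1 \<Longrightarrow> mild_solution \<theta> u1 u \<Longrightarrow> T > 0 \<Longrightarrow>
      exp (- \<kappa> * T) \<le> T powr (- (real CARD('n) / (2 * \<theta>))) \<Longrightarrow>
      energy_norm u T
        \<le> M * ((LINT x|lebesgue. norm (u1 x)) + L2_norm u1) * T powr (- (real CARD('n) / (4 * \<theta>)))"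
    using energy_upper_bound[OF assms, where 'n = 'n] by blast
  \<comment> \<open>One constant serves both sides: decreasing it weakens the lower bound, and its
    inverse then exceeds \<open>M\<close>.\<close>
  define C where "C = min m (inverse M)"
  have C: "C > 0" "C \<le> m" "M \<le> inverse C"
  proof -
    show C0: "C > 0" using m M by (simp add: C_def)
    show "C \<le> m" by (simp add: C_def)
    have "inverse (inverse M) \<le> inverse C" using C0 by (intro le_imp_inverse_le) (simp_all add: C_def)
    then show "M \<le> inverse C" by simp
  qed
  show ?thesis
  proof (intro exI[of _ C] conjI C(1) allI impI)
    fix u1 :: "real^'n \<Rightarrow> complex" and u
    assume u2: "square_integrable u1" and L: "L11 u1" and sol: "mild_solution \<theta> u1 u"
    have u1: "integrable lebesgue u1" and w1: "integrable lebesgue (\<lambda>x. (1 + norm x) * norm (u1 x))"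
      using L by (auto simp: L11_def)
    have N1: "(LINT x|lebesgue. norm (u1 x)) \<le> L11_norm u1"
      unfolding L11_norm_def
    proof (rule integral_mono[OF _ w1])
      show "integrable lebesgue (\<lambda>x. norm (u1 x))" using u1 by simp
      show "norm (u1 x) \<le> (1 + norm x) * norm (u1 x)" for x
        using mult_right_mono[of 1 "1 + norm x" "norm (u1 x)"] by simp
    qed
    obtain \<delta> where \<delta>: "\<delta> > 0" "\<And>T. T > 0 \<Longrightarrow> T powr (- (1 / (2 * \<theta>))) \<le> \<delta> \<Longrightarrow>
      m * norm (LINT x|lebesgue. u1 x) * T powr (- (real CARD('n) / (4 * \<theta>)))
        \<le> energy_norm u T"
      using lower[OF u2 u1 sol] by blast
    \<comment> \<open>Two thresholds in time: the first depends on the datum through \<delta>, the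
      second only on the dimension and \<theta>.\<close>
    have "((\<lambda>T. T powr (- (1 / (2 * \<theta>)))) \<longlongrightarrow> 0) at_top"
      by (rule tendsto_neg_powr) (use assms in \<open>auto simp: filterlim_ident\<close>)
    then have "\<forall>\<^sub>F T in at_top. T powr (- (1 / (2 * \<theta>))) < \<delta>"
      by (rule order_tendstoD) (rule \<delta>(1))
    moreover have "\<forall>\<^sub>F T in at_top. exp (- \<kappa> * T) \<le> T powr (- (real CARD('n) / (2 * \<theta>)))"
      using k by real_asymp
    ultimately show "\<forall>\<^sub>F t in at_top.
        C * norm (LINT x|lebesgue. u1 x) * t powr (- (real CARD('n) / (4 * \<theta>)))
          \<le> energy_norm u t \<and>
        energy_norm u t
          \<le> inverse C * (L11_norm u1 + L2_norm u1) * t powr (- (real CARD('n) / (4 * \<theta>)))"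
      using eventually_gt_at_top[of 0]
    proof eventually_elim
      case (elim t)
      let ?p = "t powr (- (real CARD('n) / (4 * \<theta>)))"
      have "C * norm (LINT x|lebesgue. u1 x) * ?p \<le> m * norm (LINT x|lebesgue. u1 x) * ?p"
        using C(2) by (intro mult_right_mono) auto
      moreover have "M * ((LINT x|lebesgue. norm (u1 x)) + L2_norm u1) * ?p
          \<le> inverse C * (L11_norm u1 + L2_norm u1) * ?p"
        using C N1 M by (intro mult_right_mono mult_mono add_mono) (auto intro!: add_nonneg_nonneg)
      ultimately show ?case
        using \<delta>(2)[of t] upper[OF u2 u1 sol, of t] elim by linarith
    qed
  qed
qed

end
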